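(* Let $\mathcal{M}$ be a Riemannian manifold modeled on a Hilbert space and let $p\in\Omega\subset\mathcal{M}$. Then for all $v\in T_p\mathcal{M}$, $$d^-_{\Omega}(p;v)\le\operatorname{dist}(v;\hat T^{\mathcal{M}}_{\Omega}(p)),$$ where $d^-_\Omega(p;v)$ is the contingent directional derivative of $\operatorname{dist}(\cdot;\Omega)$ at $p$ in the direction $v$. If it is further assumed that $\mathcal{M}$ is finite dimensional, then equality holds.
   Context: A Riemannian manifold $\mathcal{M}$ here is a $C^\infty$ manifold modeled on a (possibly infinite-dimensional) real Hilbert space, with a smooth Riemannian metric $g$ such that for each $p$ the norm $\|x\|_p=g_p(x,x)^{1/2}$ on $T_p\mathcal{M}$ is equivalent to the model norm. In any metric space, $\operatorname{dist}(x;A):=\inf_{a\in A}d(x,a)$; in $\mathcal{M}$ it is taken with respect to the Riemannian distance, and in $T_p\mathcal{M}$ with respect to $\|\cdot\|_p$. $\exp_p$ is the exponential map on a sufficiently small neighborhood of $0$ in $T_p\mathcal{M}$. For $f:\mathcal{M}\to\mathbb{R}\cup\{\infty\}$ finite at $p$ and $v\in T_p\mathcal{M}$, the contingent directional derivative is $$f^-(p;v):=\liminf_{w\to v,\ t\downarrow0}\frac{f(\exp_p(tw))-f(p)}{t},$$ with $w\in T_p\mathcal{M}$; and $d^-_\Omega(p;v)$ is $f^-(p;v)$ for $f=\operatorname{dist}(\cdot;\Omega)$. The contingent cone of $\Omega$ at $p\in\operatorname{cl}\Omega$ is $\hat T^{\mathcal{M}}_\Omega(p):=\{v\in T_p\mathcal{M}:\exists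 v_i\in T_p\mathcal{M},\ t_i\downarrow0\text{ such that }v_i\to v,\ \exp_p(t_iv_i)\in\Omega\}$. *)

theory Defs
  imports "HOL-Analysis.Analysis"
begin

section \<open>Smooth maps between normed spaces of arbitrary dimension\<close>

definition bounded_multilinear ::
    "nat \<Rightarrow> ('a::real_normed_vector list \<Rightarrow> 'b::real_normed_vector) \<Rightarrow> bool" where
  "bounded_multilinear k M \<longleftrightarrow>
     (\<forall>us vs. length us + length vs + 1 = k \<longrightarrow> linear (\<lambda>x. M (us @ x # vs))) \<and>
     (\<exists>C. \<forall>vs. length vs = k \<longrightarrow> norm (M vs) \<le> C * prod_list (map norm vs))"

text \<open>
  Infinite Frechet differentiability on an open set \<open>S\<close>.  The iterated derivatives live in
  spaces of \<open>k\<close>-linear maps whose types vary with \<open>k\<close>; they are therefore encoded in a single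
  function \<open>D\<close>, where \<open>D x [v\<^sub>1, \<dots>, v\<^sub>k]\<close> is the \<open>k\<close>-th derivative of \<open>f\<close> at \<open>x\<close> applied to
  \<open>v\<^sub>1, \<dots>, v\<^sub>k\<close>.  The last clause says that the \<open>(k+1)\<close>-st derivative is the Frechet derivative
  of the \<open>k\<close>-th one with respect to the operator norm of bounded \<open>k\<close>-linear maps.
\<close>

definition smooth_on ::
    "'a::real_normed_vector set \<Rightarrow> ('a \<Rightarrow> 'b::real_normed_vector) \<Rightarrow> bool" where
  "smooth_on S f \<longleftrightarrow>
     (\<exists>D :: 'a \<Rightarrow> 'a list \<Rightarrow> 'b.
        (\<forall>x\<in>S. D x [] = f x) \<and>
        (\<forall>k. \<forall>x\<in>S.
           bounded_multilinear k (D x) \<and>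
           (\<forall>e>0. \<exists>d>0. \<forall>y\<in>S. norm (y - x) < d \<longrightarrow>
              (\<forall>vs. length vs = k \<longrightarrow>
                 norm (D y vs - D x vs - D x ((y - x) # vs))
                   \<le> e * norm (y - x) * prod_list (map norm vs)))))"


section \<open>Manifolds modeled on a Hilbert space\<close>

text \<open>A chart is a domain together with a coordinate map, relevant only on that domain.
  Atlases are not required to be maximal; none of the notions below depends on maximality.\<close>

type_synonym ('m, 'e) chart = "'m set \<times> ('m \<Rightarrow> 'e)"

definition chart_inv :: "('m, 'e) chart \<Rightarrow> 'e \<Rightarrow> 'm" where
  "chart_inv c = inv_into (fst c) (snd c)"

definition is_chart :: "('m::topological_space, 'e::real_normed_vector) chart \<Rightarrow> bool" where
  "is_chart c \<longleftrightarrow> open (fst c) \<and> open (snd c ` fst c) \<and>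
     homeomorphism (fst c) (snd c ` fst c) (snd c) (chart_inv c)"

definition transition :: "('m, 'e) chart \<Rightarrow> ('m, 'e) chart \<Rightarrow> 'e \<Rightarrow> 'e" where
  "transition c c' = snd c' \<circ> chart_inv c"

definition smooth_atlas ::
    "('m::t2_space, 'e::{real_inner, complete_space}) chart set \<Rightarrow> bool" where
  "smooth_atlas A \<longleftrightarrow>
     (\<forall>c\<in>A. is_chart c) \<and> (\<Union>c\<in>A. fst c) = UNIV \<and>
     (\<forall>c\<in>A. \<forall>c'\<in>A. smooth_on (snd c ` (fst c \<inter> fst c')) (transition c c'))"

text \<open>
  A tangent vector at \<open>p\<close> is the family of its coordinate representations in all charts around \<open>p\<close>,
  related by the derivatives of the transition maps; the value at irrelevant charts is \<open>0\<close>.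
\<close>

type_synonym ('m, 'e) tangent = "('m, 'e) chart \<Rightarrow> 'e"

definition tangent_space ::
    "('m, 'e::real_normed_vector) chart set \<Rightarrow> 'm \<Rightarrow> ('m, 'e) tangent set" where
  "tangent_space A p =
     {v. (\<forall>c. c \<notin> A \<or> p \<notin> fst c \<longrightarrow> v c = 0) \<and>
         (\<forall>c\<in>A. \<forall>c'\<in>A. p \<in> fst c \<longrightarrow> p \<in> fst c' \<longrightarrow>
            v c' = frechet_derivative (transition c c') (at (snd c p)) (v c))}"

definition tangent_minus :: "('m, 'e::real_normed_vector) tangent \<Rightarrow> ('m, 'e) tangent \<Rightarrow>
    ('m, 'e) tangent" where
  "tangent_minus v w = (\<lambda>c. v c - w c)"

definition tangent_scale :: "real \<Rightarrow> ('m, 'e::real_normed_vector) tangent \<Rightarrow> ('m, 'e) tangent"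
  where "tangent_scale t v = (\<lambda>c. t *\<^sub>R v c)"

text \<open>The tangent vector at \<open>p\<close> whose representation in the chart \<open>c\<close> is \<open>u\<close>.\<close>

definition coord_tangent ::
    "('m, 'e::real_normed_vector) chart set \<Rightarrow> ('m, 'e) chart \<Rightarrow> 'm \<Rightarrow> 'e \<Rightarrow> ('m, 'e) tangent" where
  "coord_tangent A c p u =
     (\<lambda>c'. if c' \<in> A \<and> p \<in> fst c'
           then frechet_derivative (transition c c') (at (snd c p)) u else 0)"


section \<open>Riemannian metrics\<close>

type_synonym ('m, 'e) metric = "'m \<Rightarrow> ('m, 'e) tangent \<Rightarrow> ('m, 'e) tangent \<Rightarrow> real"

definition tangent_norm :: "('m, 'e) metric \<Rightarrow> 'm \<Rightarrow> ('m, 'e) tangent \<Rightarrow> real" where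
  "tangent_norm g p v = sqrt (g p v v)"

text \<open>
  Bilinearity of \<open>g\<close> on each tangent space is contained in the second clause, which represents \<open>g\<close>
  in every chart by a smooth map into the bounded bilinear forms on the model space.
\<close>

definition riemannian_manifold ::
    "('m::t2_space, 'e::{real_inner, complete_space}) chart set \<Rightarrow> ('m, 'e) metric \<Rightarrow> bool" where
  "riemannian_manifold A g \<longleftrightarrow>
     smooth_atlas A \<and>
     (\<forall>c\<in>A. \<exists>G :: 'e \<Rightarrow> 'e \<Rightarrow>\<^sub>L 'e \<Rightarrow>\<^sub>L real. smooth_on (snd c ` fst c) G \<and>
        (\<forall>p\<in>fst c. \<forall>u\<in>tangent_space A p. \<forall>v\<in>tangent_space A p.
           g p u v = blinfun_apply (blinfun_apply (G (snd c p)) (u c)) (v c))) \<and>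
     (\<forall>p. \<forall>u\<in>tangent_space A p. \<forall>v\<in>tangent_space A p. g p u v = g p v u) \<and>
     (\<forall>p. \<forall>u\<in>tangent_space A p. u \<noteq> (\<lambda>_. 0) \<longrightarrow> g p u u > 0) \<and>
     (\<forall>c\<in>A. \<forall>p\<in>fst c. \<exists>K>0. \<forall>u\<in>tangent_space A p.
        norm (u c) \<le> K * tangent_norm g p u \<and> tangent_norm g p u \<le> K * norm (u c))"


section \<open>Curves, length and Riemannian distance\<close>

definition velocity ::
    "('m, 'e::real_normed_vector) chart set \<Rightarrow> (real \<Rightarrow> 'm) \<Rightarrow> real set \<Rightarrow> real \<Rightarrow> ('m, 'e) tangent"
  where
  "velocity A \<gamma> I t =
     (\<lambda>c. if c \<in> A \<and> \<gamma> t \<in> fst c then vector_derivative (snd c \<circ> \<gamma>) (at t within I) else 0)"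

definition C1_curve ::
    "('m::topological_space, 'e::real_normed_vector) chart set \<Rightarrow> (real \<Rightarrow> 'm) \<Rightarrow> real set \<Rightarrow> bool"
  where
  "C1_curve A \<gamma> I \<longleftrightarrow>
     continuous_on I \<gamma> \<and>
     (\<forall>c\<in>A. (\<forall>t\<in>I. \<gamma> t \<in> fst c \<longrightarrow> (snd c \<circ> \<gamma>) differentiable (at t within I)) \<and>
            continuous_on {t\<in>I. \<gamma> t \<in> fst c} (\<lambda>t. velocity A \<gamma> I t c))"

text \<open>
  Each piece is \<open>C\<^sup>1\<close> up to its end points (with one-sided derivatives), so that the speed is
  bounded and integrable.  The library predicate \<open>piecewise_C1_differentiable_on\<close> would not
  guarantee this.
\<close>

definition piecewise_C1_curve ::
    "('m::topological_space, 'e::real_normed_vector) chart set \<Rightarrow> (real \<Rightarrow> 'm) \<Rightarrow> bool" where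
  "piecewise_C1_curve A \<gamma> \<longleftrightarrow>
     continuous_on {0..1} \<gamma> \<and>
     (\<exists>S. finite S \<and> {0, 1} \<subseteq> S \<and> S \<subseteq> {0..1} \<and>
        (\<forall>a\<in>S. \<forall>b\<in>S. a < b \<and> {a<..<b} \<inter> S = {} \<longrightarrow> C1_curve A \<gamma> {a..b}))"

definition curve_length ::
    "('m, 'e::real_normed_vector) chart set \<Rightarrow> ('m, 'e) metric \<Rightarrow> (real \<Rightarrow> 'm) \<Rightarrow> real" where
  "curve_length A g \<gamma> =
     integral {0..1} (\<lambda>t. tangent_norm g (\<gamma> t) (velocity A \<gamma> {0..1} t))"

text \<open>The distance is \<open>\<infinity>\<close> between points of different connected components.\<close>

definition riem_dist ::
    "('m::topological_space, 'e::real_normed_vector) chart set \<Rightarrow> ('m, 'e) metric \<Rightarrow>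
     'm \<Rightarrow> 'm \<Rightarrow> ereal" where
  "riem_dist A g p q =
     (INF \<gamma>\<in>{\<gamma>. piecewise_C1_curve A \<gamma> \<and> \<gamma> 0 = p \<and> \<gamma> 1 = q}. ereal (curve_length A g \<gamma>))"

definition riem_setdist ::
    "('m::topological_space, 'e::real_normed_vector) chart set \<Rightarrow> ('m, 'e) metric \<Rightarrow>
     'm set \<Rightarrow> 'm \<Rightarrow> ereal" where
  "riem_setdist A g \<Omega> x = (INF a\<in>\<Omega>. riem_dist A g x a)"

definition tangent_setdist ::
    "('m, 'e::real_normed_vector) metric \<Rightarrow> 'm \<Rightarrow> ('m, 'e) tangent set \<Rightarrow> ('m, 'e) tangent \<Rightarrow> ereal"
  where
  "tangent_setdist g p T v = (INF w\<in>T. ereal (tangent_norm g p (tangent_minus v w)))"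


section \<open>Geodesics and the exponential map\<close>

definition metric_rep ::
    "('m, 'e::real_normed_vector) chart set \<Rightarrow> ('m, 'e) metric \<Rightarrow> ('m, 'e) chart \<Rightarrow>
     'e \<Rightarrow> 'e \<Rightarrow> 'e \<Rightarrow> real" where
  "metric_rep A g c x u v =
     (let q = chart_inv c x in g q (coord_tangent A c q u) (coord_tangent A c q v))"

text \<open>
  Christoffel map of the Levi-Civita connection in the chart \<open>c\<close>, given by the Koszul formula for
  constant vector fields.  Existence of \<open>z\<close> is the Riesz representation theorem for the inner
  product \<open>metric_rep A g c x\<close>.
\<close>

definition christoffel ::
    "('m, 'e::real_normed_vector) chart set \<Rightarrow> ('m, 'e) metric \<Rightarrow> ('m, 'e) chart \<Rightarrow>
     'e \<Rightarrow> 'e \<Rightarrow> 'e \<Rightarrow> 'e" where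
  "christoffel A g c x u v =
     (let D = (\<lambda>h a b. frechet_derivative (\<lambda>y. metric_rep A g c y a b) (at x) h)
      in THE z. \<forall>w. metric_rep A g c x z w = (D u v w + D v u w - D w u v) / 2)"

definition geodesic ::
    "('m::topological_space, 'e::real_normed_vector) chart set \<Rightarrow> ('m, 'e) metric \<Rightarrow>
     (real \<Rightarrow> 'm) \<Rightarrow> real set \<Rightarrow> bool" where
  "geodesic A g \<gamma> I \<longleftrightarrow>
     C1_curve A \<gamma> I \<and>
     (\<forall>c\<in>A. \<forall>t\<in>I. \<gamma> t \<in> fst c \<longrightarrow>
        ((\<lambda>s. velocity A \<gamma> I s c) has_vector_derivative
           - christoffel A g c (snd c (\<gamma> t)) (velocity A \<gamma> I t c) (velocity A \<gamma> I t c))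
        (at t within I))"

text \<open>
  Meaningful for those \<open>v\<close> for which the geodesic with initial velocity \<open>v\<close> exists on \<open>[0, 1]\<close>,
  in particular for all \<open>v\<close> in some neighbourhood of \<open>0\<close>; unspecified otherwise.
\<close>

definition riem_exp ::
    "('m::topological_space, 'e::real_normed_vector) chart set \<Rightarrow> ('m, 'e) metric \<Rightarrow>
     'm \<Rightarrow> ('m, 'e) tangent \<Rightarrow> 'm" where
  "riem_exp A g p v =
     (THE q. \<exists>\<gamma>. geodesic A g \<gamma> {0..1} \<and> \<gamma> 0 = p \<and> velocity A \<gamma> {0..1} 0 = v \<and> \<gamma> 1 = q)"


section \<open>Contingent directional derivative and contingent cone\<close>

text \<open>The neighbourhood filter of \<open>v\<close> in the tangent space at \<open>p\<close>, for the norm given by \<open>g\<close>.\<close>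

definition tangent_nhds ::
    "('m, 'e::real_normed_vector) chart set \<Rightarrow> ('m, 'e) metric \<Rightarrow> 'm \<Rightarrow> ('m, 'e) tangent \<Rightarrow>
     ('m, 'e) tangent filter" where
  "tangent_nhds A g p v =
     inf (filtercomap (\<lambda>w. tangent_norm g p (tangent_minus w v)) (nhds 0))
         (principal (tangent_space A p))"

text \<open>
  Only \<open>t *\<^sub>R w\<close> close to \<open>0\<close> matter for the limit, so the values of \<open>riem_exp\<close> outside its
  natural domain play no role; in \<open>contingent_cone\<close> they can affect only finitely many indices,
  which may be dropped from the sequences.
\<close>

definition contingent_deriv ::
    "('m::topological_space, 'e::real_normed_vector) chart set \<Rightarrow> ('m, 'e) metric \<Rightarrow>
     ('m \<Rightarrow> ereal) \<Rightarrow> 'm \<Rightarrow> ('m, 'e) tangent \<Rightarrow> ereal" where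
  "contingent_deriv A g f p v =
     Liminf (tangent_nhds A g p v \<times>\<^sub>F at_right 0)
       (\<lambda>(w, t). (f (riem_exp A g p (tangent_scale t w)) - f p) / ereal t)"

definition contingent_cone ::
    "('m::topological_space, 'e::real_normed_vector) chart set \<Rightarrow> ('m, 'e) metric \<Rightarrow>
     'm set \<Rightarrow> 'm \<Rightarrow> ('m, 'e) tangent set" where
  "contingent_cone A g \<Omega> p =
     {v \<in> tangent_space A p. \<exists>(w :: nat \<Rightarrow> ('m, 'e) tangent) (t :: nat \<Rightarrow> real).
        (\<forall>i. w i \<in> tangent_space A p \<and> t i > 0 \<and>
             riem_exp A g p (tangent_scale (t i) (w i)) \<in> \<Omega>) \<and>
        t \<longlonglongrightarrow> 0 \<and> (\<lambda>i. tangent_norm g p (tangent_minus (w i) v)) \<longlonglongrightarrow> 0}"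

end

(*
  Only the first-order behaviour of exp_p in a chart matters.  Rescaling the geodesic equation so
  that its Lipschitz constant is O(t), a contraction argument gives exp_p(t w) = p + t w + O(t^2)
  in coordinates, with a remainder that has Lipschitz constant O(t^2) in w; hence every point
  p + t z is exp_p(t w) for some w = z + O(t).  Comparing the metric with its value at p, coordinate
  segments bound the Riemannian distance from above and short curves bound it from below by
  (1 +- e) times the norm at p.  If exp_p(t_i w_i) lies in Omega and w_i -> w, the upper bound gives
  d(exp_p(t_i v), Omega) / t_i <= |v - w| + o(1).  Conversely, almost nearest points of Omega to
  exp_p(t_i w_i) have the form exp_p(t_i u_i) with u_i bounded, and in finite dimension a limit of
  the u_i is a contingent vector at distance at most liminf d / t from v.
*)

theory Submission
  imports Defs
begin

section \<open>Calculus in normed spaces\<close>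

text \<open>The point \<open>riem_exp A g p v\<close> is a definite description over geodesics that
  satisfy their equation in every chart of the atlas and may leave any given chart. To evaluate it,
  a curve solved for in one chart has to be shown geodesic in all others, which rests on the
  transformation law of the Christoffel map and thus on the symmetry of second derivatives; and
  every competitor has to be shown to coincide with it on all of [0, 1]. The Christoffel map is a
  definite description as well: the Riesz theorem, with the coercivity that norm equivalence
  provides, turns it into an equation, and its Lipschitz estimate is read off from that equation.
  Finite dimension enters twice, both times through compact balls: bounded directions have a
  convergent subsequence, and a closed coordinate ball is closed in the Hausdorff manifold, so that
  a curve can leave it only through its coordinate sphere, by which time it is already too long. For
  the inequality \<open>\<le>\<close> it is enough to exhibit one curve, a coordinate
  segment.\<close>

lemma bounded_multilinear_linear:
  assumes "bounded_multilinear k M" "length us + length vs + 1 = k"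
  shows "linear (\<lambda>x. M (us @ x # vs))"
  using assms unfolding bounded_multilinear_def by blast

text \<open>The list-valued encoding \<open>D\<close> is converted into operator-valued derivatives
  of orders one and two. The local bound on \<open>f2\<close> is the order-two clause with error
  constant 1 on a ball of radius at most 1: the second and third derivatives at \<open>x\<close>
  then bound the second derivative nearby by \<open>1 + C2 + C3\<close>. Applied to the metric, it
  makes the first derivative locally Lipschitz.\<close>

lemma smooth_on_derivatives:
  fixes f :: "'a::real_normed_vector \<Rightarrow> 'b::real_normed_vector"
  assumes "open S" "smooth_on S f"
  obtains f1 :: "'a \<Rightarrow> 'a \<Rightarrow>\<^sub>L 'b" and f2 :: "'a \<Rightarrow> 'a \<Rightarrow>\<^sub>L 'a \<Rightarrow>\<^sub>L 'b" where
    "\<And>x. x \<in> S \<Longrightarrow> (f has_derivative blinfun_apply (f1 x)) (at x)"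
    "\<And>x. x \<in> S \<Longrightarrow> (f1 has_derivative blinfun_apply (f2 x)) (at x)"
    "\<And>x. x \<in> S \<Longrightarrow> \<exists>L. \<exists>d>0. ball x d \<subseteq> S \<and> (\<forall>y\<in>ball x d. norm (f2 y) \<le> L)"
proof -
  obtain D :: "'a \<Rightarrow> 'a list \<Rightarrow> 'b" where D0: "\<And>x. x \<in> S \<Longrightarrow> D x [] = f x"
    and ml: "\<And>k x. x \<in> S \<Longrightarrow> bounded_multilinear k (D x)"
    and Dd: "\<And>k x e. x \<in> S \<Longrightarrow> e > 0 \<Longrightarrow> \<exists>d>0. \<forall>y\<in>S. norm (y - x) < d \<longrightarrow>
              (\<forall>vs. length vs = k \<longrightarrow>
                 norm (D y vs - D x vs - D x ((y - x) # vs))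
                   \<le> e * norm (y - x) * prod_list (map norm vs))"
    using assms(2) unfolding smooth_on_def by blast
  have bd: "\<exists>C\<ge>0. \<forall>vs. length vs = k \<longrightarrow> norm (D x vs) \<le> C * prod_list (map norm vs)"
    if x: "x \<in> S" for k x
  proof -
    obtain C where C: "\<And>vs. length vs = k \<Longrightarrow> norm (D x vs) \<le> C * prod_list (map norm vs)"
      using ml[OF x, of k] unfolding bounded_multilinear_def by blast
    have nn: "prod_list (map norm vs) \<ge> 0" for vs :: "'a list"
      by (induction vs) auto
    have "norm (D x vs) \<le> max C 0 * prod_list (map norm vs)" if "length vs = k" for vs
      using C[OF that] mult_right_mono[OF max.cobounded1 nn[of vs], of C 0] by linarith
    then show ?thesis
      by (intro exI[of _ "max C 0"]) auto
  qed
  have lin1: "linear (\<lambda>v. D x [v])" if "x \<in> S" for x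
    using bounded_multilinear_linear[OF ml[OF that, of 1], of "[]" "[]"] by simp
  have bl1: "bounded_linear (\<lambda>v. D x [v])" if x: "x \<in> S" for x
  proof -
    obtain C where "\<And>vs. length vs = 1 \<Longrightarrow> norm (D x vs) \<le> C * prod_list (map norm vs)"
      using bd[OF x, of 1] by blast
    from this[of "[v]" for v] show ?thesis
      by (intro bounded_linear_intro[of _ C])
        (auto simp: linear_add[OF lin1[OF x]] linear_scale[OF lin1[OF x]] mult.commute)
  qed
  have lin2r: "linear (\<lambda>v. D x [h, v])" if "x \<in> S" for x h
    using bounded_multilinear_linear[OF ml[OF that, of 2], of "[h]" "[]"] by simp
  have lin2l: "linear (\<lambda>h. D x [h, v])" if "x \<in> S" for x v
    using bounded_multilinear_linear[OF ml[OF that, of 2], of "[]" "[v]"] by simp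
  have bd2: "\<exists>C\<ge>0. \<forall>h v. norm (D x [h, v]) \<le> C * norm h * norm v" if x: "x \<in> S" for x
  proof -
    obtain C where "C \<ge> 0" "\<And>vs. length vs = 2 \<Longrightarrow> norm (D x vs) \<le> C * prod_list (map norm vs)"
      using bd[OF x, of 2] by blast
    from this(1) this(2)[of "[h, v]" for h v] show ?thesis
      by (intro exI[of _ C]) (auto simp: mult.assoc)
  qed
  have bl2: "bounded_linear (\<lambda>v. D x [h, v])" if x: "x \<in> S" for x h
  proof -
    obtain C where "\<And>h v. norm (D x [h, v]) \<le> C * norm h * norm v"
      using bd2[OF x] by blast
    then show ?thesis
      by (intro bounded_linear_intro[of _ "C * norm h"])
        (auto simp: linear_add[OF lin2r[OF x]] linear_scale[OF lin2r[OF x]] mult.commute)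
  qed
  define f1 where "f1 x = Blinfun (\<lambda>v. D x [v])" for x
  define g2 where "g2 x h = Blinfun (\<lambda>v. D x [h, v])" for x h
  define f2 where "f2 x = Blinfun (g2 x)" for x
  have f1: "blinfun_apply (f1 x) v = D x [v]" if "x \<in> S" for x v
    unfolding f1_def by (simp add: bounded_linear_Blinfun_apply bl1 that)
  have g2: "blinfun_apply (g2 x h) v = D x [h, v]" if "x \<in> S" for x h v
    unfolding g2_def by (simp add: bounded_linear_Blinfun_apply bl2 that)
  have g2norm: "norm (g2 x h) \<le> C * norm h"
    if "x \<in> S" "\<And>h v. norm (D x [h, v]) \<le> C * norm h * norm v" "C \<ge> 0" for x h C
    by (rule norm_blinfun_bound) (use that in \<open>auto simp: g2 mult.assoc\<close>)
  have blg2: "bounded_linear (g2 x)" if x: "x \<in> S" for x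
  proof -
    obtain C where "C \<ge> 0" "\<And>h v. norm (D x [h, v]) \<le> C * norm h * norm v"
      using bd2[OF x] by blast
    then show ?thesis
      by (intro bounded_linear_intro[of _ C] blinfun_eqI)
        (auto simp: g2 x blinfun.add_left blinfun.scaleR_left linear_add[OF lin2l[OF x]]
          linear_scale[OF lin2l[OF x]] mult.commute intro!: g2norm[OF x, simplified mult.commute])
  qed
  have f2: "blinfun_apply (f2 x) h = g2 x h" if "x \<in> S" for x h
    unfolding f2_def by (simp add: bounded_linear_Blinfun_apply blg2 that)
  have d1: "(f has_derivative blinfun_apply (f1 x)) (at x)" if x: "x \<in> S" for x
    unfolding at_within_open[OF x assms(1), symmetric] has_derivative_within_alt
  proof (intro conjI allI impI)
    fix e :: real assume "e > 0"
    from Dd[OF x this, of 0] show "\<exists>d>0. \<forall>y\<in>S. norm (y - x) < d \<longrightarrow>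
        norm (f y - f x - blinfun_apply (f1 x) (y - x)) \<le> e * norm (y - x)"
      by (auto simp: D0 x f1)
  qed (simp add: blinfun.bounded_linear_right)
  have d2: "(f1 has_derivative blinfun_apply (f2 x)) (at x)" if x: "x \<in> S" for x
    unfolding at_within_open[OF x assms(1), symmetric] has_derivative_within_alt
  proof (intro conjI allI impI)
    fix e :: real assume e: "e > 0"
    obtain d where d: "d > 0" "\<And>y vs. y \<in> S \<Longrightarrow> norm (y - x) < d \<Longrightarrow> length vs = 1 \<Longrightarrow>
        norm (D y vs - D x vs - D x ((y - x) # vs)) \<le> e * norm (y - x) * prod_list (map norm vs)"
      using Dd[OF x e, of 1] by blast
    have "norm (f1 y - f1 x - blinfun_apply (f2 x) (y - x)) \<le> e * norm (y - x)"
      if y: "y \<in> S" "norm (y - x) < d" for y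
    proof (rule norm_blinfun_bound)
      fix v
      show "norm (blinfun_apply (f1 y - f1 x - blinfun_apply (f2 x) (y - x)) v)
          \<le> e * norm (y - x) * norm v"
        using d(2)[OF y, of "[v]"] by (simp add: blinfun.diff_left f1 f2 g2 x y)
    qed (use e in simp)
    with d(1) show "\<exists>d>0. \<forall>y\<in>S. norm (y - x) < d \<longrightarrow>
        norm (f1 y - f1 x - blinfun_apply (f2 x) (y - x)) \<le> e * norm (y - x)"
      by blast
  qed (simp add: blinfun.bounded_linear_right)
  have d3: "\<exists>L. \<exists>d>0. ball x d \<subseteq> S \<and> (\<forall>y\<in>ball x d. norm (f2 y) \<le> L)" if x: "x \<in> S" for x
  proof -
    obtain d where d: "d > 0" "\<And>y vs. y \<in> S \<Longrightarrow> norm (y - x) < d \<Longrightarrow> length vs = 2 \<Longrightarrow>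
        norm (D y vs - D x vs - D x ((y - x) # vs)) \<le> 1 * norm (y - x) * prod_list (map norm vs)"
      using Dd[OF x zero_less_one, of 2] by blast
    obtain d' where d': "d' > 0" "ball x d' \<subseteq> S"
      using assms(1) x openE by blast
    obtain C2 where C2: "C2 \<ge> 0" "\<And>h v. norm (D x [h, v]) \<le> C2 * norm h * norm v"
      using bd2[OF x] by blast
    obtain C3 where C3: "C3 \<ge> 0"
      "\<And>vs. length vs = 3 \<Longrightarrow> norm (D x vs) \<le> C3 * prod_list (map norm vs)"
      using bd[OF x, of 3] by blast
    define r where "r = min d (min d' 1)"
    have r: "r > 0" "r \<le> d" "r \<le> d'" "r \<le> 1"
      unfolding r_def using d d' by auto
    have "norm (f2 y) \<le> 1 + C2 + C3" if y: "y \<in> ball x r" for y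
    proof (rule norm_blinfun_bound)
      fix h
      have yS: "y \<in> S" and yx: "norm (y - x) < d" and y1: "norm (y - x) \<le> 1"
        using y d' r by (auto simp: dist_norm norm_minus_commute subset_iff)
      have "norm (D y [h, v]) \<le> (1 + C2 + C3) * norm h * norm v" for v
      proof -
        have "norm (D y [h, v]) \<le> norm (D y [h, v] - D x [h, v] - D x [y - x, h, v])
          + norm (D x [h, v]) + norm (D x [y - x, h, v])"
          by norm
        also have "\<dots> \<le> norm (y - x) * (norm h * norm v) + C2 * norm h * norm v
            + C3 * (norm (y - x) * (norm h * norm v))"
          using d(2)[OF yS yx, of "[h, v]"] C2(2)[of h v] C3(2)[of "[y - x, h, v]"] by simp
        also have "\<dots> \<le> 1 * (norm h * norm v) + C2 * norm h * norm v
            + C3 * (1 * (norm h * norm v))"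
          using y1 C3(1) by (intro add_mono mult_right_mono mult_left_mono) auto
        finally show ?thesis by (simp add: algebra_simps)
      qed
      then show "norm (blinfun_apply (f2 y) h) \<le> (1 + C2 + C3) * norm h"
        unfolding f2[OF yS] using C2(1) C3(1)
        by (intro norm_blinfun_bound) (simp_all add: g2 yS)
    qed (use C2 C3 in simp)
    moreover have "ball x r \<subseteq> S" using r d' by auto
    ultimately show ?thesis using r(1) by blast
  qed
  show thesis
    by (rule that[OF d1 d2 d3])
qed

lemma locally_lipschitz_of_bounded_derivative:
  fixes f :: "'a::real_normed_vector \<Rightarrow> 'b::real_normed_vector"
  assumes "\<And>y. y \<in> ball x d \<Longrightarrow> (f has_derivative blinfun_apply (f' y)) (at y)"
    and "\<And>y. y \<in> ball x d \<Longrightarrow> norm (f' y) \<le> L"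
    and "y \<in> ball x d" "z \<in> ball x d"
  shows "norm (f y - f z) \<le> L * norm (y - z)"
proof (rule differentiable_bound[of "ball x d" f "\<lambda>y. blinfun_apply (f' y)"])
  show "onorm (blinfun_apply (f' y)) \<le> L" if "y \<in> ball x d" for y
    using assms(2)[OF that] by (simp add: norm_blinfun.rep_eq)
qed (use assms in \<open>auto intro: has_derivative_at_withinI\<close>)

text \<open>The second difference of \<open>f\<close> along \<open>u\<close> and \<open>v\<close> is symmetric and agrees with
  \<open>t\<^sup>2 * f2 v u\<close> up to an error that is small compared with \<open>t\<^sup>2\<close>.\<close>

lemma second_derivative_symmetric:
  fixes f :: "'a::real_normed_vector \<Rightarrow> 'b::real_normed_vector"
  assumes S: "open S" "x \<in> S"
    and f1: "\<And>y. y \<in> S \<Longrightarrow> (f has_derivative blinfun_apply (f1 y)) (at y)"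
    and f2: "(f1 has_derivative blinfun_apply f2) (at x)"
  shows "blinfun_apply (blinfun_apply f2 u) v = blinfun_apply (blinfun_apply f2 v) u"
proof -
  \<comment> \<open>\<open>K\<close> bounds both directions and their sum, so that
    \<open>x + s u + t v\<close> and \<open>x + s u\<close> lie within \<open>t * K\<close> of
    \<open>x\<close> for 0 \<le> s \<le> t; the summand 1 makes it positive.\<close>
  define K where "K = norm u + norm v + 1"
  have K: "K > 0" "norm u \<le> K" "norm v \<le> K" "norm u + norm v \<le> K"
    unfolding K_def by (auto intro: add_nonneg_pos)
  have key: "\<exists>\<delta>>0. \<forall>t. 0 < t \<longrightarrow> t < \<delta> \<longrightarrow>
      norm (f (x + t *\<^sub>R u + t *\<^sub>R v) - f (x + t *\<^sub>R u) - f (x + t *\<^sub>R v) + f x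
        - t\<^sup>2 *\<^sub>R f2 v u) \<le> 2 * e * K\<^sup>2 * t\<^sup>2"
    if e: "e > 0" and K: "K > 0" "norm u \<le> K" "norm v \<le> K" "norm u + norm v \<le> K" for e u v
  proof -
    obtain d1 where d1: "d1 > 0" "\<And>y. norm (y - x) < d1 \<Longrightarrow>
        norm (f1 y - f1 x - f2 (y - x)) \<le> e * norm (y - x)"
      using f2 e unfolding has_derivative_at_alt by blast
    obtain d2 where d2: "d2 > 0" "ball x d2 \<subseteq> S"
      using S openE by blast
    define d where "d = min d1 d2"
    have d: "d > 0" "d \<le> d1" "d \<le> d2" using d1 d2 by (auto simp: d_def)
    have main: "norm (f (x + t *\<^sub>R u + t *\<^sub>R v) - f (x + t *\<^sub>R u) - f (x + t *\<^sub>R v) + f x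
        - t\<^sup>2 *\<^sub>R f2 v u) \<le> 2 * e * K\<^sup>2 * t\<^sup>2" if t: "0 < t" "t * K < d" for t
    proof -
      \<comment> \<open>Mean value inequality in \<open>s\<close>:
        \<open>\<phi> t - \<phi> 0\<close> is the second difference minus the expected quadratic
        term. Both values of \<open>f1\<close> in \<open>\<phi>'\<close> are compared with
        \<open>f1 x\<close>, since \<open>f1\<close> is differentiable only at
        \<open>x\<close>.\<close>
      define \<phi> where "\<phi> s = f (x + s *\<^sub>R u + t *\<^sub>R v) - f (x + s *\<^sub>R u)
        - (t * s) *\<^sub>R f2 v u" for s
      define \<phi>' where "\<phi>' s = f1 (x + s *\<^sub>R u + t *\<^sub>R v) u - f1 (x + s *\<^sub>R u) u
        - t *\<^sub>R f2 v u" for s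
      have n1: "norm (s *\<^sub>R u + t *\<^sub>R v) \<le> t * K" and n2: "norm (s *\<^sub>R u) \<le> t * K"
        if "s \<in> {0..t}" for s
      proof -
        have "norm (s *\<^sub>R u + t *\<^sub>R v) \<le> s * norm u + t * norm v"
          using norm_triangle_ineq[of "s *\<^sub>R u" "t *\<^sub>R v"] that t by simp
        also have "\<dots> \<le> t * norm u + t * norm v"
          using that by (intro add_mono mult_right_mono) auto
        also have "\<dots> \<le> t * K"
          using K(4) t by (simp flip: distrib_left)
        finally show "norm (s *\<^sub>R u + t *\<^sub>R v) \<le> t * K" .
        show "norm (s *\<^sub>R u) \<le> t * K"
          using that K by (auto intro: mult_mono)
      qed
      have inS: "x + s *\<^sub>R u + t *\<^sub>R v \<in> S" "x + s *\<^sub>R u \<in> S" if "s \<in> {0..t}" for s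
      proof -
        have "x + w \<in> S" if "norm w \<le> t * K" for w
          using that t d by (intro subsetD[OF d2(2)]) (simp add: dist_norm)
        from this[OF n1[OF that]] this[OF n2[OF that]]
        show "x + s *\<^sub>R u + t *\<^sub>R v \<in> S" "x + s *\<^sub>R u \<in> S"
          by (simp_all add: add.assoc)
      qed
      have der: "(\<phi> has_derivative (\<lambda>h. h *\<^sub>R \<phi>' s)) (at s within {0..t})" if "s \<in> {0..t}" for s
        unfolding \<phi>_def \<phi>'_def
        by (rule has_derivative_eq_rhs,
            (rule derivative_eq_intros has_derivative_compose[OF _ f1] inS[OF that] refl)+)
          (auto simp: blinfun.scaleR_right algebra_simps)
      have bnd: "norm (\<phi>' s) \<le> 2 * e * (t * K) * K" if s: "s \<in> {0..t}" for s
      proof -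
        let ?a = "x + s *\<^sub>R u + t *\<^sub>R v" and ?b = "x + s *\<^sub>R u"
        have "norm (f1 ?a - f1 ?b - f2 (t *\<^sub>R v)) \<le> norm (f1 ?a - f1 x - f2 (?a - x))
           + norm (f1 ?b - f1 x - f2 (?b - x))"
        proof -
          have *: "f2 (t *\<^sub>R v) = f2 (?a - x) - f2 (?b - x)"
            by (simp add: blinfun.diff_right[symmetric] algebra_simps)
          have "f1 ?a - f1 ?b - f2 (t *\<^sub>R v)
              = (f1 ?a - f1 x - f2 (?a - x)) - (f1 ?b - f1 x - f2 (?b - x))"
            unfolding * by (simp add: algebra_simps)
          then show ?thesis by (metis norm_triangle_ineq4)
        qed
        also have "\<dots> \<le> e * norm (?a - x) + e * norm (?b - x)"
          using n1[OF s] n2[OF s] t d by (intro add_mono d1) (auto simp: algebra_simps)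
        also have "\<dots> \<le> e * (t * K) + e * (t * K)"
          using n1[OF s] n2[OF s] e by (intro add_mono mult_left_mono) (auto simp: algebra_simps)
        finally have *: "norm (f1 ?a - f1 ?b - f2 (t *\<^sub>R v)) \<le> 2 * e * (t * K)"
          by (simp add: algebra_simps)
        have "\<phi>' s = (f1 ?a - f1 ?b - f2 (t *\<^sub>R v)) u"
          unfolding \<phi>'_def by (simp add: blinfun.diff_left blinfun.scaleR_right blinfun.scaleR_left)
        then have "norm (\<phi>' s) \<le> norm (f1 ?a - f1 ?b - f2 (t *\<^sub>R v)) * norm u"
          by (simp add: norm_blinfun)
        also have "\<dots> \<le> (2 * e * (t * K)) * K"
          using * K e t by (intro mult_mono) auto
        finally show ?thesis .
      qed
      have "norm (\<phi> t - \<phi> 0) \<le> (2 * e * (t * K) * K) * norm (t - 0)"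
      proof (rule differentiable_bound[OF _ der])
        show "onorm (\<lambda>h. h *\<^sub>R \<phi>' s) \<le> 2 * e * (t * K) * K" if "s \<in> {0..t}" for s
          by (rule onorm_le) (use mult_left_mono[OF bnd[OF that] abs_ge_zero] in \<open>simp add: mult.commute\<close>)
      qed (use t in auto)
      then show ?thesis
        using t unfolding \<phi>_def by (simp add: algebra_simps power2_eq_square)
    qed
    show ?thesis
      by (rule exI[of _ "d / K"]) (use d K main in \<open>auto simp: field_simps\<close>)
  qed
  \<comment> \<open>The same second difference approximates both \<open>f2 v u\<close> and, with the
    directions exchanged, \<open>f2 u v\<close>.\<close>
  have "norm (f2 u v - f2 v u) \<le> 4 * e * K\<^sup>2" if e: "e > 0" for e
  proof -
    obtain a where a: "a > 0" "\<And>t. 0 < t \<Longrightarrow> t < a \<Longrightarrow>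
      norm (f (x + t *\<^sub>R u + t *\<^sub>R v) - f (x + t *\<^sub>R u) - f (x + t *\<^sub>R v) + f x
        - t\<^sup>2 *\<^sub>R f2 v u) \<le> 2 * e * K\<^sup>2 * t\<^sup>2"
      using key[OF e K] by blast
    obtain b where b: "b > 0" "\<And>t. 0 < t \<Longrightarrow> t < b \<Longrightarrow>
      norm (f (x + t *\<^sub>R v + t *\<^sub>R u) - f (x + t *\<^sub>R v) - f (x + t *\<^sub>R u) + f x
        - t\<^sup>2 *\<^sub>R f2 u v) \<le> 2 * e * K\<^sup>2 * t\<^sup>2"
      using key[OF e K(1,3,2)] K(4) by (auto simp: add.commute)
    define t where "t = min a b / 2"
    have t: "0 < t" "t < a" "t < b" using a(1) b(1) by (auto simp: t_def)
    have "norm (t\<^sup>2 *\<^sub>R (f2 u v - f2 v u)) \<le> 2 * e * K\<^sup>2 * t\<^sup>2 + 2 * e * K\<^sup>2 * t\<^sup>2"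
    proof -
      define P where "P = f (x + t *\<^sub>R u + t *\<^sub>R v) - f (x + t *\<^sub>R u) - f (x + t *\<^sub>R v) + f x"
      have "norm (P - t\<^sup>2 *\<^sub>R f2 v u) \<le> 2 * e * K\<^sup>2 * t\<^sup>2"
        using a(2)[OF t(1,2)] by (simp add: P_def)
      moreover have "norm (P - t\<^sup>2 *\<^sub>R f2 u v) \<le> 2 * e * K\<^sup>2 * t\<^sup>2"
        using b(2)[OF t(1,3)] by (simp add: P_def algebra_simps)
      moreover have *: "t\<^sup>2 *\<^sub>R (f2 u v - f2 v u) = (P - t\<^sup>2 *\<^sub>R f2 v u) - (P - t\<^sup>2 *\<^sub>R f2 u v)"
        by (simp add: algebra_simps)
      ultimately show ?thesis
        unfolding * by (intro order_trans[OF norm_triangle_ineq4 add_mono])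
    qed
    then have "t\<^sup>2 * norm (f2 u v - f2 v u) \<le> t\<^sup>2 * (4 * e * K\<^sup>2)"
      unfolding norm_scaleR by (simp add: mult_ac)
    with t show ?thesis by simp
  qed
  from this[of "\<epsilon> / (4 * K\<^sup>2)" for \<epsilon>] have "norm (f2 u v - f2 v u) \<le> \<epsilon>" if "\<epsilon> > 0" for \<epsilon>
    using that K(1) by auto
  then have "norm (f2 u v - f2 v u) \<le> 0"
    using field_le_epsilon[of "norm (f2 u v - f2 v u)" 0] by simp
  then show ?thesis by simp
qed

section \<open>The Riesz representation theorem\<close>

text \<open>Direct method: \<open>z\<close> minimizes \<open>J z = B z z - 2 * l z\<close>.
  Completing the square bounds \<open>J\<close> below, the parallelogram law makes a minimizing
  sequence Cauchy, and the first variation of \<open>J\<close> at the minimum is the claimed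
  equation. A general coercive form is allowed because the metric at a point is one.\<close>

lemma riesz_representation:
  fixes B :: "'a::{real_inner, complete_space} \<Rightarrow>\<^sub>L 'a \<Rightarrow>\<^sub>L real" and l :: "'a \<Rightarrow>\<^sub>L real"
  assumes sym: "\<And>u v. B u v = B v u" and c: "c > 0" and coer: "\<And>u. c * (norm u)\<^sup>2 \<le> B u u"
  shows "\<exists>z. \<forall>w. B z w = l w"
proof -
  define J where "J z = B z z - 2 * l z" for z
  have J_lb: "J z \<ge> - ((norm l)\<^sup>2 / c)" for z
  proof -
    have "l z \<le> norm l * norm z"
      using norm_blinfun[of l z] by simp
    then have "J z \<ge> c * (norm z)\<^sup>2 - 2 * (norm l * norm z)"
      using coer[of z] by (simp add: J_def)
    also have "c * (norm z)\<^sup>2 - 2 * (norm l * norm z)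
        = c * (norm z - norm l / c)\<^sup>2 - (norm l)\<^sup>2 / c"
      using c by (simp add: power2_eq_square field_simps)
    finally show ?thesis using c by (smt (verit) mult_nonneg_nonneg zero_le_power2)
  qed
  define m where "m = (INF z. J z)"
  have bdd: "bdd_below (range J)"
    using J_lb by (auto intro!: bdd_belowI)
  have m_le: "m \<le> J z" for z
    unfolding m_def by (rule cINF_lower[OF bdd]) auto
  have "\<exists>z. J z < m + inverse (real (Suc n))" for n
    using cINF_less_iff[OF _ bdd, of "m + inverse (real (Suc n))"] by (auto simp: m_def)
  then obtain z where z: "\<And>n. J (z n) < m + inverse (real (Suc n))" by metis
  \<comment> \<open>Parallelogram law for \<open>B\<close>; the linear part of \<open>J\<close> is
    exact at the midpoint, where \<open>J\<close> is still at least \<open>m\<close>.\<close>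
  have par: "c * (norm (a - b))\<^sup>2 \<le> 2 * (J a - m) + 2 * (J b - m)" for a b
  proof -
    have "J a + J b = 2 * J ((1/2) *\<^sub>R (a + b)) + B (a - b) (a - b) / 2"
      unfolding J_def
      by (simp add: blinfun.add_left blinfun.add_right blinfun.diff_left blinfun.diff_right
          blinfun.scaleR_left blinfun.scaleR_right sym[of b a] field_simps)
    note * = this
    have "q \<le> 2 * (ja - m) + 2 * (jb - m)"
      if "ja + jb = 2 * M + q' / 2" "m \<le> M" "q \<le> q'" for q q' ja jb M
      using that by argo
    from this[OF * m_le coer] show ?thesis .
  qed
  have "Cauchy z"
  proof (rule metric_CauchyI)
    fix e :: real assume "e > 0"
    then have "c * e\<^sup>2 / 4 > 0" using c by simp
    then obtain N where N: "inverse (real (Suc N)) < c * e\<^sup>2 / 4"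
      using reals_Archimedean by blast
    have "dist (z i) (z j) < e" if "i \<ge> N" "j \<ge> N" for i j
    proof -
      have "inverse (real (Suc i)) \<le> inverse (real (Suc N))"
        "inverse (real (Suc j)) \<le> inverse (real (Suc N))"
        using that by (auto simp: field_simps)
      with par[of "z i" "z j"] z[of i] z[of j] N
      have "c * (norm (z i - z j))\<^sup>2 < c * e\<^sup>2" by argo
      then have "(norm (z i - z j))\<^sup>2 < e\<^sup>2" using c by simp
      then show ?thesis
        using \<open>e > 0\<close> by (simp add: dist_norm power2_less_imp_less)
    qed
    then show "\<exists>M. \<forall>i\<ge>M. \<forall>j\<ge>M. dist (z i) (z j) < e" by blast
  qed
  then obtain w where w: "z \<longlonglongrightarrow> w"
    using Cauchy_convergent convergent_def by blast
  have "(\<lambda>n. J (z n)) \<longlonglongrightarrow> J w"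
    unfolding J_def by (intro tendsto_intros w)
  moreover have "(\<lambda>n. m + inverse (real (Suc n))) \<longlonglongrightarrow> m + 0"
    by (intro tendsto_intros LIMSEQ_inverse_real_of_nat)
  ultimately have "J w \<le> m + 0"
    by (rule LIMSEQ_le) (use z in \<open>auto intro: less_imp_le\<close>)
  then have Jw: "J w \<le> J y" for y using m_le[of y] by simp
  have "B w h = l h" for h
  proof -
    define a where "a = B w h - l h"
    define b where "b = B h h"
    have ineq: "0 \<le> 2 * t * a + t\<^sup>2 * b" for t
      using Jw[of "w + t *\<^sub>R h"] unfolding J_def a_def b_def
      by (simp add: blinfun.add_left blinfun.add_right blinfun.scaleR_left blinfun.scaleR_right
          sym[of h w] algebra_simps power2_eq_square)
    have b: "b \<ge> 0"
      using coer[of h] c by (simp add: b_def) (meson less_imp_le mult_nonneg_nonneg order_trans zero_le_power2)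
    \<comment> \<open>The step \<open>- s\<close> makes the quadratic in \<open>ineq\<close> equal
      to -s^2 (b + 2), which is negative unless \<open>a\<close> vanishes; the summand 1 covers
      \<open>b = 0\<close>.\<close>
    define s where "s = a / (b + 1)"
    have a: "a = s * (b + 1)" using b by (simp add: s_def)
    have "0 \<le> 2 * (- s) * a + (- s)\<^sup>2 * b" by (rule ineq)
    also have "\<dots> = - (s\<^sup>2 * (b + 2))"
      by (simp add: a algebra_simps power2_eq_square)
    finally have "s = 0"
      using b by (simp add: mult_le_0_iff)
    then have "a = 0" by (simp add: a)
    then show ?thesis by (simp add: a_def)
  qed
  then show ?thesis by blast
qed

section \<open>Ordinary differential equations\<close>

text \<open>The Lipschitz constant 1/2 on an interval of length 1 makes the Picard operator a
  contraction on the whole interval at once, and the bound \<open>r\<close> on \<open>F\<close>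
  keeps its values in the ball.\<close>

lemma picard_banach:
  fixes F :: "'b::banach \<Rightarrow> 'b"
  assumes lip: "\<And>x y. x \<in> cball X0 r \<Longrightarrow> y \<in> cball X0 r \<Longrightarrow> norm (F x - F y) \<le> 1/2 * norm (x - y)"
    and bd: "\<And>x. x \<in> cball X0 r \<Longrightarrow> norm (F x) \<le> r"
    and r: "r \<ge> 0"
  shows "\<exists>X. X 0 = X0 \<and> (\<forall>t\<in>{0..1}. X t \<in> cball X0 r \<and>
           (X has_vector_derivative F (X t)) (at t within {0..1}))"
proof -
  \<comment> \<open>Bounded continuous functions live on all of the reals, so time is clamped to
    [0, 1].\<close>
  define cl :: "real \<Rightarrow> real" where "cl s = max 0 (min 1 s)" for s
  have cl: "cl s \<in> {0..1}" for s unfolding cl_def by auto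
  have cl_id: "cl s = s" if "s \<in> {0..1}" for s using that unfolding cl_def by auto
  have cl_cont: "continuous_on UNIV cl" unfolding cl_def by (intro continuous_intros)
  have Fcont: "continuous_on (cball X0 r) F"
  proof (rule continuous_on_iff[THEN iffD2], intro ballI allI impI)
    fix x and e :: real assume "x \<in> cball X0 r" "e > 0"
    then show "\<exists>d>0. \<forall>x'\<in>cball X0 r. dist x' x < d \<longrightarrow> dist (F x') (F x) < e"
      using lip by (intro exI[of _ e]) (force simp: dist_norm)
  qed
  define S :: "(real \<Rightarrow>\<^sub>C 'b) set" where "S = PiC UNIV (\<lambda>_. cball X0 r)"
  define I where "I h s = X0 + integral {0..cl s} (\<lambda>u. F (apply_bcontfun h u))" for h s
  have inS: "h \<in> S \<longleftrightarrow> (\<forall>s. apply_bcontfun h s \<in> cball X0 r)" for h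
    by (auto simp: S_def mem_PiC_iff)
  have cont: "continuous_on A (\<lambda>u. F (apply_bcontfun h u))" if "h \<in> S" for h A
    by (rule continuous_on_compose2[OF Fcont]) (use that inS in auto)
  have Icball: "I h s \<in> cball X0 r" if "h \<in> S" for h s
  proof -
    have "norm (integral {0..cl s} (\<lambda>u. F (apply_bcontfun h u))) \<le> r * (cl s - 0)"
      by (rule integral_bound[OF _ cont[OF that]]) (use that cl[of s] inS bd in auto)
    also have "\<dots> \<le> r * 1" using cl[of s] r by (intro mult_left_mono) auto
    finally show ?thesis by (simp add: I_def dist_norm)
  qed
  have Icont: "continuous_on UNIV (I h)" if "h \<in> S" for h
  proof -
    have "continuous_on {0..1} (\<lambda>s. integral {0..s} (\<lambda>u. F (apply_bcontfun h u)))"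
      by (intro indefinite_integral_continuous_1 integrable_continuous_real cont that)
    from continuous_on_compose2[OF this cl_cont] cl
    have "continuous_on UNIV (\<lambda>s. integral {0..cl s} (\<lambda>u. F (apply_bcontfun h u)))"
      by blast
    then show ?thesis
      unfolding I_def by (rule continuous_on_add[OF continuous_on_const])
  qed
  have Ibc: "I h \<in> bcontfun" if "h \<in> S" for h
    unfolding bcontfun_def using Icont[OF that] Icball[OF that]
    by (auto intro: bounded_subset[OF bounded_cball[of X0 r]])
  have Bap: "apply_bcontfun (Bcontfun (I h)) = I h" if "h \<in> S" for h
    using Ibc[OF that] by (rule Bcontfun_inverse)
  have "\<exists>!h. h \<in> S \<and> Bcontfun (I h) = h"
  proof (rule Banach_fix[of S "1/2"])
    show "complete S"
      unfolding complete_eq_closed S_def by (rule closed_PiC) auto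
    show "S \<noteq> {}"
    proof -
      have "const_bcontfun X0 \<in> S" using r by (simp add: inS const_bcontfun.rep_eq)
      then show ?thesis by blast
    qed
    show "(\<lambda>h. Bcontfun (I h)) ` S \<subseteq> S"
      using Icball by (auto simp: inS[of "Bcontfun _"] Bap)
    show "dist (Bcontfun (I h)) (Bcontfun (I k)) \<le> 1/2 * dist h k" if "h \<in> S" "k \<in> S" for h k
    proof (rule dist_bound)
      fix s
      have "I h s - I k s
          = integral {0..cl s} (\<lambda>u. F (apply_bcontfun h u) - F (apply_bcontfun k u))"
        unfolding I_def
        by (subst integral_diff) (auto intro!: integrable_continuous_real cont that)
      also have "norm \<dots> \<le> (1/2 * dist h k) * (cl s - 0)"
      proof (rule integral_bound)
        fix u
        have "norm (F (apply_bcontfun h u) - F (apply_bcontfun k u))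
            \<le> 1/2 * dist (apply_bcontfun h u) (apply_bcontfun k u)"
          unfolding dist_norm using that inS by (intro lip) auto
        then show "norm (F (apply_bcontfun h u) - F (apply_bcontfun k u)) \<le> 1/2 * dist h k"
          using dist_bounded[of h u k] by simp
      qed (use cl[of s] cont that in \<open>auto intro!: continuous_intros\<close>)
      also have "\<dots> \<le> (1/2 * dist h k) * 1" using cl[of s] by (intro mult_left_mono) auto
      finally show "dist (apply_bcontfun (Bcontfun (I h)) s) (apply_bcontfun (Bcontfun (I k)) s) \<le> 1/2 * dist h k"
        by (simp add: Bap that dist_norm)
    qed
  qed auto
  then obtain h where h: "h \<in> S" "Bcontfun (I h) = h" by blast
  have heq: "apply_bcontfun h s = I h s" for s
    using Bap[OF h(1)] h(2) by simp
  have "apply_bcontfun h 0 = X0"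
    unfolding heq by (simp add: I_def cl_id)
  moreover have "(apply_bcontfun h has_vector_derivative F (apply_bcontfun h t)) (at t within {0..1})"
    if t: "t \<in> {0..1}" for t
  proof -
    have "((\<lambda>s. X0 + integral {0..s} (\<lambda>u. F (apply_bcontfun h u))) has_vector_derivative
        0 + F (apply_bcontfun h t)) (at t within {0..1})"
      by (intro has_vector_derivative_add has_vector_derivative_const
          integral_has_vector_derivative cont h t)
    moreover have "apply_bcontfun h s = X0 + integral {0..s} (\<lambda>u. F (apply_bcontfun h u))"
      if "s \<in> {0..1}" for s
      using heq[of s] unfolding I_def cl_id[OF that] .
    ultimately show ?thesis
      using has_vector_derivative_transform[OF t, of "apply_bcontfun h"] by simp
  qed
  ultimately show ?thesis
    using h(1) inS by blast
qed

text \<open>The equation is conjugated by a surjective linear isometry, solved in the target and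
  pulled back along the inverse \<open>K\<close>; balls and Lipschitz constants are
  preserved.\<close>

lemma picard_isometric:
  fixes F :: "'a::real_normed_vector \<Rightarrow> 'a" and J :: "'a \<Rightarrow> 'b::banach"
  assumes J: "linear J" "\<And>x. norm (J x) = norm x" "surj J"
    and lip: "\<And>x y. x \<in> cball X0 r \<Longrightarrow> y \<in> cball X0 r \<Longrightarrow> norm (F x - F y) \<le> 1/2 * norm (x - y)"
    and bd: "\<And>x. x \<in> cball X0 r \<Longrightarrow> norm (F x) \<le> r"
    and r: "r \<ge> 0"
  shows "\<exists>X. X 0 = X0 \<and> (\<forall>t\<in>{0..1}. X t \<in> cball X0 r \<and>
           (X has_vector_derivative F (X t)) (at t within {0..1}))"
proof -
  interpret J: linear J by fact
  have "inj J"
    by (rule injI) (metis J(2) J.diff norm_eq_zero right_minus_eq)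
  define K where "K = inv J"
  have JK: "J (K y) = y" for y using J(3) by (simp add: K_def surj_f_inv_f)
  have KJ: "K (J x) = x" for x using \<open>inj J\<close> by (simp add: K_def)
  have nK: "norm (K y) = norm y" for y using J(2)[of "K y"] JK by simp
  have Kadd: "K (x + y) = K x + K y" for x y
    by (rule injD[OF \<open>inj J\<close>]) (simp add: JK J.add)
  have Kscale: "K (c *\<^sub>R x) = c *\<^sub>R K x" for c x
    by (rule injD[OF \<open>inj J\<close>]) (simp add: JK J.scale)
  have Kbl: "bounded_linear K"
    by (rule bounded_linear_intro[of _ 1]) (auto simp: Kadd Kscale nK)
  then interpret K: bounded_linear K .
  have Kin: "K y \<in> cball X0 r" if "y \<in> cball (J X0) r" for y
  proof -
    have "X0 - K y = K (J X0 - y)" by (simp add: K.diff KJ)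
    then show ?thesis using that by (simp add: dist_norm nK)
  qed
  have "\<exists>Y. Y 0 = J X0 \<and> (\<forall>t\<in>{0..1}. Y t \<in> cball (J X0) r \<and>
          (Y has_vector_derivative J (F (K (Y t)))) (at t within {0..1}))"
  proof (rule picard_banach)
    show "norm (J (F (K x)) - J (F (K y))) \<le> 1/2 * norm (x - y)"
      if "x \<in> cball (J X0) r" "y \<in> cball (J X0) r" for x y
      using lip[OF Kin[OF that(1)] Kin[OF that(2)]]
      by (simp add: J(2) nK flip: J.diff K.diff)
    show "norm (J (F (K x))) \<le> r" if "x \<in> cball (J X0) r" for x
      using bd[OF Kin[OF that]] by (simp add: J(2))
  qed (rule r)
  then obtain Y where Y: "Y 0 = J X0" "\<And>t. t \<in> {0..1} \<Longrightarrow> Y t \<in> cball (J X0) r"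
    "\<And>t. t \<in> {0..1} \<Longrightarrow> (Y has_vector_derivative J (F (K (Y t)))) (at t within {0..1})" by blast
  show ?thesis
  proof (intro exI[of _ "\<lambda>t. K (Y t)"] conjI ballI)
    show "((\<lambda>t. K (Y t)) has_vector_derivative F (K (Y t))) (at t within {0..1})"
      if "t \<in> {0..1}" for t
      using K.has_vector_derivative[OF Y(3)[OF that]] by (simp add: KJ)
  qed (use Y Kin KJ in auto)
qed

text \<open>The sort of \<open>'e\<close> does not contain \<open>banach\<close>, which the library requires for integration.  The
  Riesz isomorphism onto the dual space, whose type is in \<open>banach\<close>, makes up for this.\<close>

lemma picard_hilbert:
  fixes F :: "'e::{real_inner, complete_space} \<times> 'e \<Rightarrow> 'e \<times> 'e"
  assumes lip: "\<And>x y. x \<in> cball X0 r \<Longrightarrow> y \<in> cball X0 r \<Longrightarrow> norm (F x - F y) \<le> 1/2 * norm (x - y)"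
    and bd: "\<And>x. x \<in> cball X0 r \<Longrightarrow> norm (F x) \<le> r"
    and r: "r \<ge> 0"
  shows "\<exists>X. X 0 = X0 \<and> (\<forall>t\<in>{0..1}. X t \<in> cball X0 r \<and>
           (X has_vector_derivative F (X t)) (at t within {0..1}))"
proof (rule picard_isometric[OF _ _ _ lip bd r])
  define B :: "'e \<Rightarrow>\<^sub>L 'e \<Rightarrow>\<^sub>L real" where "B = Blinfun blinfun_inner_left"
  have B: "blinfun_apply B x = blinfun_inner_left x" for x
    by (simp add: B_def bounded_linear_Blinfun_apply bounded_linear_blinfun_inner_left)
  have Bxy: "B x y = y \<bullet> x" for x y
    by (simp add: B blinfun_inner_left.rep_eq inner_commute)
  define J where "J z = (B (fst z), B (snd z))" for z
  have nB: "norm (B x) = norm x" for x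
  proof (rule antisym)
    show "norm (B x) \<le> norm x"
      by (rule norm_blinfun_bound) (simp_all add: Bxy Cauchy_Schwarz_ineq2 mult.commute[of "norm x"])
    have "(norm x)\<^sup>2 \<le> norm (B x) * norm x"
      using norm_blinfun[of "B x" x] by (simp add: Bxy power2_norm_eq_inner)
    then show "norm x \<le> norm (B x)"
      by (cases "x = 0") (auto simp: power2_eq_square)
  qed
  show "linear J"
    unfolding J_def by (rule linearI) (auto simp: blinfun.add_right blinfun.scaleR_right)
  show "norm (J z) = norm z" for z
    by (cases z) (simp add: J_def norm_Pair nB)
  have "\<exists>z. B z = l" for l
  proof -
    have "\<exists>z. \<forall>w. B z w = l w"
      by (rule riesz_representation[of _ 1]) (auto simp: Bxy inner_commute power2_norm_eq_inner)
    then show ?thesis by (meson blinfun_eqI)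
  qed
  then show "surj J"
    unfolding J_def surj_def by (metis fst_conv prod.collapse snd_conv)
qed

text \<open>Mean value inequality for \<open>f\<close> minus the uniform motion with velocity
  \<open>c\<close>. A suitable nonzero \<open>c\<close> extracts first-order terms, so that only the
  second-order remainder is estimated.\<close>

lemma norm_diff_le_of_vector_derivative:
  fixes f :: "real \<Rightarrow> 'a::real_normed_vector"
  assumes f: "\<And>s. s \<in> {a..b} \<Longrightarrow> (f has_vector_derivative f' s) (at s within {a..b})"
    and B: "\<And>s. s \<in> {a..b} \<Longrightarrow> norm (f' s - c) \<le> B"
    and st: "s \<in> {a..b}" "t \<in> {a..b}"
  shows "norm (f s - f t - (s - t) *\<^sub>R c) \<le> B * \<bar>s - t\<bar>"
proof -
  have "norm ((f s - s *\<^sub>R c) - (f t - t *\<^sub>R c)) \<le> B * norm (s - t)"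
  proof (rule differentiable_bound[of "{a..b}" _ "\<lambda>s h. h *\<^sub>R (f' s - c)"])
    show "((\<lambda>s. f s - s *\<^sub>R c) has_derivative (\<lambda>h. h *\<^sub>R (f' s - c))) (at s within {a..b})"
      if "s \<in> {a..b}" for s
      using f[OF that] unfolding has_vector_derivative_def
      by (auto intro!: derivative_eq_intros simp: algebra_simps)
    show "onorm (\<lambda>h. h *\<^sub>R (f' s - c)) \<le> B" if "s \<in> {a..b}" for s
      by (rule onorm_le) (use mult_left_mono[OF B[OF that] abs_ge_zero] in \<open>simp add: mult.commute\<close>)
  qed (use st in auto)
  then show ?thesis by (simp add: algebra_simps)
qed

lemma continuous_on_vector_derivative:
  assumes "\<And>s. s \<in> S \<Longrightarrow> (f has_vector_derivative f' s) (at s within S)"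
  shows "continuous_on S f"
  using assms has_vector_derivative_continuous
  unfolding continuous_on_eq_continuous_within by blast

text \<open>At a maximum point \<open>m\<close> of \<open>norm (Z s)\<close>, the mean value
  inequality gives \<open>norm (Z m - Z t0) \<le> 1/2 * norm (Z m)\<close>. The result serves both
  for Lipschitz dependence on initial data and, with \<open>Z t0 = 0\<close>, for
  uniqueness.\<close>

lemma gronwall_half:
  fixes Z :: "real \<Rightarrow> 'a::real_normed_vector"
  assumes Z: "\<And>s. s \<in> {a..b} \<Longrightarrow> (Z has_vector_derivative Z' s) (at s within {a..b})"
    and Z': "\<And>s. s \<in> {a..b} \<Longrightarrow> norm (Z' s) \<le> 1/2 * norm (Z s)"
    and ab: "b - a \<le> 1" and t: "t \<in> {a..b}" "t0 \<in> {a..b}"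
  shows "norm (Z t) \<le> 2 * norm (Z t0)"
proof -
  have "continuous_on {a..b} (\<lambda>s. norm (Z s))"
    by (intro continuous_on_norm continuous_on_vector_derivative[OF Z])
  then obtain m where m: "m \<in> {a..b}" "\<And>s. s \<in> {a..b} \<Longrightarrow> norm (Z s) \<le> norm (Z m)"
    using continuous_attains_sup[of "{a..b}" "\<lambda>s. norm (Z s)"] t by auto
  have "norm (Z m - Z t0) \<le> 1/2 * norm (Z m) * \<bar>m - t0\<bar>"
    using norm_diff_le_of_vector_derivative[OF Z, where c = 0 and s = m and t = t0 and B = "1/2 * norm (Z m)"] Z' m t
    by fastforce
  also have "\<dots> \<le> 1/2 * norm (Z m) * 1"
    using m t ab by (intro mult_left_mono) auto
  finally have "norm (Z m) \<le> 2 * norm (Z t0)"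
    using norm_triangle_ineq2[of "Z m" "Z t0"] by linarith
  with m(2)[OF t(1)] show ?thesis by linarith
qed

section \<open>The rescaled geodesic system and the inversion of its time-one map\<close>

text \<open>The system \<open>x' = t y\<close>, \<open>y' = - t Q(x, y)\<close> on the unit interval is the geodesic equation for
  initial velocity \<open>t w\<close>, rescaled so that its Lipschitz constant is \<open>O(t)\<close>.\<close>

lemma rescaled_spray_flow:
  fixes Q :: "'e::{real_inner, complete_space} \<Rightarrow> 'e \<Rightarrow> 'e"
  assumes \<rho>: "\<rho> > 0" and L: "L \<ge> 0" and R: "R > 0"
    and Q: "\<And>x y u v. x \<in> cball x0 \<rho> \<Longrightarrow> y \<in> cball x0 \<rho> \<Longrightarrow> norm u \<le> R + 1 \<Longrightarrow> norm v \<le> R + 1 \<Longrightarrow>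
      norm (Q x u - Q y v) \<le> L * (norm (x - y) + norm (u - v))"
  obtains \<delta> M where "\<delta> > 0" "M > 0" "\<And>t. 0 < t \<Longrightarrow> t < \<delta> \<Longrightarrow> \<exists>x y :: 'e \<Rightarrow> real \<Rightarrow> 'e.
     \<forall>w. norm w \<le> R \<longrightarrow> x w 0 = x0 \<and> y w 0 = w \<and>
       (\<forall>s\<in>{0..1}. x w s \<in> cball x0 (\<rho>/2) \<and> norm (y w s) \<le> R + 1/2 \<and>
          (x w has_vector_derivative t *\<^sub>R y w s) (at s within {0..1}) \<and>
          (y w has_vector_derivative - t *\<^sub>R Q (x w s) (y w s)) (at s within {0..1})) \<and>
       norm (x w 1 - x0 - t *\<^sub>R w) \<le> M * t\<^sup>2 \<and>
       (\<forall>w'. norm w' \<le> R \<longrightarrow>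
          norm ((x w 1 - t *\<^sub>R w) - (x w' 1 - t *\<^sub>R w')) \<le> M * t\<^sup>2 * norm (w - w'))"
    "\<And>t x x' u u'. 0 < t \<Longrightarrow> t < \<delta> \<Longrightarrow> x \<in> cball x0 \<rho> \<Longrightarrow> x' \<in> cball x0 \<rho> \<Longrightarrow>
       norm u \<le> R + 1 \<Longrightarrow> norm u' \<le> R + 1 \<Longrightarrow>
       norm ((t *\<^sub>R u, - t *\<^sub>R Q x u) - (t *\<^sub>R u', - t *\<^sub>R Q x' u')) \<le> 1/2 * norm ((x, u) - (x', u'))"
proof -
  define F where "F t z = (t *\<^sub>R snd z, - t *\<^sub>R Q (fst z) (snd z))" for t and z :: "'e \<times> 'e"
  define N where "N = norm (Q x0 0) + L * (\<rho> + (R + 1))"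
  \<comment> \<open>\<open>t * C\<close> dominates both the Lipschitz constant
    \<open>t * (1 + 2 * L)\<close> and the size \<open>t * (R + 1 + N)\<close> of the field
    \<open>F t\<close> on \<open>D\<close>, where \<open>N\<close> bounds \<open>Q\<close>.\<close>
  define C where "C = 1 + 2 * L + (R + 1) + N"
  define q where "q = min (\<rho>/2) (1/2)"
  have N: "N \<ge> 0" unfolding N_def using L \<rho> R by auto
  have C: "C > 0" "1 + 2 * L \<le> C" "R + 1 + N \<le> C" unfolding C_def using L N R by auto
  have q: "q > 0" "q \<le> \<rho>/2" "q \<le> 1/2" unfolding q_def using \<rho> by auto
  define D where "D = cball x0 \<rho> \<times> cball (0::'e) (R + 1)"
  have Flip: "norm (F t z - F t z') \<le> t * C * norm (z - z')"
    if "z \<in> D" "z' \<in> D" "t > 0" for t z z'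
  proof -
    obtain x u where z: "z = (x, u)" by (cases z)
    obtain x' u' where z': "z' = (x', u')" by (cases z')
    have n: "norm (x - x') \<le> norm (z - z')" "norm (u - u') \<le> norm (z - z')"
      unfolding z z' by (simp_all add: norm_fst_le norm_snd_le)
    have "norm (F t z - F t z') \<le> norm (t *\<^sub>R (u - u')) + norm (t *\<^sub>R (Q x u - Q x' u'))"
      using norm_Pair_le[of "t *\<^sub>R u - t *\<^sub>R u'" "- (t *\<^sub>R Q x u) + t *\<^sub>R Q x' u'"]
      unfolding F_def z z' by (simp add: algebra_simps norm_minus_commute)
    also have "\<dots> \<le> t * norm (z - z') + t * (L * (norm (z - z') + norm (z - z')))"
      using that(3) n(2) order_trans[OF Q mult_left_mono[OF add_mono[OF n] L]] that(1,2)
      unfolding norm_scaleR by (intro add_mono mult_mono) (auto simp: z z' D_def)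
    also have "\<dots> = t * ((1 + 2 * L) * norm (z - z'))" by (simp add: algebra_simps)
    also have "\<dots> \<le> t * (C * norm (z - z'))"
      using C that by (intro mult_left_mono mult_right_mono) auto
    finally show ?thesis by (simp add: mult.assoc)
  qed
  have Fbd: "norm (F t z) \<le> t * C" if "z \<in> D" "t > 0" for t z
  proof -
    obtain x u where z: "z = (x, u)" by (cases z)
    have xu: "norm (x0 - x) \<le> \<rho>" "norm u \<le> R + 1" using that by (auto simp: z D_def dist_norm)
    have "norm (Q x u - Q x0 0) \<le> L * (\<rho> + (R + 1))"
      using Q[of x x0 u 0] xu L \<rho> R
      by (auto simp: dist_norm norm_minus_commute intro: order_trans[OF _ mult_left_mono[OF add_mono]])
    then have "norm (Q x u) \<le> N"
      unfolding N_def using norm_triangle_sub[of "Q x u" "Q x0 0"] by linarith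
    have "norm (F t z) \<le> norm (t *\<^sub>R u) + norm (- t *\<^sub>R Q x u)"
      unfolding F_def z by (simp add: norm_Pair_le[of "t *\<^sub>R u" "- t *\<^sub>R Q x u", simplified])
    also have "\<dots> \<le> t * (R + 1) + t * N"
      using that xu \<open>norm (Q x u) \<le> N\<close> by (auto intro!: add_mono mult_left_mono)
    also have "\<dots> = t * (R + 1 + N)" by (simp add: algebra_simps)
    also have "\<dots> \<le> t * C" using C that by (intro mult_left_mono) auto
    finally show ?thesis .
  qed
  \<comment> \<open>The first bound gives Lipschitz constant 1/2, the second keeps solutions in a
    ball of radius \<open>q\<close> about their initial value.\<close>
  define \<delta> where "\<delta> = min (1 / (2 * C)) (q / C)"
  have \<delta>: "\<delta> > 0" unfolding \<delta>_def using C q by auto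
  have tC: "t * C \<le> 1/2" "t * C \<le> q" if "0 < t" "t < \<delta>" for t
    using that C by (auto simp: \<delta>_def field_simps)
  have half: "norm (F t z - F t z') \<le> 1/2 * norm (z - z')"
    if "z \<in> D" "z' \<in> D" "0 < t" "t < \<delta>" for t z z'
    using Flip[OF that(1-3)] mult_right_mono[OF tC(1)[OF that(3,4)] norm_ge_zero[of "z - z'"]]
    by linarith
  \<comment> \<open>Solutions stay in the smaller set \<open>D'\<close> while the Lipschitz estimate
    holds on \<open>D\<close>; this margin is used in the uniqueness proof, where a competitor is
    known to stay close only for a short time.\<close>
  define D' where "D' = cball x0 (\<rho>/2) \<times> cball (0::'e) (R + 1/2)"
  have D': "D' \<subseteq> D" unfolding D_def D'_def using \<rho> R by (auto simp: subset_iff)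
  have flow: "\<exists>X. X 0 = (x0, w) \<and> (\<forall>s\<in>{0..1}. X s \<in> D' \<and>
      (X has_vector_derivative F t (X s)) (at s within {0..1}))"
    if w: "norm w \<le> R" and t: "0 < t" "t < \<delta>" for w t
  proof -
    have sub: "z \<in> D'" if z: "z \<in> cball (x0, w) q" for z
    proof -
      have "dist x0 (fst z) \<le> q" "dist w (snd z) \<le> q"
        using z dist_fst_le[of "(x0, w)" z] dist_snd_le[of "(x0, w)" z] by auto
      moreover have "norm (snd z) \<le> norm w + dist w (snd z)"
        using norm_triangle_sub[of "snd z" w] by (simp add: dist_norm norm_minus_commute)
      ultimately show ?thesis using q w by (cases z) (auto simp: D'_def)
    qed
    have "\<exists>X. X 0 = (x0, w) \<and> (\<forall>s\<in>{0..1}. X s \<in> cball (x0, w) q \<and>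
      (X has_vector_derivative F t (X s)) (at s within {0..1}))"
    proof (rule picard_hilbert)
      show "norm (F t x) \<le> q" if "x \<in> cball (x0, w) q" for x
        using Fbd[OF subsetD[OF D' sub[OF that]] t(1)] tC(2)[OF t] by linarith
      show "norm (F t x - F t y) \<le> 1/2 * norm (x - y)"
        if "x \<in> cball (x0, w) q" "y \<in> cball (x0, w) q" for x y
        using half[OF subsetD[OF D' sub[OF that(1)]] subsetD[OF D' sub[OF that(2)]] t] .
    qed (use q in auto)
    then show ?thesis using sub by blast
  qed
  show thesis
  proof (rule that[of \<delta> "2 * C"])
    fix t :: real assume t: "0 < t" "t < \<delta>"
    obtain X where X: "\<And>w. norm w \<le> R \<Longrightarrow> X w 0 = (x0, w)"
      "\<And>w s. norm w \<le> R \<Longrightarrow> s \<in> {0..1} \<Longrightarrow> X w s \<in> D'"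
      "\<And>w s. norm w \<le> R \<Longrightarrow> s \<in> {0..1} \<Longrightarrow>
         (X w has_vector_derivative F t (X w s)) (at s within {0..1})"
      using flow[OF _ t] by metis
    have XD: "X w s \<in> D" if "norm w \<le> R" "s \<in> {0..1}" for w s
      using X(2)[OF that] D' by blast
    define x where "x w s = fst (X w s)" for w s
    define y where "y w s = snd (X w s)" for w s
    have X_eq: "X w s = (x w s, y w s)" for w s by (simp add: x_def y_def)
    have F_eq: "F t (X w s) = (t *\<^sub>R y w s, - t *\<^sub>R Q (x w s) (y w s))" for w s
      by (simp add: F_def x_def y_def)
    have dx: "(x w has_vector_derivative t *\<^sub>R y w s) (at s within {0..1})"
      and dy: "(y w has_vector_derivative - t *\<^sub>R Q (x w s) (y w s)) (at s within {0..1})"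
      if "norm w \<le> R" "s \<in> {0..1}" for w s
      using bounded_linear.has_vector_derivative[OF bounded_linear_fst X(3)[OF that]]
        bounded_linear.has_vector_derivative[OF bounded_linear_snd X(3)[OF that]]
      by (simp_all add: F_eq flip: x_def y_def)
    have x0: "x w 0 = x0" "y w 0 = w" if "norm w \<le> R" for w
      using X(1)[OF that] by (simp_all add: x_def y_def)
    have xy: "x w s \<in> cball x0 (\<rho>/2)" "norm (y w s) \<le> R + 1/2" if "norm w \<le> R" "s \<in> {0..1}" for w s
      using X(2)[OF that] by (simp_all add: D'_def X_eq)
    \<comment> \<open>The velocity drifts by at most \<open>t * C\<close>; as
      \<open>x' = t y\<close>, the position deviates from uniform motion by one more factor
      \<open>t\<close>.\<close>
    have yw: "norm (y w s - w) \<le> t * C" if w: "norm w \<le> R" and s: "s \<in> {0..1}" for w s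
    proof -
      have "norm (y w s - y w 0 - (s - 0) *\<^sub>R 0) \<le> (t * C) * \<bar>s - 0\<bar>"
      proof (rule norm_diff_le_of_vector_derivative[OF dy[OF w]])
        show "norm (- t *\<^sub>R Q (x w s) (y w s) - 0) \<le> t * C" if "s \<in> {0..1}" for s
          using Fbd[OF XD[OF w that] t(1)] norm_snd_le[of "- t *\<^sub>R Q (x w s) (y w s)" "t *\<^sub>R y w s"]
          unfolding F_eq by simp
      qed (use s in auto)
      also have "\<dots> \<le> (t * C) * 1" using s t C by (intro mult_left_mono) auto
      finally show ?thesis by (simp add: x0 w)
    qed
    have e1: "norm (x w 1 - x0 - t *\<^sub>R w) \<le> 2 * C * t\<^sup>2" if w: "norm w \<le> R" for w
    proof -
      have "norm (x w 1 - x w 0 - (1 - 0) *\<^sub>R (t *\<^sub>R w)) \<le> (t * (t * C)) * \<bar>1 - 0\<bar>"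
      proof (rule norm_diff_le_of_vector_derivative[OF dx[OF w]])
        show "norm (t *\<^sub>R y w s - t *\<^sub>R w) \<le> t * (t * C)" if "s \<in> {0..1}" for s
          using mult_left_mono[OF yw[OF w that], of t] t by (simp flip: scaleR_diff_right)
      qed auto
      also have "\<dots> \<le> 2 * C * t\<^sup>2" using C by (simp add: power2_eq_square)
      finally show ?thesis by (simp add: x0 w)
    qed
    \<comment> \<open>Two factors \<open>t\<close> arise, one from the Lipschitz constant of
      \<open>F t\<close> in the equation for the velocities and one from \<open>x' = t y\<close>.
      The 2 in \<open>2 * C\<close> is the Gronwall factor.\<close>
    have e2: "norm ((x w 1 - t *\<^sub>R w) - (x w' 1 - t *\<^sub>R w')) \<le> 2 * C * t\<^sup>2 * norm (w - w')"
      if w: "norm w \<le> R" and w': "norm w' \<le> R" for w w'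
    proof -
      have Z: "((\<lambda>s. X w s - X w' s) has_vector_derivative F t (X w s) - F t (X w' s)) (at s within {0..1})"
        if "s \<in> {0..1}" for s
        by (intro has_vector_derivative_diff X that w w')
      have bnd: "norm (X w s - X w' s) \<le> 2 * norm (w - w')" if s: "s \<in> {0..1}" for s
        using gronwall_half[OF Z half, of s 0] X(1) XD w w' s t by simp
      have yd: "norm ((y w s - y w' s) - (w - w')) \<le> t * C * (2 * norm (w - w'))" if s: "s \<in> {0..1}" for s
      proof -
        have "norm ((X w s - X w' s) - (X w 0 - X w' 0) - (s - 0) *\<^sub>R 0)
            \<le> (t * C * (2 * norm (w - w'))) * \<bar>s - 0\<bar>"
        proof (rule norm_diff_le_of_vector_derivative[OF Z])
          show "norm (F t (X w s) - F t (X w' s) - 0) \<le> t * C * (2 * norm (w - w'))"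
            if "s \<in> {0..1}" for s
            using order_trans[OF Flip[OF XD[OF w that] XD[OF w' that] t(1)]
              mult_left_mono[OF bnd[OF that]]] t C by simp
        qed (use s in auto)
        also have "\<dots> \<le> (t * C * (2 * norm (w - w'))) * 1"
          using s t C by (intro mult_left_mono) auto
        finally have "norm ((X w s - X w' s) - (X w 0 - X w' 0)) \<le> t * C * (2 * norm (w - w'))" by simp
        moreover have "(X w s - X w' s) - (X w 0 - X w' 0)
            = (x w s - x w' s, (y w s - y w' s) - (w - w'))"
          by (simp add: X_eq x0 w w')
        ultimately show ?thesis
          using norm_snd_le[of "(y w s - y w' s) - (w - w')" "x w s - x w' s"] by simp
      qed
      have "norm ((x w 1 - x w' 1) - (x w 0 - x w' 0) - (1 - 0) *\<^sub>R (t *\<^sub>R (w - w')))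
          \<le> (t * (t * C * (2 * norm (w - w')))) * \<bar>1 - 0\<bar>"
      proof (rule norm_diff_le_of_vector_derivative)
        show "((\<lambda>s. x w s - x w' s) has_vector_derivative t *\<^sub>R y w s - t *\<^sub>R y w' s) (at s within {0..1})"
          if "s \<in> {0..1}" for s
          by (intro has_vector_derivative_diff dx that w w')
        show "norm (t *\<^sub>R y w s - t *\<^sub>R y w' s - t *\<^sub>R (w - w')) \<le> t * (t * C * (2 * norm (w - w')))"
          if "s \<in> {0..1}" for s
          using mult_left_mono[OF yd[OF that], of t] t by (simp flip: scaleR_diff_right)
      qed auto
      then show ?thesis
        by (simp add: x0 w w' algebra_simps power2_eq_square)
    qed
    show "\<exists>x y :: 'e \<Rightarrow> real \<Rightarrow> 'e.
     \<forall>w. norm w \<le> R \<longrightarrow> x w 0 = x0 \<and> y w 0 = w \<and>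
       (\<forall>s\<in>{0..1}. x w s \<in> cball x0 (\<rho>/2) \<and> norm (y w s) \<le> R + 1/2 \<and>
          (x w has_vector_derivative t *\<^sub>R y w s) (at s within {0..1}) \<and>
          (y w has_vector_derivative - t *\<^sub>R Q (x w s) (y w s)) (at s within {0..1})) \<and>
       norm (x w 1 - x0 - t *\<^sub>R w) \<le> (2 * C) * t\<^sup>2 \<and>
       (\<forall>w'. norm w' \<le> R \<longrightarrow>
          norm ((x w 1 - t *\<^sub>R w) - (x w' 1 - t *\<^sub>R w')) \<le> (2 * C) * t\<^sup>2 * norm (w - w'))"
      by (rule exI[of _ x], rule exI[of _ y]) (use x0 xy dx dy e1 e2 in blast)
  next
    fix t :: real and x x' u u' :: 'e
    assume "0 < t" "t < \<delta>" "x \<in> cball x0 \<rho>" "x' \<in> cball x0 \<rho>" "norm u \<le> R + 1" "norm u' \<le> R + 1"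
    then show "norm ((t *\<^sub>R u, - t *\<^sub>R Q x u) - (t *\<^sub>R u', - t *\<^sub>R Q x' u')) \<le> 1/2 * norm ((x, u) - (x', u'))"
      using half[of "(x, u)" "(x', u')" t] by (simp add: F_def D_def)
  qed (use \<delta> C in auto)
qed

text \<open>Solving \<open>E w = x0 + t z\<close> amounts to finding a fixed point of
  \<open>T w = z - (E w - x0 - t w) / t\<close>. By \<open>E2\<close> it contracts with constant
  \<open>M * t\<close>, and by \<open>E1\<close> it moves points to within \<open>M * t\<close> of
  \<open>z\<close>, hence into \<open>cball 0 R\<close>. The fixed point inherits the latter
  estimate.\<close>

lemma perturbation_surjective:
  fixes E :: "'e::{real_normed_vector, complete_space} \<Rightarrow> 'e"
  assumes E1: "\<And>w. norm w \<le> R \<Longrightarrow> norm (E w - x0 - t *\<^sub>R w) \<le> M * t\<^sup>2"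
    and E2: "\<And>w w'. norm w \<le> R \<Longrightarrow> norm w' \<le> R \<Longrightarrow>
      norm ((E w - t *\<^sub>R w) - (E w' - t *\<^sub>R w')) \<le> M * t\<^sup>2 * norm (w - w')"
    and t: "t > 0" "M * t \<le> 1/2" "M * t \<le> R/2" and z: "norm z \<le> R/2"
  obtains w where "norm w \<le> R" "E w = x0 + t *\<^sub>R z" "norm (w - z) \<le> M * t"
proof -
  define T where "T w = z - (1/t) *\<^sub>R (E w - x0 - t *\<^sub>R w)" for w
  have Tz: "norm (T w - z) \<le> M * t" if "norm w \<le> R" for w
  proof -
    have "norm (T w - z) = (1/t) * norm (E w - x0 - t *\<^sub>R w)"
      using t by (simp add: T_def del: scaleR_diff_right)
    also have "\<dots> \<le> (1/t) * (M * t\<^sup>2)"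
      using E1[OF that] t by (intro mult_left_mono) auto
    finally show ?thesis using t by (simp add: power2_eq_square)
  qed
  have "\<exists>!w. w \<in> cball 0 R \<and> T w = w"
  proof (rule Banach_fix[of "cball 0 R" "1/2"])
    show "complete (cball (0::'e) R)" by (simp add: complete_eq_closed)
    have "R \<ge> 0" using z norm_ge_zero[of z] by linarith
    then show "cball (0::'e) R \<noteq> {}" by simp
    show "T ` cball 0 R \<subseteq> cball 0 R"
    proof (safe)
      fix w assume "w \<in> cball (0::'e) R"
      then have "norm (T w - z) \<le> M * t" by (auto intro: Tz)
      then show "T w \<in> cball 0 R"
        using norm_triangle_sub[of "T w" z] t z by auto
    qed
    show "dist (T w) (T w') \<le> 1/2 * dist w w'" if "w \<in> cball 0 R" "w' \<in> cball 0 R" for w w'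
    proof -
      have "T w - T w' = (1/t) *\<^sub>R ((E w' - t *\<^sub>R w') - (E w - t *\<^sub>R w))"
        by (simp add: T_def algebra_simps)
      then have "norm (T w - T w') \<le> (1/t) * (M * t\<^sup>2 * norm (w - w'))"
        using E2[of w' w] that t by (simp add: norm_minus_commute divide_right_mono)
      also have "\<dots> = M * t * norm (w - w')" using t by (simp add: power2_eq_square)
      also have "\<dots> \<le> 1/2 * norm (w - w')" using t by (intro mult_right_mono) auto
      finally show ?thesis by (simp add: dist_norm)
    qed
  qed auto
  then obtain w where w: "norm w \<le> R" "T w = w" by auto
  have "t *\<^sub>R T w = t *\<^sub>R z - (E w - x0 - t *\<^sub>R w)"
    using t by (simp add: T_def scaleR_diff_right)
  then have "E w = x0 + t *\<^sub>R z" using w by (simp add: algebra_simps)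
  with w Tz[OF w(1)] show thesis by (intro that) auto
qed

section \<open>Charts and tangent spaces\<close>

text \<open>Geodesics see the Christoffel map only on the diagonal, where the three terms of the
  Koszul formula reduce to \<open>D u u w - D w u u / 2\<close>.\<close>

definition spray ::
    "('m, 'e::real_normed_vector) chart set \<Rightarrow> ('m, 'e) metric \<Rightarrow> ('m, 'e) chart \<Rightarrow> 'e \<Rightarrow> 'e \<Rightarrow> 'e"
  where "spray A g c x u = christoffel A g c x u u"

text \<open>Bundling the derivative as a bounded operator lets it be differentiated once more as a
  function of the base point.\<close>

definition tder :: "('m, 'e::real_normed_vector) chart \<Rightarrow> ('m, 'e) chart \<Rightarrow> 'e \<Rightarrow> 'e \<Rightarrow>\<^sub>L 'e"
  where "tder c c' x = Blinfun (frechet_derivative (transition c c') (at x))"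

locale riem =
  fixes A :: "('m::t2_space, 'e::{real_inner, complete_space}) chart set"
    and g :: "('m, 'e) metric"
  assumes rm: "riemannian_manifold A g"
begin

lemma atlas: "smooth_atlas A"
  using rm unfolding riemannian_manifold_def by blast

lemma cover: obtains c where "c \<in> A" "p \<in> fst c"
  using atlas unfolding smooth_atlas_def by blast

lemma chart:
  assumes "c \<in> A"
  shows open_dom: "open (fst c)" and open_img: "open (snd c ` fst c)"
    and cont_chart: "continuous_on (fst c) (snd c)"
    and cont_inv: "continuous_on (snd c ` fst c) (chart_inv c)"
    and chart_inv_in: "x \<in> snd c ` fst c \<Longrightarrow> chart_inv c x \<in> fst c"
    and chart_chart_inv: "x \<in> snd c ` fst c \<Longrightarrow> snd c (chart_inv c x) = x"
    and chart_inv_chart: "q \<in> fst c \<Longrightarrow> chart_inv c (snd c q) = q"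
  using atlas assms unfolding smooth_atlas_def is_chart_def homeomorphism_def by auto

lemma overlap_iff:
  assumes "c \<in> A" "x \<in> snd c ` fst c"
  shows "x \<in> snd c ` (fst c \<inter> fst c') \<longleftrightarrow> chart_inv c x \<in> fst c'"
proof
  show "chart_inv c x \<in> fst c'" if "x \<in> snd c ` (fst c \<inter> fst c')"
    using that chart_inv_chart[OF assms(1)] by auto
  show "x \<in> snd c ` (fst c \<inter> fst c')" if "chart_inv c x \<in> fst c'"
    by (rule image_eqI[of _ _ "chart_inv c x"])
      (use that chart_inv_in[OF assms] chart_chart_inv[OF assms] in simp_all)
qed

lemma open_overlap:
  assumes "c \<in> A" "c' \<in> A"
  shows "open (snd c ` (fst c \<inter> fst c'))"
proof -
  have "snd c ` (fst c \<inter> fst c') = snd c ` fst c \<inter> chart_inv c -` fst c'"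
    using overlap_iff[OF assms(1)] by (auto simp: chart_inv_chart assms(1))
  then show ?thesis
    by (simp only: continuous_open_preimage[OF cont_inv[OF assms(1)] open_img[OF assms(1)] open_dom[OF assms(2)]])
qed

text \<open>The symmetric second derivative in the last claim is the inhomogeneous term by which the
  spray changes from chart to chart.\<close>

lemma tder:
  assumes "c \<in> A" "c' \<in> A" "x \<in> snd c ` (fst c \<inter> fst c')"
  shows tder_deriv: "(transition c c' has_derivative tder c c' x) (at x)"
    and tder_apply: "blinfun_apply (tder c c' x) = frechet_derivative (transition c c') (at x)"
    and tder2: "\<exists>f2 :: 'e \<Rightarrow>\<^sub>L 'e \<Rightarrow>\<^sub>L 'e. (tder c c' has_derivative blinfun_apply f2) (at x) \<and>
          (\<forall>u v. f2 u v = f2 v u)"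
proof -
  let ?W = "snd c ` (fst c \<inter> fst c')"
  have sm: "smooth_on ?W (transition c c')"
    using atlas assms unfolding smooth_atlas_def by blast
  obtain f1 f2 where f: "\<And>x. x \<in> ?W \<Longrightarrow> (transition c c' has_derivative blinfun_apply (f1 x)) (at x)"
    "\<And>x. x \<in> ?W \<Longrightarrow> (f1 has_derivative blinfun_apply (f2 x)) (at x)"
    "\<And>x. x \<in> ?W \<Longrightarrow> \<exists>L. \<exists>d>0. ball x d \<subseteq> ?W \<and> (\<forall>y\<in>ball x d. norm (f2 y) \<le> L)"
    by (rule smooth_on_derivatives[OF open_overlap[OF assms(1,2)] sm]) (rule that; assumption)
  have eq: "tder c c' y = f1 y" if "y \<in> ?W" for y
    unfolding tder_def frechet_derivative_at[OF f(1)[OF that], symmetric]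
    by (rule blinfun_apply_inverse)
  show "(transition c c' has_derivative tder c c' x) (at x)"
    using f(1)[OF assms(3)] eq[OF assms(3)] by simp
  then show "blinfun_apply (tder c c' x) = frechet_derivative (transition c c') (at x)"
    by (rule frechet_derivative_at)
  have "(tder c c' has_derivative blinfun_apply (f2 x)) (at x)"
    by (rule has_derivative_transform_within_open[OF f(2)[OF assms(3)] open_overlap[OF assms(1,2)] assms(3)])
      (simp add: eq)
  moreover have "f2 x u v = f2 x v u" for u v
    by (rule second_derivative_symmetric[OF open_overlap[OF assms(1,2)] assms(3) f(1) f(2)[OF assms(3)]])
  ultimately show "\<exists>f2 :: 'e \<Rightarrow>\<^sub>L 'e \<Rightarrow>\<^sub>L 'e. (tder c c' has_derivative blinfun_apply f2) (at x) \<and>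
          (\<forall>u v. f2 u v = f2 v u)" by blast
qed

lemma tder_cont:
  assumes "c \<in> A" "c' \<in> A"
  shows "continuous_on (snd c ` (fst c \<inter> fst c')) (tder c c')"
proof (rule continuous_at_imp_continuous_on, rule ballI)
  fix x assume "x \<in> snd c ` (fst c \<inter> fst c')"
  from tder2[OF assms this] show "isCont (tder c c') x"
    using has_derivative_continuous by blast
qed

lemma transition_chart: "c \<in> A \<Longrightarrow> q \<in> fst c \<Longrightarrow> transition c c' (snd c q) = snd c' q"
  by (simp add: transition_def chart_inv_chart)

text \<open>Chain rule for the composite of two transition maps, which is the direct transition map
  near \<open>snd c p\<close>.\<close>

lemma tder_cocycle:
  assumes c: "c \<in> A" "c' \<in> A" "c'' \<in> A" and p: "p \<in> fst c" "p \<in> fst c'" "p \<in> fst c''"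
  shows "tder c' c'' (snd c' p) (tder c c' (snd c p) u) = tder c c'' (snd c p) u"
proof -
  let ?W = "snd c ` (fst c \<inter> fst c')"
  have d: "(transition c c' has_derivative tder c c' (snd c p)) (at (snd c p))"
    by (rule tder_deriv) (use c p in auto)
  have d': "(transition c' c'' has_derivative tder c' c'' (snd c' p)) (at (transition c c' (snd c p)))"
    unfolding transition_chart[OF c(1) p(1)] by (rule tder_deriv) (use c p in auto)
  have "((\<lambda>x. transition c' c'' (transition c c' x)) has_derivative
      (\<lambda>u. tder c' c'' (snd c' p) (tder c c' (snd c p) u))) (at (snd c p))"
    by (rule has_derivative_compose[OF d d'])
  then have "(transition c c'' has_derivative
      (\<lambda>u. tder c' c'' (snd c' p) (tder c c' (snd c p) u))) (at (snd c p))"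
    by (rule has_derivative_transform_within_open[OF _ open_overlap[OF c(1,2)]])
      (use c p in \<open>auto simp: transition_chart\<close>)
  moreover have "(transition c c'' has_derivative tder c c'' (snd c p)) (at (snd c p))"
    by (rule tder_deriv) (use c p in auto)
  ultimately show ?thesis
    by (rule fun_cong[OF has_derivative_unique])
qed

lemma tder_self:
  assumes "c \<in> A" "p \<in> fst c"
  shows "tder c c (snd c p) u = u"
proof -
  have "(transition c c has_derivative (\<lambda>u. u)) (at (snd c p))"
    by (rule has_derivative_transform_within_open[OF has_derivative_ident open_img[OF assms(1)]])
      (use assms in \<open>auto simp: transition_chart\<close>)
  moreover have "(transition c c has_derivative tder c c (snd c p)) (at (snd c p))"
    by (rule tder_deriv) (use assms in auto)
  ultimately show ?thesis
    by (rule fun_cong[OF has_derivative_unique, symmetric])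
qed

section \<open>Tangent vectors and their components in one chart\<close>

lemma coord_tangent_apply:
  assumes "c \<in> A" "p \<in> fst c"
  shows "coord_tangent A c p u c' = (if c' \<in> A \<and> p \<in> fst c' then tder c c' (snd c p) u else 0)"
  unfolding coord_tangent_def using assms by (simp add: tder_apply)

lemma coord_tangent_self [simp]: "c \<in> A \<Longrightarrow> p \<in> fst c \<Longrightarrow> coord_tangent A c p u c = u"
  by (simp add: coord_tangent_apply tder_self)

lemma tangent_transform:
  assumes "v \<in> tangent_space A p" "c \<in> A" "c' \<in> A" "p \<in> fst c" "p \<in> fst c'"
  shows "v c' = tder c c' (snd c p) (v c)"
proof -
  have "v c' = frechet_derivative (transition c c') (at (snd c p)) (v c)"
    using assms unfolding tangent_space_def by blast
  then show ?thesis using tder_apply[of c c' "snd c p"] assms by simp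
qed

lemma tangent_outside: "v \<in> tangent_space A p \<Longrightarrow> c \<notin> A \<or> p \<notin> fst c \<Longrightarrow> v c = 0"
  unfolding tangent_space_def by blast

lemma tangent_spaceI:
  assumes "\<And>c. c \<notin> A \<or> p \<notin> fst c \<Longrightarrow> v c = 0"
    and "\<And>c c'. c \<in> A \<Longrightarrow> c' \<in> A \<Longrightarrow> p \<in> fst c \<Longrightarrow> p \<in> fst c' \<Longrightarrow> v c' = tder c c' (snd c p) (v c)"
  shows "v \<in> tangent_space A p"
  unfolding tangent_space_def
proof (intro CollectI conjI allI ballI impI)
  fix c c' assume "c \<in> A" "c' \<in> A" "p \<in> fst c" "p \<in> fst c'"
  then show "v c' = frechet_derivative (transition c c') (at (snd c p)) (v c)"
    using assms(2) tder_apply[of c c' "snd c p"] by (metis IntI image_eqI)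
qed (rule assms(1))

lemma coord_tangent_in:
  assumes "c \<in> A" "p \<in> fst c"
  shows "coord_tangent A c p u \<in> tangent_space A p"
  by (rule tangent_spaceI) (use assms tder_cocycle in \<open>auto simp add: coord_tangent_apply\<close>)

lemma tangent_eq_coord:
  assumes "v \<in> tangent_space A p" "c \<in> A" "p \<in> fst c"
  shows "v = coord_tangent A c p (v c)"
proof
  fix c'
  show "v c' = coord_tangent A c p (v c) c'"
  proof (cases "c' \<in> A \<and> p \<in> fst c'")
    case True
    then show ?thesis
      unfolding coord_tangent_apply[OF assms(2,3)] using tangent_transform[OF assms(1,2) _ assms(3)] by simp
  next
    case False
    then show ?thesis
      unfolding coord_tangent_apply[OF assms(2,3)] using tangent_outside[OF assms(1)] by auto
  qed
qed

lemma tangent_minus_in: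
  assumes "v \<in> tangent_space A p" "w \<in> tangent_space A p"
  shows "tangent_minus v w \<in> tangent_space A p"
proof (rule tangent_spaceI)
  fix c c' assume c: "c \<in> A" "c' \<in> A" "p \<in> fst c" "p \<in> fst c'"
  show "tangent_minus v w c' = tder c c' (snd c p) (tangent_minus v w c)"
    unfolding tangent_minus_def tangent_transform[OF assms(1) c] tangent_transform[OF assms(2) c]
    by (simp add: blinfun.diff_right)
qed (simp add: tangent_minus_def tangent_outside[OF assms(1)] tangent_outside[OF assms(2)])

lemma tangent_scale_in:
  assumes "v \<in> tangent_space A p"
  shows "tangent_scale t v \<in> tangent_space A p"
proof (rule tangent_spaceI)
  fix c c' assume c: "c \<in> A" "c' \<in> A" "p \<in> fst c" "p \<in> fst c'"
  show "tangent_scale t v c' = tder c c' (snd c p) (tangent_scale t v c)"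
    unfolding tangent_scale_def tangent_transform[OF assms c] by (simp add: blinfun.scaleR_right)
qed (simp add: tangent_scale_def tangent_outside[OF assms])

section \<open>The metric and its spray in a chart\<close>

text \<open>\<open>SOME\<close> selects one of the coordinate representations granted by
  \<open>riemannian_manifold\<close>; on the chart image all of them agree by
  \<open>gram_coord\<close>. Unlike the scalar functions \<open>metric_rep\<close>, it takes values
  in a normed space of forms and is differentiated in the operator norm.\<close>

definition gram :: "('m, 'e) chart \<Rightarrow> 'e \<Rightarrow> 'e \<Rightarrow>\<^sub>L 'e \<Rightarrow>\<^sub>L real" where
  "gram c = (SOME G. smooth_on (snd c ` fst c) G \<and>
     (\<forall>p\<in>fst c. \<forall>u\<in>tangent_space A p. \<forall>v\<in>tangent_space A p.
        g p u v = blinfun_apply (blinfun_apply (G (snd c p)) (u c)) (v c)))"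

lemma gram:
  assumes "c \<in> A"
  shows gram_smooth: "smooth_on (snd c ` fst c) (gram c)"
    and gram_eq: "p \<in> fst c \<Longrightarrow> u \<in> tangent_space A p \<Longrightarrow> v \<in> tangent_space A p \<Longrightarrow>
      g p u v = gram c (snd c p) (u c) (v c)"
proof -
  have "\<exists>G. smooth_on (snd c ` fst c) G \<and>
     (\<forall>p\<in>fst c. \<forall>u\<in>tangent_space A p. \<forall>v\<in>tangent_space A p.
        g p u v = blinfun_apply (blinfun_apply (G (snd c p)) (u c)) (v c))"
    using rm assms unfolding riemannian_manifold_def by blast
  from someI_ex[OF this] show "smooth_on (snd c ` fst c) (gram c)"
    "p \<in> fst c \<Longrightarrow> u \<in> tangent_space A p \<Longrightarrow> v \<in> tangent_space A p \<Longrightarrow>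
      g p u v = gram c (snd c p) (u c) (v c)"
    unfolding gram_def by blast+
qed

lemma gram_coord:
  assumes "c \<in> A" "q \<in> fst c"
  shows "gram c (snd c q) a b = g q (coord_tangent A c q a) (coord_tangent A c q b)"
  using gram_eq[OF assms coord_tangent_in[OF assms] coord_tangent_in[OF assms]] assms by simp

lemma gram_sym:
  assumes "c \<in> A" "x \<in> snd c ` fst c"
  shows "gram c x a b = gram c x b a"
proof -
  obtain q where q: "q \<in> fst c" "x = snd c q" using assms by auto
  show ?thesis
    using rm coord_tangent_in[OF assms(1) q(1)] unfolding q(2) gram_coord[OF assms(1) q(1)]
      riemannian_manifold_def by blast
qed

text \<open>This is the norm equivalence, squared, with \<open>k = 1 / K^2\<close>. In infinite
  dimension positive definiteness alone would not give a uniform \<open>k\<close>. Nonnegativity of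
  \<open>g\<close> is established beforehand so that the square root in \<open>tangent_norm\<close>
  can be undone.\<close>

lemma gram_coercive:
  assumes "c \<in> A" "x \<in> snd c ` fst c"
  obtains k where "k > 0" "\<And>a. k * (norm a)\<^sup>2 \<le> gram c x a a"
proof -
  obtain q where q: "q \<in> fst c" "x = snd c q" using assms by auto
  obtain K where K: "K > 0" "\<And>u. u \<in> tangent_space A q \<Longrightarrow> norm (u c) \<le> K * tangent_norm g q u"
    using rm assms q(1) unfolding riemannian_manifold_def by meson
  have pos: "g q u u \<ge> 0" if "u \<in> tangent_space A q" for u
  proof (cases "u = (\<lambda>_. 0)")
    case True
    then show ?thesis using gram_eq[OF assms(1) q(1) that that] by simp
  next
    case False
    then show ?thesis using rm that unfolding riemannian_manifold_def by (meson less_imp_le)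
  qed
  have "1 / K\<^sup>2 * (norm a)\<^sup>2 \<le> gram c x a a" for a
  proof -
    let ?u = "coord_tangent A c q a"
    have u: "?u \<in> tangent_space A q" by (rule coord_tangent_in) (use assms q in auto)
    have "(norm a)\<^sup>2 \<le> (K * sqrt (g q ?u ?u))\<^sup>2"
      using K(2)[OF u] assms q by (intro power_mono) (auto simp: tangent_norm_def)
    also have "\<dots> = K\<^sup>2 * gram c x a a"
      using pos[OF u] by (simp add: power_mult_distrib q(2) gram_coord[OF assms(1) q(1)])
    finally show ?thesis using K(1) by (simp add: field_simps)
  qed
  then show thesis using K(1) by (intro that[of "1 / K\<^sup>2"]) auto
qed

lemma gram_nonneg:
  assumes "c \<in> A" "x \<in> snd c ` fst c"
  shows "gram c x a a \<ge> 0"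
proof -
  obtain k where "k > 0" "k * (norm a)\<^sup>2 \<le> gram c x a a"
    using gram_coercive[OF assms] by blast
  moreover from this have "0 \<le> k * (norm a)\<^sup>2" by simp
  ultimately show ?thesis by linarith
qed

lemma gram_eq_0:
  assumes "c \<in> A" "x \<in> snd c ` fst c" "gram c x a a = 0"
  shows "a = 0"
proof -
  obtain k where "k > 0" "k * (norm a)\<^sup>2 \<le> gram c x a a"
    using gram_coercive[OF assms(1,2)] by blast
  with assms(3) show ?thesis by (simp add: mult_le_0_iff)
qed

lemma metric_rep_eq:
  assumes "c \<in> A" "x \<in> snd c ` fst c"
  shows "metric_rep A g c x a b = gram c x a b"
proof -
  obtain q where q: "q \<in> fst c" "x = snd c q" using assms by auto
  then show ?thesis
    by (simp add: metric_rep_def gram_coord assms(1) chart_inv_chart)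
qed

lemma gram_transform:
  assumes "c \<in> A" "c' \<in> A" "x \<in> snd c ` (fst c \<inter> fst c')"
  shows "gram c x a b = gram c' (transition c c' x) (tder c c' x a) (tder c c' x b)"
proof -
  obtain q where q: "q \<in> fst c" "q \<in> fst c'" "x = snd c q" using assms by auto
  have "gram c x a b = g q (coord_tangent A c q a) (coord_tangent A c q b)"
    by (simp add: q gram_coord assms)
  also have "\<dots> = gram c' (snd c' q) (coord_tangent A c q a c') (coord_tangent A c q b c')"
    by (intro gram_eq coord_tangent_in assms q)
  finally show ?thesis
    by (simp add: q assms transition_chart coord_tangent_apply)
qed

text \<open>The right-hand side is the Koszul formula on the diagonal and is a bounded functional of
  \<open>w\<close>. The Riesz theorem gives existence of a representing vector and definiteness
  gives uniqueness, so the definite description in \<open>christoffel\<close> denotes it and may be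
  replaced by an equation.\<close>

lemma spray_char:
  fixes G1 :: "'e \<Rightarrow>\<^sub>L 'e \<Rightarrow>\<^sub>L 'e \<Rightarrow>\<^sub>L real"
  assumes c: "c \<in> A" and x: "x \<in> snd c ` fst c" and G1: "(gram c has_derivative G1) (at x)"
  shows "spray A g c x u = z \<longleftrightarrow> (\<forall>w. gram c x z w = G1 u u w - G1 w u u / 2)"
proof -
  have fd: "frechet_derivative (\<lambda>y. metric_rep A g c y a b) (at x) h = G1 h a b" for a b h
  proof -
    have "((\<lambda>y. gram c y a b) has_derivative (\<lambda>h. G1 h a b)) (at x)"
      by (rule has_derivative_eq_rhs) (rule derivative_eq_intros G1 refl | simp)+
    then have "((\<lambda>y. metric_rep A g c y a b) has_derivative (\<lambda>h. G1 h a b)) (at x)"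
      by (rule has_derivative_transform_within_open[OF _ open_img[OF c] x])
        (simp add: metric_rep_eq c)
    then show ?thesis by (metis frechet_derivative_at)
  qed
  have eq: "spray A g c x u = (THE z. \<forall>w. gram c x z w = G1 u u w - G1 w u u / 2)"
    unfolding spray_def christoffel_def Let_def fd metric_rep_eq[OF c x]
    by (simp add: diff_divide_distrib)
  have "\<exists>!z. \<forall>w. gram c x z w = G1 u u w - G1 w u u / 2"
  proof (rule ex_ex1I)
    obtain k where k: "k > 0" "\<And>a. k * (norm a)\<^sup>2 \<le> gram c x a a"
      using gram_coercive[OF c x] by blast
    have bl: "bounded_linear (\<lambda>w. G1 u u w - G1 w u u / 2)"
      by (intro bounded_linear_intros bounded_linear_sub bounded_linear_compose[OF bounded_linear_divide]
          blinfun.bounded_linear_right bounded_linear_compose[OF bounded_linear_apply_blinfun])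
    have "\<exists>z. \<forall>w. gram c x z w = Blinfun (\<lambda>w. G1 u u w - G1 w u u / 2) w"
      by (rule riesz_representation[OF gram_sym[OF c x] k])
    then show "\<exists>z. \<forall>w. gram c x z w = G1 u u w - G1 w u u / 2"
      by (simp add: bounded_linear_Blinfun_apply[OF bl])
  next
    fix z z' assume "\<forall>w. gram c x z w = G1 u u w - G1 w u u / 2"
      "\<forall>w. gram c x z' w = G1 u u w - G1 w u u / 2"
    then have "gram c x z w = gram c x z' w" for w by metis
    then have "gram c x (z - z') (z - z') = 0"
      by (simp add: blinfun.diff_left blinfun.diff_right)
    then show "z = z'" using gram_eq_0[OF c x] by fastforce
  qed
  note ex1 = this
  have sol: "\<forall>w. gram c x (spray A g c x u) w = G1 u u w - G1 w u u / 2"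
    unfolding eq by (rule theI'[OF ex1])
  show ?thesis
  proof
    assume "spray A g c x u = z"
    from sol[unfolded this] show "\<forall>w. gram c x z w = G1 u u w - G1 w u u / 2" .
  next
    assume "\<forall>w. gram c x z w = G1 u u w - G1 w u u / 2"
    then show "spray A g c x u = z"
      unfolding eq by (rule the1_equality[OF ex1])
  qed
qed

lemma gram_derivatives:
  assumes "c \<in> A"
  obtains G1 :: "'e \<Rightarrow> 'e \<Rightarrow>\<^sub>L 'e \<Rightarrow>\<^sub>L 'e \<Rightarrow>\<^sub>L real" and G2 where
    "\<And>x. x \<in> snd c ` fst c \<Longrightarrow> (gram c has_derivative blinfun_apply (G1 x)) (at x)"
    "\<And>x. x \<in> snd c ` fst c \<Longrightarrow> (G1 has_derivative blinfun_apply (G2 x)) (at x)"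
    "\<And>x. x \<in> snd c ` fst c \<Longrightarrow> \<exists>L. \<exists>d>0. ball x d \<subseteq> snd c ` fst c \<and> (\<forall>y\<in>ball x d. norm (G2 y) \<le> L)"
  using smooth_on_derivatives[OF open_img[OF assms] gram_smooth[OF assms]] by metis

lemma gram_cont:
  assumes "c \<in> A"
  shows "continuous_on (snd c ` fst c) (gram c)"
proof (rule continuous_at_imp_continuous_on, rule ballI)
  fix x assume x: "x \<in> snd c ` fst c"
  obtain G1 where "(gram c has_derivative blinfun_apply (G1 x)) (at x)"
    using gram_derivatives[OF assms] x by metis
  then show "isCont (gram c) x"
    by (rule has_derivative_continuous)
qed

text \<open>Homogeneity of degree two is what allows the factor \<open>t\<close> of the initial
  velocity \<open>t w\<close> to be moved into the differential equation.\<close>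

lemma spray_scale:
  assumes "c \<in> A" "x \<in> snd c ` fst c"
  shows "spray A g c x (t *\<^sub>R u) = t\<^sup>2 *\<^sub>R spray A g c x u"
proof -
  obtain G1 where G1: "(gram c has_derivative blinfun_apply (G1 x)) (at x)"
    using gram_derivatives[OF assms(1)] assms(2) by metis
  have "\<forall>w. gram c x (spray A g c x u) w = G1 x u u w - G1 x w u u / 2"
    using spray_char[OF assms G1] by blast
  then show ?thesis
    unfolding spray_char[OF assms G1]
    by (simp add: blinfun.scaleR_left blinfun.scaleR_right power2_eq_square right_diff_distrib mult.assoc)
qed

text \<open>Transformation law of the Christoffel symbols: the inhomogeneous term is the second
  derivative of the transition map.  Its symmetry enters when the metric is differentiated.\<close>

lemma spray_transform:
  fixes \<tau>2 :: "'e \<Rightarrow>\<^sub>L 'e \<Rightarrow>\<^sub>L 'e"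
  assumes c: "c \<in> A" "c' \<in> A" and x: "x \<in> snd c ` (fst c \<inter> fst c')"
    and \<tau>2: "(tder c c' has_derivative blinfun_apply \<tau>2) (at x)"
  shows "spray A g c' (transition c c' x) (tder c c' x u)
    = tder c c' x (spray A g c x u) - \<tau>2 u u"
proof -
  obtain q where q: "q \<in> fst c" "q \<in> fst c'" "x = snd c q" using x by auto
  have x1: "x \<in> snd c ` fst c" and x2: "transition c c' x \<in> snd c' ` fst c'"
    using q transition_chart[OF c(1) q(1)] by auto
  obtain G1 where G1: "(gram c has_derivative blinfun_apply (G1 x)) (at x)"
    using gram_derivatives[OF c(1)] x1 by metis
  obtain H1 where H1: "(gram c' has_derivative blinfun_apply (H1 (transition c c' x))) (at (transition c c' x))"
    using gram_derivatives[OF c(2)] x2 by metis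
  define K where "K = H1 (transition c c' x)"
  define \<tau> where "\<tau> = tder c c' x"
  define G' where "G' = gram c' (transition c c' x)"
  have G'sym: "G' a b = G' b a" for a b
    unfolding G'_def by (rule gram_sym[OF c(2) x2])
  have \<tau>2sym: "\<tau>2 a b = \<tau>2 b a" for a b
  proof -
    obtain f2 :: "'e \<Rightarrow>\<^sub>L 'e \<Rightarrow>\<^sub>L 'e" where "(tder c c' has_derivative blinfun_apply f2) (at x)"
      "\<And>u v. f2 u v = f2 v u" using tder2[OF c x] by blast
    then show ?thesis using has_derivative_unique[OF \<tau>2] by metis
  qed
  \<comment> \<open>Derivative of the invariance relation \<open>gram_transform\<close>: one term
    from the base point and one from each of the two transformed arguments.\<close>
  have dG: "G1 x h a b = K (\<tau> h) (\<tau> a) (\<tau> b) + G' (\<tau>2 h a) (\<tau> b) + G' (\<tau> a) (\<tau>2 h b)" for h a b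
  proof -
    have d1: "((\<lambda>y. gram c y a b) has_derivative (\<lambda>h. G1 x h a b)) (at x)"
      by (rule has_derivative_eq_rhs) (rule derivative_eq_intros G1 refl | simp)+
    have dt: "((\<lambda>y. gram c' (transition c c' y)) has_derivative (\<lambda>h. K (\<tau> h))) (at x)"
      unfolding K_def \<tau>_def by (rule has_derivative_compose[OF tder_deriv[OF c x] H1])
    have "((\<lambda>y. gram c' (transition c c' y) (tder c c' y a) (tder c c' y b)) has_derivative
       (\<lambda>h. K (\<tau> h) (\<tau> a) (\<tau> b) + G' (\<tau>2 h a) (\<tau> b) + G' (\<tau> a) (\<tau>2 h b))) (at x)"
      by (rule has_derivative_eq_rhs, (rule derivative_eq_intros dt \<tau>2 refl)+)
        (simp add: G'_def \<tau>_def blinfun.add_left algebra_simps)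
    then have "((\<lambda>y. gram c y a b) has_derivative
       (\<lambda>h. K (\<tau> h) (\<tau> a) (\<tau> b) + G' (\<tau>2 h a) (\<tau> b) + G' (\<tau> a) (\<tau>2 h b))) (at x)"
      by (rule has_derivative_transform_within_open[OF _ open_overlap[OF c] x])
        (simp add: gram_transform[OF c])
    from has_derivative_unique[OF d1 this] show ?thesis by metis
  qed
  have sp: "gram c x (spray A g c x u) w = G1 x u u w - G1 x w u u / 2" for w
    using spray_char[OF c(1) x1 G1] by blast
  have "G' (\<tau> (spray A g c x u) - \<tau>2 u u) w' = K (\<tau> u) (\<tau> u) w' - K w' (\<tau> u) (\<tau> u) / 2" for w'
  proof -
    \<comment> \<open>The derivative of the transition map is onto, so every test vector
      \<open>w'\<close> has the form \<open>\<tau> w\<close>.\<close>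
    define w where "w = tder c' c (snd c' q) w'"
    have w: "\<tau> w = w'"
      using tder_cocycle[OF c(2,1,2) q(2,1,2)] tder_self[OF c(2) q(2)]
      by (simp add: w_def \<tau>_def q(3))
    have "G' (\<tau> (spray A g c x u)) (\<tau> w) = gram c x (spray A g c x u) w"
      unfolding G'_def \<tau>_def by (rule gram_transform[OF c x, symmetric])
    also have "\<dots> = G1 x u u w - G1 x w u u / 2" by (rule sp)
    \<comment> \<open>By symmetry of \<open>\<tau>2\<close> and \<open>G'\<close>, the term with
      \<open>\<tau>2 u w\<close> from the first derivative cancels the two halved terms from the
      second; only \<open>\<tau>2 u u\<close> remains.\<close>
    also have "\<dots> = K (\<tau> u) (\<tau> u) (\<tau> w) + G' (\<tau>2 u u) (\<tau> w) - K (\<tau> w) (\<tau> u) (\<tau> u) / 2"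
      unfolding dG \<tau>2sym[of w u] G'sym[of "\<tau>2 u w" "\<tau> u"] by (simp add: field_simps)
    finally show ?thesis by (simp add: w blinfun.diff_left blinfun.diff_right)
  qed
  then show ?thesis
    unfolding spray_char[OF c(2) x2 H1] G'_def K_def \<tau>_def by blast
qed

text \<open>The defining equations of the spray at two points are subtracted and tested with the
  difference \<open>a\<close> of the two sprays. Coercivity bounds \<open>norm a\<close>, since the
  coefficients \<open>gram c\<close> and \<open>G1\<close> are Lipschitz near \<open>x0\<close> and
  the sprays themselves are bounded there.\<close>

lemma spray_lipschitz:
  assumes c: "c \<in> A" and x0: "x0 \<in> snd c ` fst c" and R: "R > 0"
  obtains \<rho> L where "\<rho> > 0" "L \<ge> 0" "cball x0 \<rho> \<subseteq> snd c ` fst c"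
    "\<And>x y u v. x \<in> cball x0 \<rho> \<Longrightarrow> y \<in> cball x0 \<rho> \<Longrightarrow> norm u \<le> R \<Longrightarrow> norm v \<le> R \<Longrightarrow>
       norm (spray A g c x u - spray A g c y v) \<le> L * (norm (x - y) + norm (u - v))"
proof -
  let ?U = "snd c ` fst c" and ?Q = "spray A g c"
  obtain G1 G2 where G1: "\<And>x. x \<in> ?U \<Longrightarrow> (gram c has_derivative blinfun_apply (G1 x)) (at x)"
    and G2: "\<And>x. x \<in> ?U \<Longrightarrow> (G1 has_derivative blinfun_apply (G2 x)) (at x)"
    and G2b: "\<And>x. x \<in> ?U \<Longrightarrow> \<exists>L. \<exists>d>0. ball x d \<subseteq> ?U \<and> (\<forall>y\<in>ball x d. norm (G2 y) \<le> L)"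
    using gram_derivatives[OF c] by metis
  obtain L2 d where d: "d > 0" "ball x0 d \<subseteq> ?U" "\<And>y. y \<in> ball x0 d \<Longrightarrow> norm (G2 y) \<le> L2"
    using G2b[OF x0] by blast
  have L2: "L2 \<ge> 0" using order_trans[OF norm_ge_zero d(3)[of x0]] d(1) by simp
  have lip1: "norm (G1 y - G1 z) \<le> L2 * norm (y - z)" if "y \<in> ball x0 d" "z \<in> ball x0 d" for y z
    by (rule locally_lipschitz_of_bounded_derivative[of x0 d G1 G2]) (use G2 d that in auto)
  define C1 where "C1 = norm (G1 x0) + L2 * d"
  have C1: "norm (G1 y) \<le> C1" if "y \<in> ball x0 d" for y
  proof -
    have "norm (G1 y) \<le> norm (G1 x0) + norm (G1 y - G1 x0)" by norm
    also have "norm (G1 y - G1 x0) \<le> L2 * norm (y - x0)" using lip1[OF that, of x0] d(1) by simp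
    also have "\<dots> \<le> L2 * d" using that L2 by (intro mult_left_mono) (auto simp: dist_norm norm_minus_commute)
    finally show ?thesis by (simp add: C1_def)
  qed
  have C1n: "C1 \<ge> 0" using order_trans[OF norm_ge_zero C1[of x0]] d(1) by simp
  have lip0: "norm (gram c y - gram c z) \<le> C1 * norm (y - z)" if "y \<in> ball x0 d" "z \<in> ball x0 d" for y z
    by (rule locally_lipschitz_of_bounded_derivative[of x0 d "gram c" G1]) (use G1 C1 d that in auto)
  obtain k where k: "k > 0" "\<And>a. k * (norm a)\<^sup>2 \<le> gram c x0 a a"
    using gram_coercive[OF c x0] by blast
  \<comment> \<open>On this ball \<open>gram c\<close> differs from \<open>gram c x0\<close> by at
    most \<open>k/2\<close>, so it stays coercive with constant \<open>k/2\<close>;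
    \<open>C1 + 1\<close> avoids division by zero.\<close>
  define \<rho> where "\<rho> = min (d/2) (k / (2 * (C1 + 1)))"
  have \<rho>: "\<rho> > 0" using d(1) k(1) C1n by (simp add: \<rho>_def)
  have sub: "cball x0 \<rho> \<subseteq> ball x0 d" using d(1) by (auto simp: \<rho>_def)
  have C1\<rho>: "C1 * \<rho> \<le> k/2"
  proof -
    have "C1 * \<rho> \<le> C1 * (k / (2 * (C1 + 1)))" using C1n by (intro mult_left_mono) (auto simp: \<rho>_def)
    also have "\<dots> \<le> k/2" using C1n k(1) by (simp add: field_simps)
    finally show ?thesis .
  qed
  have coer: "k/2 * (norm a)\<^sup>2 \<le> gram c y a a" if y: "y \<in> cball x0 \<rho>" for y a
  proof -
    have "norm (gram c x0 - gram c y) \<le> C1 * norm (x0 - y)"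
      using lip0[of x0 y] sub y d(1) by auto
    also have "\<dots> \<le> C1 * \<rho>" using y C1n by (intro mult_left_mono) (auto simp: dist_norm)
    finally have n: "norm (gram c x0 - gram c y) \<le> k/2" using C1\<rho> by linarith
    have "gram c x0 a a - gram c y a a = (gram c x0 - gram c y) a a" by (simp add: blinfun.diff_left)
    also have "\<dots> \<le> norm ((gram c x0 - gram c y) a a)" by simp
    also have "\<dots> \<le> norm ((gram c x0 - gram c y) a) * norm a" by (rule norm_blinfun)
    also have "\<dots> \<le> (norm (gram c x0 - gram c y) * norm a) * norm a"
      by (intro mult_right_mono norm_blinfun) auto
    also have "\<dots> \<le> k/2 * (norm a)\<^sup>2"
      using mult_right_mono[OF n, of "(norm a)\<^sup>2"] by (simp add: power2_eq_square mult.assoc)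
    finally show ?thesis using k(2)[of a] by (simp add: field_simps)
  qed
  have sp: "gram c x (?Q x u) w = G1 x u u w - G1 x w u u / 2" if "x \<in> cball x0 \<rho>" for x u w
    using spray_char[OF c _ G1, of x u] that sub d(2) by blast
  have tri: "\<bar>T a b e\<bar> \<le> norm T * norm a * norm b * norm e" for T :: "'e \<Rightarrow>\<^sub>L 'e \<Rightarrow>\<^sub>L 'e \<Rightarrow>\<^sub>L real" and a b e
  proof -
    have "\<bar>T a b e\<bar> \<le> norm (T a b) * norm e" using norm_blinfun[of "T a b" e] by simp
    also have "\<dots> \<le> (norm (T a) * norm b) * norm e" by (intro mult_right_mono norm_blinfun) auto
    also have "\<dots> \<le> ((norm T * norm a) * norm b) * norm e" by (intro mult_right_mono norm_blinfun) auto
    finally show ?thesis .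
  qed
  have bi: "\<bar>T b e\<bar> \<le> norm T * norm b * norm e" for T :: "'e \<Rightarrow>\<^sub>L 'e \<Rightarrow>\<^sub>L real" and b e
  proof -
    have "\<bar>T b e\<bar> \<le> norm (T b) * norm e" using norm_blinfun[of "T b" e] by simp
    also have "\<dots> \<le> (norm T * norm b) * norm e" by (intro mult_right_mono norm_blinfun) auto
    finally show ?thesis .
  qed
  have coerD: "norm a \<le> 2/k * N" if "y \<in> cball x0 \<rho>" "gram c y a a \<le> N * norm a" "N \<ge> 0" for y a N
  proof (cases "a = 0")
    case False
    have "k/2 * (norm a)\<^sup>2 \<le> N * norm a" using coer[OF that(1), of a] that(2) by linarith
    then have "(k/2 * norm a) * norm a \<le> N * norm a" by (simp add: power2_eq_square)
    then have "k/2 * norm a \<le> N" using False by simp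
    then show ?thesis using k(1) by (simp add: field_simps)
  qed (use that k in auto)
  \<comment> \<open>Testing the equation of the spray \<open>w\<close> with \<open>w\<close> itself
    gives \<open>gram c x w w \<le> 3/2 * C1 * R\<^sup>2 * norm w\<close>; the 3/2 is the sum of the
    coefficients 1 and 1/2.\<close>
  define B where "B = 2/k * (3/2 * C1 * R\<^sup>2)"
  have B: "B \<ge> 0" unfolding B_def using k C1n by auto
  have Qb: "norm (?Q x u) \<le> B" if x: "x \<in> cball x0 \<rho>" and u: "norm u \<le> R" for x u
    unfolding B_def
  proof (rule coerD[OF x])
    let ?w = "?Q x u"
    have G1x: "norm (G1 x) \<le> C1" using C1 sub x by blast
    have t1: "\<bar>G1 x a b e\<bar> \<le> C1 * norm a * norm b * norm e" for a b e
      using tri[of "G1 x" a b e] mult_right_mono[OF G1x, of "norm a * norm b * norm e"]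
      by (simp add: mult.assoc)
    have "gram c x ?w ?w \<le> C1 * norm u * norm u * norm ?w + C1 * norm ?w * norm u * norm u / 2"
      using t1[of u u ?w] t1[of ?w u u] unfolding sp[OF x] by argo
    also have "\<dots> = 3/2 * (C1 * (norm u)\<^sup>2 * norm ?w)" by (simp add: power2_eq_square)
    also have "\<dots> \<le> 3/2 * (C1 * R\<^sup>2 * norm ?w)"
      using u C1n by (intro mult_left_mono mult_right_mono power_mono) auto
    finally show "gram c x ?w ?w \<le> 3/2 * C1 * R\<^sup>2 * norm ?w" by simp
  qed (use C1n in auto)
  define L where "L = 2/k * (3/2 * L2 * R\<^sup>2 + 3 * C1 * R + C1 * B)"
  have Ln: "L \<ge> 0" unfolding L_def using k L2 C1n B R by auto
  have lipQ: "norm (?Q x u - ?Q y v) \<le> L * (norm (x - y) + norm (u - v))"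
    if x: "x \<in> cball x0 \<rho>" and y: "y \<in> cball x0 \<rho>" and u: "norm u \<le> R" and v: "norm v \<le> R" for x y u v
  proof -
    define a where "a = ?Q x u - ?Q y v"
    define \<alpha> where "\<alpha> = norm (x - y)"
    define \<beta> where "\<beta> = norm (u - v)"
    have \<alpha>\<beta>: "\<alpha> \<ge> 0" "\<beta> \<ge> 0" by (auto simp: \<alpha>_def \<beta>_def)
    have xd: "x \<in> ball x0 d" and yd: "y \<in> ball x0 d" using x y sub by auto
    have est: "\<bar>G1 x p q r - G1 y p' q' r'\<bar> \<le> L2 * \<alpha> * (norm p * norm q * norm r)
        + C1 * (norm (p - p') * norm q * norm r + norm p' * norm (q - q') * norm r
          + norm p' * norm q' * norm (r - r'))" for p q r p' q' r'
    proof -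
      \<comment> \<open>Telescoping: first the base point is changed, then one argument at a
        time.\<close>
      have *: "G1 x p q r - G1 y p' q' r' = (G1 x - G1 y) p q r + G1 y (p - p') q r
          + G1 y p' (q - q') r + G1 y p' q' (r - r')"
        by (simp add: blinfun.diff_left blinfun.diff_right)
      have G1y: "norm (G1 y) \<le> C1" by (rule C1[OF yd])
      have t1: "\<bar>G1 y a b e\<bar> \<le> C1 * (norm a * norm b * norm e)" for a b e
        using tri[of "G1 y" a b e] mult_right_mono[OF G1y, of "norm a * norm b * norm e"]
        by (simp add: mult.assoc)
      have t2: "\<bar>(G1 x - G1 y) p q r\<bar> \<le> L2 * \<alpha> * (norm p * norm q * norm r)"
        using tri[of "G1 x - G1 y" p q r] mult_right_mono[OF lip1[OF xd yd], of "norm p * norm q * norm r"]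
        by (simp add: mult.assoc \<alpha>_def)
      show ?thesis
        unfolding * using t2 t1[of "p - p'" q r] t1[of p' "q - q'" r] t1[of p' q' "r - r'"]
        by (simp add: distrib_left abs_le_iff)
    qed
    have mono: "norm u * norm u \<le> R\<^sup>2" "\<beta> * norm u \<le> R * \<beta>" "norm v * \<beta> \<le> R * \<beta>"
      using u v R \<alpha>\<beta> by (auto simp: power2_eq_square mult.commute[of \<beta>] intro!: mult_mono mult_right_mono)
    have e1: "\<bar>G1 x u u a - G1 y v v a\<bar> \<le> (L2 * \<alpha> * R\<^sup>2 + C1 * (2 * R * \<beta>)) * norm a"
    proof -
      have "\<bar>G1 x u u a - G1 y v v a\<bar> \<le> L2 * \<alpha> * (norm u * norm u * norm a)
        + C1 * (\<beta> * norm u * norm a + norm v * \<beta> * norm a)"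
        using est[of u u a v v a] by (simp add: \<beta>_def)
      also have "\<dots> \<le> L2 * \<alpha> * (R\<^sup>2 * norm a) + C1 * (R * \<beta> * norm a + R * \<beta> * norm a)"
        using mono L2 C1n \<alpha>\<beta> by (intro add_mono mult_left_mono[of _ _ "L2 * \<alpha>"] mult_left_mono[of _ _ C1]
            mult_right_mono[of _ _ "norm a"] mult_left_mono[of _ _ "norm a"]) auto
      finally show ?thesis by (simp add: algebra_simps)
    qed
    have e2: "\<bar>G1 x a u u - G1 y a v v\<bar> \<le> (L2 * \<alpha> * R\<^sup>2 + C1 * (2 * R * \<beta>)) * norm a"
    proof -
      have "\<bar>G1 x a u u - G1 y a v v\<bar> \<le> L2 * \<alpha> * (norm a * (norm u * norm u))
        + C1 * (norm a * (\<beta> * norm u) + norm a * (norm v * \<beta>))"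
        using est[of a u u a v v] by (simp add: \<beta>_def mult.assoc)
      also have "\<dots> \<le> L2 * \<alpha> * (norm a * R\<^sup>2) + C1 * (norm a * (R * \<beta>) + norm a * (R * \<beta>))"
        using mono L2 C1n \<alpha>\<beta> by (intro add_mono mult_left_mono[of _ _ "L2 * \<alpha>"] mult_left_mono[of _ _ C1]
            mult_right_mono[of _ _ "norm a"] mult_left_mono[of _ _ "norm a"]) auto
      finally show ?thesis by (simp add: algebra_simps)
    qed
    have e3: "\<bar>(gram c y - gram c x) (?Q y v) a\<bar> \<le> C1 * \<alpha> * B * norm a"
    proof -
      have n: "norm (gram c y - gram c x) \<le> C1 * \<alpha>"
        using lip0[OF yd xd] by (simp add: \<alpha>_def norm_minus_commute)
      have "\<bar>(gram c y - gram c x) (?Q y v) a\<bar> \<le> norm (gram c y - gram c x) * norm (?Q y v) * norm a"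
        by (rule bi)
      also have "\<dots> \<le> C1 * \<alpha> * B * norm a"
        using n Qb[OF y v] C1n \<alpha>\<beta> by (intro mult_right_mono mult_mono) auto
      finally show ?thesis .
    qed
    define N where "N = 3/2 * (L2 * \<alpha> * R\<^sup>2 + C1 * (2 * R * \<beta>)) + C1 * \<alpha> * B"
    \<comment> \<open>The last term compensates for the equation of \<open>?Q y v\<close> being
      posed with the form at \<open>y\<close> instead of the form at \<open>x\<close>.\<close>
    have "gram c x a a = (G1 x u u a - G1 y v v a) - (G1 x a u u - G1 y a v v) / 2
        + (gram c y - gram c x) (?Q y v) a"
    proof -
      have "gram c x a a = gram c x (?Q x u) a - gram c x (?Q y v) a"
        unfolding a_def by (simp add: blinfun.diff_left blinfun.diff_right)
      moreover have "(gram c y - gram c x) (?Q y v) a = gram c y (?Q y v) a - gram c x (?Q y v) a"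
        by (simp add: blinfun.diff_left)
      ultimately show ?thesis using sp[OF x, of u a] sp[OF y, of v a] by argo
    qed
    also have "\<dots> \<le> N * norm a"
    proof -
      have "N * norm a = 3/2 * ((L2 * \<alpha> * R\<^sup>2 + C1 * (2 * R * \<beta>)) * norm a) + C1 * \<alpha> * B * norm a"
        by (simp add: N_def algebra_simps)
      with e1 e2 e3 show ?thesis by argo
    qed
    finally have "norm a \<le> 2/k * N"
      using \<alpha>\<beta> L2 C1n R B by (intro coerD[OF x]) (auto simp: N_def)
    moreover have "N \<le> (3/2 * L2 * R\<^sup>2 + 3 * C1 * R + C1 * B) * (\<alpha> + \<beta>)"
    proof -
      have "(3/2 * L2 * R\<^sup>2 + 3 * C1 * R + C1 * B) * (\<alpha> + \<beta>) - N
          = 3/2 * L2 * R\<^sup>2 * \<beta> + 3 * C1 * R * \<alpha> + C1 * B * \<beta>"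
        by (simp add: N_def algebra_simps)
      also have "\<dots> \<ge> 0" using \<alpha>\<beta> L2 C1n R B by simp
      finally show ?thesis by simp
    qed
    ultimately have "norm a \<le> 2/k * ((3/2 * L2 * R\<^sup>2 + 3 * C1 * R + C1 * B) * (\<alpha> + \<beta>))"
      using k(1) by (meson mult_left_mono order_trans divide_nonneg_pos zero_le_numeral)
    then show ?thesis
      by (simp only: a_def L_def \<alpha>_def \<beta>_def mult.assoc)
  qed
  show thesis
    by (rule that[OF \<rho> Ln _ lipQ]) (use sub d(2) in auto)
qed

end

section \<open>Curves and geodesics in a chart\<close>

lemma continuous_on_nbhd:
  fixes \<gamma> :: "'a::metric_space \<Rightarrow> 'b::topological_space"
  assumes "continuous_on I \<gamma>" "open B" "s \<in> I" "\<gamma> s \<in> B"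
  obtains d where "d > 0" "\<And>r. r \<in> I \<Longrightarrow> dist r s < d \<Longrightarrow> \<gamma> r \<in> B"
proof -
  obtain V where V: "open V" "s \<in> V" "\<And>y. y \<in> I \<Longrightarrow> y \<in> V \<Longrightarrow> \<gamma> y \<in> B"
    using iffD1[OF continuous_on_topological, rule_format, OF assms(1,3,2,4)] by metis
  obtain d where d: "d > 0" "\<And>y. dist y s < d \<Longrightarrow> y \<in> V"
    using iffD1[OF open_dist, rule_format, OF V(1,2)] by metis
  show thesis
    by (rule that[OF d(1)]) (intro V(3) d(2))
qed

context riem
begin

lemma chart_curve_derivative:
  assumes c: "c \<in> A" "c' \<in> A" and xU: "x s \<in> snd c ` fst c"
    and dx: "(x has_vector_derivative x' s) (at s within S)"
    and c's: "chart_inv c (x s) \<in> fst c'"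
  shows "((snd c' \<circ> (\<lambda>s. chart_inv c (x s))) has_vector_derivative tder c c' (x s) (x' s)) (at s within S)"
proof -
  have "x s \<in> snd c ` (fst c \<inter> fst c')"
    by (rule iffD2[OF overlap_iff[OF c(1) xU] c's])
  from has_derivative_at_withinI[OF tder_deriv[OF c this]]
  have "(transition c c' has_derivative tder c c' (x s)) (at (x s) within x ` S)" .
  from vector_derivative_diff_chain_within[OF dx this] show ?thesis
    by (simp only: transition_def comp_def)
qed

lemma coord_tangent_chart_inv:
  assumes "c \<in> A" "z \<in> snd c ` fst c"
  shows "coord_tangent A c (chart_inv c z) u c'
    = (if c' \<in> A \<and> chart_inv c z \<in> fst c' then tder c c' z u else 0)"
  using coord_tangent_apply[OF assms(1) chart_inv_in[OF assms]] by (simp add: chart_chart_inv[OF assms])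

text \<open>A curve given in one chart is examined in every chart by the chain rule. Since
  \<open>a < b\<close>, derivatives within the interval are unique, also at the end points, so
  \<open>vector_derivative\<close> returns the expected value.\<close>

lemma chart_curve:
  fixes a b :: real and x x' :: "real \<Rightarrow> 'e"
  assumes ab: "a < b" and c: "c \<in> A" and xU: "\<And>s. s \<in> {a..b} \<Longrightarrow> x s \<in> snd c ` fst c"
    and dx: "\<And>s. s \<in> {a..b} \<Longrightarrow> (x has_vector_derivative x' s) (at s within {a..b})"
    and cx': "continuous_on {a..b} x'"
  shows velocity_chart_curve: "s \<in> {a..b} \<Longrightarrow> velocity A (\<lambda>s. chart_inv c (x s)) {a..b} s
      = coord_tangent A c (chart_inv c (x s)) (x' s)"
    and C1_chart_curve: "C1_curve A (\<lambda>s. chart_inv c (x s)) {a..b}"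
proof -
  let ?\<gamma> = "\<lambda>s. chart_inv c (x s)"
  have vel: "velocity A ?\<gamma> {a..b} s = coord_tangent A c (?\<gamma> s) (x' s)" if s: "s \<in> {a..b}" for s
  proof
    fix c'
    have "vector_derivative (snd c' \<circ> ?\<gamma>) (at s within {a..b}) = tder c c' (x s) (x' s)"
      if "c' \<in> A" "?\<gamma> s \<in> fst c'"
      using vector_derivative_within_cbox[of a b s] ab s
        chart_curve_derivative[where x' = x', OF c that(1) xU[OF s] dx[OF s] that(2)] by simp
    then show "velocity A ?\<gamma> {a..b} s c' = coord_tangent A c (?\<gamma> s) (x' s) c'"
      unfolding velocity_def coord_tangent_chart_inv[OF c xU[OF s]] by simp
  qed
  then show "s \<in> {a..b} \<Longrightarrow> velocity A ?\<gamma> {a..b} s = coord_tangent A c (?\<gamma> s) (x' s)" .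
  have cx: "continuous_on {a..b} x"
    by (rule continuous_on_vector_derivative[OF dx])
  show "C1_curve A ?\<gamma> {a..b}"
    unfolding C1_curve_def
  proof (intro conjI ballI impI)
    show "continuous_on {a..b} ?\<gamma>"
      by (rule continuous_on_compose2[OF cont_inv[OF c] cx]) (use xU in blast)
    fix c' assume c': "c' \<in> A"
    show "(snd c' \<circ> ?\<gamma>) differentiable (at s within {a..b})" if "s \<in> {a..b}" "?\<gamma> s \<in> fst c'" for s
      using chart_curve_derivative[where x' = x', OF c c' xU[OF that(1)] dx[OF that(1)] that(2)]
      by (rule differentiableI_vector)
    let ?I = "{s \<in> {a..b}. ?\<gamma> s \<in> fst c'}"
    have cont: "continuous_on ?I (\<lambda>s. tder c c' (x s) (x' s))"
    proof (intro continuous_intros)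
      show "continuous_on ?I (\<lambda>s. tder c c' (x s))"
        by (rule continuous_on_compose2[OF tder_cont[OF c c'] continuous_on_subset[OF cx]])
          (use overlap_iff[OF c xU] in auto)
      show "continuous_on ?I x'"
        by (rule continuous_on_subset[OF cx']) auto
    qed
    have v: "velocity A ?\<gamma> {a..b} s c' = tder c c' (x s) (x' s)" if "s \<in> ?I" for s
      using that c' vel[of s] coord_tangent_chart_inv[OF c xU[of s]] by simp
    show "continuous_on ?I (\<lambda>s. velocity A ?\<gamma> {a..b} s c')"
      by (rule continuous_on_eq[OF cont v[symmetric]])
  qed
qed

text \<open>In another chart the velocity is \<open>tder c c' (x s) (x' s)\<close>. The product rule
  gives its derivative as \<open>\<tau>2 (x' s) (x' s)\<close> minus the transformed spray, and
  \<open>spray_transform\<close> identifies this with minus the spray of the other chart.\<close>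

lemma geodesic_chart_curve:
  fixes a b :: real and x x' :: "real \<Rightarrow> 'e"
  assumes ab: "a < b" and c: "c \<in> A" and xU: "\<And>s. s \<in> {a..b} \<Longrightarrow> x s \<in> snd c ` fst c"
    and dx: "\<And>s. s \<in> {a..b} \<Longrightarrow> (x has_vector_derivative x' s) (at s within {a..b})"
    and dx': "\<And>s. s \<in> {a..b} \<Longrightarrow>
        (x' has_vector_derivative - spray A g c (x s) (x' s)) (at s within {a..b})"
  shows "geodesic A g (\<lambda>s. chart_inv c (x s)) {a..b}"
proof -
  let ?\<gamma> = "\<lambda>s. chart_inv c (x s)" and ?I = "{a..b}"
  have cx': "continuous_on ?I x'"
    by (rule continuous_on_vector_derivative[OF dx'])
  have vel: "velocity A ?\<gamma> ?I s = coord_tangent A c (?\<gamma> s) (x' s)" if "s \<in> ?I" for s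
    by (rule velocity_chart_curve[OF ab c xU dx cx' that])
  have C1: "C1_curve A ?\<gamma> ?I" by (rule C1_chart_curve[OF ab c xU dx cx'])
  show ?thesis
    unfolding geodesic_def
  proof (intro conjI C1 ballI impI)
    fix c' s assume c': "c' \<in> A" and s: "s \<in> ?I" and gs: "?\<gamma> s \<in> fst c'"
    have x1: "x s \<in> snd c ` (fst c \<inter> fst c')"
      using overlap_iff[OF c xU[OF s]] gs by blast
    have v: "velocity A ?\<gamma> ?I r c' = tder c c' (x r) (x' r)" if "r \<in> ?I" "?\<gamma> r \<in> fst c'" for r
      using that c' vel[OF that(1)] coord_tangent_chart_inv[OF c xU[OF that(1)]] by simp
    obtain \<tau>2 :: "'e \<Rightarrow>\<^sub>L 'e \<Rightarrow>\<^sub>L 'e" where \<tau>2: "(tder c c' has_derivative blinfun_apply \<tau>2) (at (x s))"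
      using tder2[OF c c' x1] by blast
    have "((\<lambda>r. tder c c' (x r)) has_derivative (\<lambda>h. \<tau>2 (h *\<^sub>R x' s))) (at s within ?I)"
      by (rule has_derivative_compose[OF dx[OF s, unfolded has_vector_derivative_def] \<tau>2])
    then have "((\<lambda>r. tder c c' (x r) (x' r)) has_derivative
        (\<lambda>h. h *\<^sub>R (\<tau>2 (x' s) (x' s) - tder c c' (x s) (spray A g c (x s) (x' s))))) (at s within ?I)"
      using dx'[OF s, unfolded has_vector_derivative_def]
      by (auto intro!: derivative_eq_intros
          simp: blinfun.scaleR_left blinfun.scaleR_right blinfun.minus_right scaleR_diff_right)
    then have d: "((\<lambda>r. tder c c' (x r) (x' r)) has_derivative
        (\<lambda>h. h *\<^sub>R (- spray A g c' (transition c c' (x s)) (tder c c' (x s) (x' s))))) (at s within ?I)"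
      unfolding spray_transform[OF c c' x1 \<tau>2] by (simp add: minus_diff_eq)
    have cont: "continuous_on ?I ?\<gamma>" using C1 unfolding C1_curve_def by blast
    obtain d where d0: "d > 0" "\<And>r. r \<in> ?I \<Longrightarrow> dist r s < d \<Longrightarrow> ?\<gamma> r \<in> fst c'"
      using continuous_on_nbhd[OF cont open_dom[OF c'] s gs] by blast
    have "((\<lambda>r. velocity A ?\<gamma> ?I r c') has_derivative
        (\<lambda>h. h *\<^sub>R (- spray A g c' (transition c c' (x s)) (tder c c' (x s) (x' s))))) (at s within ?I)"
      by (rule has_derivative_transform_within[OF d d0(1) s]) (simp add: v d0(2))
    moreover have "transition c c' (x s) = snd c' (?\<gamma> s)" by (simp add: transition_def)
    ultimately show "((\<lambda>r. velocity A ?\<gamma> ?I r c') has_vector_derivative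
        - christoffel A g c' (snd c' (?\<gamma> s)) (velocity A ?\<gamma> ?I s c') (velocity A ?\<gamma> ?I s c'))
        (at s within ?I)"
      using v[OF s gs] by (simp add: has_vector_derivative_def spray_def)
  qed
qed

lemma geodesic_ode:
  assumes "geodesic A g \<gamma> I" "c \<in> A" "s \<in> I" "\<gamma> s \<in> fst c"
  shows "((\<lambda>s. snd c (\<gamma> s)) has_vector_derivative velocity A \<gamma> I s c) (at s within I)"
    and "((\<lambda>s. velocity A \<gamma> I s c) has_vector_derivative
           - spray A g c (snd c (\<gamma> s)) (velocity A \<gamma> I s c)) (at s within I)"
  using assms unfolding geodesic_def C1_curve_def spray_def
  by (auto simp: velocity_def vector_derivative_works comp_def)

text \<open>A geodesic agrees with a solution in the chart on a relatively clopen set of times: wherever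
  both agree up to closure, the first one stays in the chart for a short time, where the
  Lipschitz condition forces agreement.\<close>

lemma geodesic_unique:
  fixes x y :: "real \<Rightarrow> 'e" and \<gamma> :: "real \<Rightarrow> 'm"
  assumes c: "c \<in> A" and \<rho>: "\<rho> > 0" "cball x0 \<rho> \<subseteq> snd c ` fst c" and t: "t > 0"
    and half: "\<And>x x' u u'. x \<in> cball x0 \<rho> \<Longrightarrow> x' \<in> cball x0 \<rho> \<Longrightarrow> norm u \<le> K \<Longrightarrow> norm u' \<le> K \<Longrightarrow>
       norm ((t *\<^sub>R u, - t *\<^sub>R spray A g c x u) - (t *\<^sub>R u', - t *\<^sub>R spray A g c x' u'))
         \<le> 1/2 * norm ((x, u) - (x', u'))"
    and x: "\<And>s. s \<in> {0..1} \<Longrightarrow> x s \<in> cball x0 (\<rho>/2)" "\<And>s. s \<in> {0..1} \<Longrightarrow> norm (y s) \<le> K - 1/2"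
    and dx: "\<And>s. s \<in> {0..1} \<Longrightarrow> (x has_vector_derivative t *\<^sub>R y s) (at s within {0..1})"
    and dy: "\<And>s. s \<in> {0..1} \<Longrightarrow>
        (y has_vector_derivative - t *\<^sub>R spray A g c (x s) (y s)) (at s within {0..1})"
    and \<gamma>: "geodesic A g \<gamma> {0..1}" "\<gamma> 0 = chart_inv c (x 0)" "velocity A \<gamma> {0..1} 0 c = t *\<^sub>R y 0"
    and s: "s \<in> {0..1}"
  shows "\<gamma> s = chart_inv c (x s)"
proof -
  let ?I = "{0..1::real}"
  define \<sigma> where "\<sigma> s = chart_inv c (x s)" for s
  define v where "v s = velocity A \<gamma> ?I s c" for s
  define S where "S = {s \<in> ?I. \<gamma> s = \<sigma> s \<and> v s = t *\<^sub>R y s}"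
  have half_sub: "cball x0 (\<rho>/2) \<subseteq> cball x0 \<rho>" using \<rho>(1) by auto
  have xU: "x s \<in> snd c ` fst c" if "s \<in> ?I" for s using x(1)[OF that] half_sub \<rho>(2) by blast
  have cx: "continuous_on ?I x"
    by (rule continuous_on_vector_derivative[OF dx])
  have cy: "continuous_on ?I y"
    by (rule continuous_on_vector_derivative[OF dy])
  have c\<sigma>: "continuous_on ?I \<sigma>"
    unfolding \<sigma>_def by (rule continuous_on_compose2[OF cont_inv[OF c] cx]) (use xU in blast)
  have c\<gamma>: "continuous_on ?I \<gamma>"
    using \<gamma>(1) unfolding geodesic_def C1_curve_def by blast
  have cv: "continuous_on {s \<in> ?I. \<gamma> s \<in> fst c} v"
    using \<gamma>(1) c unfolding geodesic_def C1_curve_def v_def by blast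
  note ode = geodesic_ode[OF \<gamma>(1) c, folded v_def]
  \<comment> \<open>Stated for points of the closure of \<open>S\<close>, this one claim gives both
    halves: \<open>S\<close> is relatively open, and relatively closed because a limit point belongs
    to its own neighbourhood.\<close>
  have step: "\<exists>e>0. \<forall>r\<in>?I. dist r s < e \<longrightarrow> r \<in> S" if s: "s \<in> ?I" "s \<in> closure S" for s
  proof -
    obtain f where f: "\<And>n. f n \<in> S" "f \<longlonglongrightarrow> s"
      using s(2) unfolding closure_sequential by blast
    have fI: "\<And>n. f n \<in> ?I" and f\<gamma>: "\<And>n. \<gamma> (f n) = \<sigma> (f n)" and fv: "\<And>n. v (f n) = t *\<^sub>R y (f n)"
      using f(1) by (auto simp: S_def)
    have lim: "(\<lambda>n. h (f n)) \<longlonglongrightarrow> h s" if "continuous_on ?I h" for h :: "real \<Rightarrow> 'b::topological_space"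
      by (rule continuous_on_tendsto_compose[OF that f(2) s(1)]) (use fI in \<open>simp add: eventually_sequentially\<close>)
    have \<gamma>s: "\<gamma> s = \<sigma> s"
      using LIMSEQ_unique[OF lim[OF c\<gamma>]] lim[OF c\<sigma>] by (simp add: f\<gamma>)
    have \<sigma>c: "\<sigma> r \<in> fst c" if "r \<in> ?I" for r
      unfolding \<sigma>_def by (rule chart_inv_in[OF c xU[OF that]])
    have "(\<lambda>n. v (f n)) \<longlonglongrightarrow> v s"
      by (rule continuous_on_tendsto_compose[OF cv f(2)]) (use s fI f\<gamma> \<gamma>s \<sigma>c in auto)
    moreover have "(\<lambda>n. v (f n)) \<longlonglongrightarrow> t *\<^sub>R y s"
      unfolding fv by (intro tendsto_intros lim cy)
    ultimately have vs: "v s = t *\<^sub>R y s" by (rule LIMSEQ_unique)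
    obtain d1 where d1: "d1 > 0" "\<And>r. r \<in> ?I \<Longrightarrow> dist r s < d1 \<Longrightarrow> \<gamma> r \<in> fst c"
      by (rule continuous_on_nbhd[OF c\<gamma> open_dom[OF c] s(1)]) (use \<gamma>s \<sigma>c[OF s(1)] in auto)
    define V where "V = {r \<in> ?I. \<gamma> r \<in> fst c}"
    have sV: "s \<in> V" using \<gamma>s \<sigma>c s(1) by (auto simp: V_def)
    have "continuous_on V (\<lambda>r. snd c (\<gamma> r))"
      by (rule continuous_on_compose2[OF cont_chart[OF c] continuous_on_subset[OF c\<gamma>]]) (auto simp: V_def)
    \<comment> \<open>The radius \<open>\<rho>/2\<close> for \<open>x\<close>, like
      \<open>K - 1/2\<close> for \<open>y\<close> below, leaves a margin: the competitor lies in an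
      open ball at time \<open>s\<close> and hence stays there for a while.\<close>
    moreover have "snd c (\<gamma> s) \<in> ball x0 \<rho>"
      using x(1)[OF s(1)] \<rho>(1) chart_chart_inv[OF c xU[OF s(1)]] by (simp add: \<gamma>s \<sigma>_def)
    ultimately obtain d2 where d2: "d2 > 0" "\<And>r. r \<in> V \<Longrightarrow> dist r s < d2 \<Longrightarrow> snd c (\<gamma> r) \<in> ball x0 \<rho>"
      by (rule continuous_on_nbhd[OF _ open_ball sV]) blast
    have "continuous_on V (\<lambda>r. (1/t) *\<^sub>R v r)"
      using cv unfolding V_def by (intro continuous_intros)
    moreover have "(1/t) *\<^sub>R v s \<in> ball 0 K"
      using x(2)[OF s(1)] t by (simp add: vs)
    ultimately obtain d3 where d3: "d3 > 0" "\<And>r. r \<in> V \<Longrightarrow> dist r s < d3 \<Longrightarrow> (1/t) *\<^sub>R v r \<in> ball 0 K"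
      by (rule continuous_on_nbhd[OF _ open_ball sV]) blast
    define e where "e = min (min d1 d2) d3 / 2"
    have e: "e > 0" "e < d1" "e < d2" "e < d3" using d1(1) d2(1) d3(1) by (auto simp: e_def)
    define a where "a = max 0 (s - e)"
    define b where "b = min 1 (s + e)"
    have ab: "{a..b} \<subseteq> ?I" "b - a \<le> 1" "s \<in> {a..b}" using s e by (auto simp: a_def b_def)
    have near: "\<gamma> r \<in> fst c" "snd c (\<gamma> r) \<in> cball x0 \<rho>" "norm ((1/t) *\<^sub>R v r) \<le> K" if "r \<in> {a..b}" for r
    proof -
      have "dist r s \<le> e" using that by (auto simp: a_def b_def dist_real_def)
      then have "dist r s < d1" "dist r s < d2" "dist r s < d3" using e by linarith+
      moreover have "r \<in> ?I" using that ab by blast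
      ultimately have "\<gamma> r \<in> fst c" using d1 by blast
      then have "r \<in> V" using \<open>r \<in> ?I\<close> by (simp add: V_def)
      with \<open>\<gamma> r \<in> fst c\<close> d2(2)[OF \<open>r \<in> V\<close>] d3(2)[OF \<open>r \<in> V\<close>] \<open>dist r s < d2\<close> \<open>dist r s < d3\<close>
      show "\<gamma> r \<in> fst c" "snd c (\<gamma> r) \<in> cball x0 \<rho>" "norm ((1/t) *\<^sub>R v r) \<le> K"
        by (auto simp: less_imp_le)
    qed
    \<comment> \<open>Difference of the two solutions in phase space, with the velocity of the
      competitor divided by \<open>t\<close> to match the rescaled system. It vanishes at
      \<open>s\<close>, so the Gronwall estimate makes it vanish on {a..b}.\<close>
    define Z where "Z r = (snd c (\<gamma> r), (1/t) *\<^sub>R v r) - (x r, y r)" for r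
    define Z' where "Z' r = (t *\<^sub>R ((1/t) *\<^sub>R v r), - t *\<^sub>R spray A g c (snd c (\<gamma> r)) ((1/t) *\<^sub>R v r))
        - (t *\<^sub>R y r, - t *\<^sub>R spray A g c (x r) (y r))" for r
    have dZ: "(Z has_vector_derivative Z' r) (at r within {a..b})" if r: "r \<in> {a..b}" for r
    proof -
      have rI: "r \<in> ?I" using r ab by blast
      note sub = has_vector_derivative_within_subset[OF _ ab(1)]
      have "snd c (\<gamma> r) \<in> snd c ` fst c" using near(1)[OF r] by blast
      then have sp: "- t *\<^sub>R spray A g c (snd c (\<gamma> r)) ((1/t) *\<^sub>R v r)
          = (1/t) *\<^sub>R (- spray A g c (snd c (\<gamma> r)) (v r))"
        using t by (simp add: spray_scale[OF c] power2_eq_square field_simps)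
      have g1: "((\<lambda>s. snd c (\<gamma> s)) has_vector_derivative t *\<^sub>R ((1/t) *\<^sub>R v r)) (at r within {a..b})"
        using sub[OF ode(1)[OF rI near(1)[OF r]]] t by simp
      have g2: "((\<lambda>s. (1/t) *\<^sub>R v s) has_vector_derivative
          - t *\<^sub>R spray A g c (snd c (\<gamma> r)) ((1/t) *\<^sub>R v r)) (at r within {a..b})"
        unfolding sp
        by (rule bounded_linear.has_vector_derivative[OF bounded_linear_scaleR_right sub[OF ode(2)[OF rI near(1)[OF r]]]])
      show ?thesis
        unfolding Z_def Z'_def
        by (intro has_vector_derivative_diff has_vector_derivative_Pair g1 g2 sub[OF dx[OF rI]] sub[OF dy[OF rI]])
    qed
    have Zb: "norm (Z' r) \<le> 1/2 * norm (Z r)" if r: "r \<in> {a..b}" for r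
    proof -
      have rI: "r \<in> ?I" using r ab by blast
      show ?thesis
        unfolding Z_def Z'_def
        by (rule half) (use near[OF r] x(1)[OF rI] x(2)[OF rI] half_sub in auto)
    qed
    have "Z s = 0"
      using chart_chart_inv[OF c xU[OF s(1)]] t by (simp add: Z_def \<gamma>s \<sigma>_def vs zero_prod_def)
    have "r \<in> S" if r: "r \<in> ?I" "dist r s < e" for r
    proof -
      have rab: "r \<in> {a..b}" using r by (auto simp: a_def b_def dist_real_def)
      have "norm (Z r) \<le> 2 * norm (Z s)"
        by (rule gronwall_half[OF dZ Zb ab(2) rab ab(3)])
      then have "Z r = 0" using \<open>Z s = 0\<close> by simp
      then have "snd c (\<gamma> r) = x r" "(1/t) *\<^sub>R v r = y r" by (auto simp: Z_def zero_prod_def)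
      then have "\<gamma> r = \<sigma> r" "v r = t *\<^sub>R y r"
        using chart_inv_chart[OF c near(1)[OF rab]] t scaleR_scaleR[of t "1/t" "v r"]
        by (simp_all add: \<sigma>_def)
      then show ?thesis using r by (simp add: S_def)
    qed
    then show ?thesis using e(1) by blast
  qed
  have SI: "S \<subseteq> ?I" by (auto simp: S_def)
  have op: "openin (top_of_set ?I) S"
    unfolding openin_euclidean_subtopology_iff
  proof (intro conjI SI ballI)
    fix r assume r: "r \<in> S"
    show "\<exists>e>0. \<forall>r'\<in>?I. dist r' r < e \<longrightarrow> r' \<in> S"
      by (rule step) (use r SI closure_subset[of S] in auto)
  qed
  have "?I \<inter> closure S \<subseteq> S"
  proof
    fix r assume r: "r \<in> ?I \<inter> closure S"
    then obtain e where "e > 0" "\<And>r'. r' \<in> ?I \<Longrightarrow> dist r' r < e \<Longrightarrow> r' \<in> S"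
      using step[of r] by blast
    then show "r \<in> S" using r by simp
  qed
  then have Seq: "?I \<inter> closure S = S"
    using SI closure_subset[of S] by blast
  have cl: "closedin (top_of_set ?I) S"
    by (rule closedin_closed_Int[OF closed_closure, of ?I S, unfolded Seq])
  have "S = {} \<or> S = ?I"
    by (rule iffD1[OF connected_clopen connected_Icc, rule_format, OF conjI[OF op cl]])
  moreover have "0 \<in> S" by (simp add: S_def \<gamma> \<sigma>_def v_def)
  ultimately have "s \<in> S" using s by blast
  then show ?thesis unfolding S_def \<sigma>_def by blast
qed

section \<open>The exponential map in a chart\<close>

text \<open>Both conclusions come from the time-one map of the rescaled flow: its distance from
  \<open>x0 + t w\<close> gives the expansion of the exponential map, and the Lipschitz bound on its
  remainder makes it onto a coordinate ball of radius \<open>t * R / 2\<close>. The flow lines are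
  geodesics by \<open>geodesic_chart_curve\<close>; \<open>geodesic_unique\<close> excludes any
  other end point.\<close>

lemma exp_chart:
  assumes c: "c \<in> A" "p \<in> fst c" and R: "R > 0"
  obtains \<delta> M where "\<delta> > 0" "M > 0"
    "\<And>t w. 0 < t \<Longrightarrow> t < \<delta> \<Longrightarrow> w \<in> tangent_space A p \<Longrightarrow> norm (w c) \<le> R \<Longrightarrow>
       riem_exp A g p (tangent_scale t w) \<in> fst c \<and>
       norm (snd c (riem_exp A g p (tangent_scale t w)) - snd c p - t *\<^sub>R w c) \<le> M * t\<^sup>2"
    "\<And>t z. 0 < t \<Longrightarrow> t < \<delta> \<Longrightarrow> norm z \<le> R/2 \<Longrightarrow>
       \<exists>w\<in>tangent_space A p. norm (w c) \<le> R \<and> norm (w c - z) \<le> M * t \<and>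
         riem_exp A g p (tangent_scale t w) = chart_inv c (snd c p + t *\<^sub>R z)"
proof -
  define x0 where "x0 = snd c p"
  have x0: "x0 \<in> snd c ` fst c" using c by (simp add: x0_def)
  obtain \<rho> L where \<rho>: "\<rho> > 0" "L \<ge> 0" "cball x0 \<rho> \<subseteq> snd c ` fst c"
    and lip: "\<And>x y u v. x \<in> cball x0 \<rho> \<Longrightarrow> y \<in> cball x0 \<rho> \<Longrightarrow> norm u \<le> R + 1 \<Longrightarrow> norm v \<le> R + 1 \<Longrightarrow>
       norm (spray A g c x u - spray A g c y v) \<le> L * (norm (x - y) + norm (u - v))"
    using spray_lipschitz[OF c(1) x0, of "R + 1"] R by auto
  obtain \<delta> M where \<delta>: "\<delta> > 0" "M > 0"
    and flow: "\<And>t. 0 < t \<Longrightarrow> t < \<delta> \<Longrightarrow> \<exists>x y :: 'e \<Rightarrow> real \<Rightarrow> 'e.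
     \<forall>w. norm w \<le> R \<longrightarrow> x w 0 = x0 \<and> y w 0 = w \<and>
       (\<forall>s\<in>{0..1}. x w s \<in> cball x0 (\<rho>/2) \<and> norm (y w s) \<le> R + 1/2 \<and>
          (x w has_vector_derivative t *\<^sub>R y w s) (at s within {0..1}) \<and>
          (y w has_vector_derivative - t *\<^sub>R spray A g c (x w s) (y w s)) (at s within {0..1})) \<and>
       norm (x w 1 - x0 - t *\<^sub>R w) \<le> M * t\<^sup>2 \<and>
       (\<forall>w'. norm w' \<le> R \<longrightarrow>
          norm ((x w 1 - t *\<^sub>R w) - (x w' 1 - t *\<^sub>R w')) \<le> M * t\<^sup>2 * norm (w - w'))"
    and half: "\<And>t x x' u u'. 0 < t \<Longrightarrow> t < \<delta> \<Longrightarrow> x \<in> cball x0 \<rho> \<Longrightarrow> x' \<in> cball x0 \<rho> \<Longrightarrow>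
       norm u \<le> R + 1 \<Longrightarrow> norm u' \<le> R + 1 \<Longrightarrow>
       norm ((t *\<^sub>R u, - t *\<^sub>R spray A g c x u) - (t *\<^sub>R u', - t *\<^sub>R spray A g c x' u'))
         \<le> 1/2 * norm ((x, u) - (x', u'))"
    by (rule rescaled_spray_flow[OF \<rho>(1,2) R lip]) (assumption+, rule that, assumption+)
  \<comment> \<open>\<open>E\<close> is the exponential map at scale \<open>t\<close> read in the
    chart, that is \<open>x w 1\<close> as a function of \<open>w\<close>.\<close>
  have E: "\<exists>E. (\<forall>w. norm w \<le> R \<longrightarrow> E w \<in> snd c ` fst c \<and> norm (E w - x0 - t *\<^sub>R w) \<le> M * t\<^sup>2 \<and>
        (\<forall>w'. norm w' \<le> R \<longrightarrow> norm ((E w - t *\<^sub>R w) - (E w' - t *\<^sub>R w')) \<le> M * t\<^sup>2 * norm (w - w'))) \<and>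
      (\<forall>w\<in>tangent_space A p. norm (w c) \<le> R \<longrightarrow>
         riem_exp A g p (tangent_scale t w) = chart_inv c (E (w c)))"
    if t: "0 < t" "t < \<delta>" for t
  proof -
    obtain x y :: "'e \<Rightarrow> real \<Rightarrow> 'e" where xy: "\<And>w. norm w \<le> R \<Longrightarrow> x w 0 = x0 \<and> y w 0 = w \<and>
       (\<forall>s\<in>{0..1}. x w s \<in> cball x0 (\<rho>/2) \<and> norm (y w s) \<le> R + 1/2 \<and>
          (x w has_vector_derivative t *\<^sub>R y w s) (at s within {0..1}) \<and>
          (y w has_vector_derivative - t *\<^sub>R spray A g c (x w s) (y w s)) (at s within {0..1})) \<and>
       norm (x w 1 - x0 - t *\<^sub>R w) \<le> M * t\<^sup>2 \<and>
       (\<forall>w'. norm w' \<le> R \<longrightarrow>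
          norm ((x w 1 - t *\<^sub>R w) - (x w' 1 - t *\<^sub>R w')) \<le> M * t\<^sup>2 * norm (w - w'))"
      using flow[OF t] by blast
    have xU: "x w s \<in> snd c ` fst c" if "norm w \<le> R" "s \<in> {0..1}" for w s
    proof -
      have "x w s \<in> cball x0 (\<rho>/2)" using xy[OF that(1)] that(2) by blast
      then have "x w s \<in> cball x0 \<rho>" using \<rho>(1) by auto
      then show ?thesis using \<rho>(3) by blast
    qed
    have ex: "riem_exp A g p (tangent_scale t w) = chart_inv c (x (w c) 1)"
      if w: "w \<in> tangent_space A p" "norm (w c) \<le> R" for w
    proof -
      let ?x = "x (w c)" and ?y = "y (w c)"
      have dx: "(?x has_vector_derivative t *\<^sub>R ?y s) (at s within {0..1})"
        and dy: "(?y has_vector_derivative - t *\<^sub>R spray A g c (?x s) (?y s)) (at s within {0..1})"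
        and xb: "?x s \<in> cball x0 (\<rho>/2)" and yb': "norm (?y s) \<le> R + 1/2"
        if "s \<in> {0..1}" for s using xy[OF w(2)] that by blast+
      have yb: "norm (?y s) \<le> (R + 1) - 1/2" if "s \<in> {0..1}" for s using yb'[OF that] by simp
      have i: "?x 0 = x0" "?y 0 = w c" using xy[OF w(2)] by auto
      let ?\<sigma> = "\<lambda>s. chart_inv c (?x s)"
      have dty: "((\<lambda>s. t *\<^sub>R ?y s) has_vector_derivative - spray A g c (?x s) (t *\<^sub>R ?y s)) (at s within {0..1})"
        if "s \<in> {0..1}" for s
        using bounded_linear.has_vector_derivative[OF bounded_linear_scaleR_right dy[OF that]]
        by (simp add: spray_scale[OF c(1) xU[OF w(2) that]] power2_eq_square)
      have geo: "geodesic A g ?\<sigma> {0..1}"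
        by (rule geodesic_chart_curve[OF zero_less_one c(1) xU[OF w(2)] dx dty])
      have cty: "continuous_on {0..1} (\<lambda>s. t *\<^sub>R ?y s)"
        by (rule continuous_on_vector_derivative[OF dty])
      have \<sigma>0: "?\<sigma> 0 = p" by (simp add: i x0_def chart_inv_chart c)
      have v0: "velocity A ?\<sigma> {0..1} 0 = tangent_scale t w"
      proof -
        have "velocity A ?\<sigma> {0..1} 0 = coord_tangent A c (?\<sigma> 0) (t *\<^sub>R ?y 0)"
          by (rule velocity_chart_curve[OF zero_less_one c(1) xU[OF w(2)] dx cty]) auto
        also have "\<dots> = coord_tangent A c p (tangent_scale t w c)"
          unfolding \<sigma>0 by (simp add: i tangent_scale_def)
        also have "\<dots> = tangent_scale t w"
          by (rule tangent_eq_coord[OF tangent_scale_in[OF w(1)] c, symmetric])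
        finally show ?thesis .
      qed
      show ?thesis
        unfolding riem_exp_def
      proof (rule the_equality)
        show "\<exists>\<gamma>. geodesic A g \<gamma> {0..1} \<and> \<gamma> 0 = p \<and> velocity A \<gamma> {0..1} 0 = tangent_scale t w \<and>
            \<gamma> 1 = chart_inv c (?x 1)"
          using geo \<sigma>0 v0 by blast
      next
        fix q assume "\<exists>\<gamma>. geodesic A g \<gamma> {0..1} \<and> \<gamma> 0 = p \<and>
          velocity A \<gamma> {0..1} 0 = tangent_scale t w \<and> \<gamma> 1 = q"
        then obtain \<gamma> where \<gamma>: "geodesic A g \<gamma> {0..1}" "\<gamma> 0 = p"
          "velocity A \<gamma> {0..1} 0 = tangent_scale t w" "\<gamma> 1 = q" by blast
        have "\<gamma> 1 = chart_inv c (?x 1)"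
          by (rule geodesic_unique[where y = ?y, OF c(1) \<rho>(1,3) t(1) half[OF t] xb yb dx dy \<gamma>(1)])
            (use \<gamma> \<sigma>0 i in \<open>auto simp: tangent_scale_def\<close>)
        then show "q = chart_inv c (?x 1)" using \<gamma>(4) by simp
      qed
    qed
    show ?thesis
    proof (intro exI[of _ "\<lambda>w. x w 1"] conjI allI impI ballI)
      show "x w 1 \<in> snd c ` fst c" if "norm w \<le> R" for w using xU[OF that] by simp
    qed (use xy ex in blast)+
  qed
  \<comment> \<open>The two extra bounds are the smallness conditions on \<open>M * t\<close> in
    \<open>perturbation_surjective\<close>.\<close>
  define \<delta>' where "\<delta>' = min \<delta> (min (1 / (2 * M)) (R / (2 * M)))"
  have \<delta>': "\<delta>' > 0" using \<delta> R by (simp add: \<delta>'_def)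
  show thesis
  proof (rule that[OF \<delta>' \<delta>(2)])
    fix t w assume t: "0 < t" "t < \<delta>'" and w: "w \<in> tangent_space A p" "norm (w c) \<le> R"
    have "t < \<delta>" using t by (simp add: \<delta>'_def)
    from E[OF t(1) this] obtain E where "E (w c) \<in> snd c ` fst c"
      "norm (E (w c) - x0 - t *\<^sub>R w c) \<le> M * t\<^sup>2"
      "riem_exp A g p (tangent_scale t w) = chart_inv c (E (w c))" using w by blast
    then show "riem_exp A g p (tangent_scale t w) \<in> fst c \<and>
       norm (snd c (riem_exp A g p (tangent_scale t w)) - snd c p - t *\<^sub>R w c) \<le> M * t\<^sup>2"
      by (simp add: chart_inv_in chart_chart_inv c x0_def)
  next
    fix t and z :: 'e assume t: "0 < t" "t < \<delta>'" and z: "norm z \<le> R/2"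
    have "t < \<delta>" using t by (simp add: \<delta>'_def)
    from E[OF t(1) this] obtain E where
      E: "\<And>w. norm w \<le> R \<Longrightarrow> norm (E w - x0 - t *\<^sub>R w) \<le> M * t\<^sup>2"
      "\<And>w w'. norm w \<le> R \<Longrightarrow> norm w' \<le> R \<Longrightarrow>
         norm ((E w - t *\<^sub>R w) - (E w' - t *\<^sub>R w')) \<le> M * t\<^sup>2 * norm (w - w')"
      and ex: "\<And>w. w \<in> tangent_space A p \<Longrightarrow> norm (w c) \<le> R \<Longrightarrow>
         riem_exp A g p (tangent_scale t w) = chart_inv c (E (w c))" by blast
    have Mt: "M * t \<le> 1/2" "M * t \<le> R/2"
      using t \<delta>(2) by (auto simp: \<delta>'_def field_simps)
    obtain a where a: "norm a \<le> R" "E a = x0 + t *\<^sub>R z" "norm (a - z) \<le> M * t"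
      by (rule perturbation_surjective[of R E, OF E t(1) Mt z])
    let ?w = "coord_tangent A c p a"
    show "\<exists>w\<in>tangent_space A p. norm (w c) \<le> R \<and> norm (w c - z) \<le> M * t \<and>
         riem_exp A g p (tangent_scale t w) = chart_inv c (snd c p + t *\<^sub>R z)"
      by (rule bexI[of _ ?w]) (use ex[of ?w] a c in \<open>auto simp: coord_tangent_in x0_def\<close>)
  qed
qed

end

section \<open>Lengths of curves\<close>

text \<open>The velocity of a piecewise curve is uncontrolled at the break points, so estimates of
  the speed hold only off a finite set, on which \<open>f\<close> is replaced by
  \<open>h\<close>.\<close>

lemma integral_le_off_finite:
  fixes f h :: "real \<Rightarrow> real"
  assumes "f integrable_on T" "h integrable_on T" "finite S" "\<And>t. t \<in> T - S \<Longrightarrow> h t \<le> f t"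
  shows "integral T h \<le> integral T f"
proof -
  define f' where "f' t = (if t \<in> S then h t else f t)" for t
  have "f' integrable_on T"
    by (rule integrable_spike_finite[OF assms(3) _ assms(1)]) (simp add: f'_def)
  then have "integral T h \<le> integral T f'"
    by (rule integral_le[OF assms(2)]) (use assms(4) in \<open>auto simp: f'_def\<close>)
  also have "integral T f' = integral T f"
    by (rule integral_spike[OF negligible_finite[OF assms(3)]]) (simp add: f'_def)
  finally show ?thesis .
qed

text \<open>Induction on the number of break points to the left of \<open>b\<close>; the nearest one
  to the left is joined to \<open>b\<close> by a single piece.\<close>

lemma integrable_on_pieces:
  fixes f :: "real \<Rightarrow> real"
  assumes S: "finite S" "{0, 1} \<subseteq> S" "S \<subseteq> {0..1}"
    and f: "\<And>a b. a \<in> S \<Longrightarrow> b \<in> S \<Longrightarrow> a < b \<Longrightarrow> {a<..<b} \<inter> S = {} \<Longrightarrow> f integrable_on {a..b}"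
  shows "f integrable_on {0..1}"
proof -
  have "f integrable_on {0..b}" if "b \<in> S" for b
    using that
  proof (induction "card (S \<inter> {..<b})" arbitrary: b rule: less_induct)
    case less
    show ?case
    proof (cases "b = 0")
      case False
      then have b: "0 \<in> S \<inter> {..<b}" using S less.prems by force
      define a where "a = Max (S \<inter> {..<b})"
      have fin: "finite (S \<inter> {..<b})" using S(1) by simp
      have a: "a \<in> S \<inter> {..<b}" unfolding a_def by (rule Max_in[OF fin]) (use b in blast)
      have a_max: "x \<le> a" if "x \<in> S" "x < b" for x
        unfolding a_def by (rule Max_ge[OF fin]) (use that in simp)
      have "S \<inter> {..<a} \<subset> S \<inter> {..<b}" using a by auto
      then have "card (S \<inter> {..<a}) < card (S \<inter> {..<b})" by (rule psubset_card_mono[OF fin])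
      then have "f integrable_on {0..a}" using less.hyps[of a] a by blast
      moreover have "f integrable_on {a..b}"
        by (rule f) (use a less.prems a_max in force)+
      ultimately show ?thesis
        using a S(3) by (intro Henstock_Kurzweil_Integration.integrable_combine[of 0 a b]) auto
    qed (use integrable_on_refl[of f "0::real"] in simp)
  qed
  then show ?thesis using S(2) by blast
qed

lemma enclosing_piece:
  fixes S :: "real set"
  assumes S: "finite S" "{0, 1} \<subseteq> S" "S \<subseteq> {0..1}" and t: "t \<in> {0..1} - S"
  obtains a b where "a \<in> S" "b \<in> S" "a < t" "t < b" "{a<..<b} \<inter> S = {}"
proof -
  have t01: "0 < t" "t < 1" using S(2) t by (auto simp: less_le)
  define a where "a = Max (S \<inter> {..<t})"
  define b where "b = Min (S \<inter> {t<..})"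
  have fin: "finite (S \<inter> {..<t})" "finite (S \<inter> {t<..})" using S(1) by auto
  have a: "a \<in> S \<inter> {..<t}" unfolding a_def by (rule Max_in[OF fin(1)]) (use S(2) t01 in blast)
  have b: "b \<in> S \<inter> {t<..}" unfolding b_def by (rule Min_in[OF fin(2)]) (use S(2) t01 in blast)
  have "x \<le> a" if "x \<in> S" "x < t" for x
    unfolding a_def by (rule Max_ge[OF fin(1)]) (use that in simp)
  moreover have "b \<le> x" if "x \<in> S" "t < x" for x
    unfolding b_def by (rule Min_le[OF fin(2)]) (use that in simp)
  ultimately have "x \<notin> S" if "a < x" "x < b" for x
    using that t by (metis DiffD2 linorder_neqE_linordered_idom not_less)
  then show thesis using a b by (intro that[of a b]) auto
qed

text \<open>An orthogonal basis \<open>D\<close>, without 0 so that \<open>proj\<close> divides by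
  nonzero squares, gives finitely many coordinates. A bounded sequence has a subsequence along which
  all of them converge, and \<open>unproj\<close> reassembles the limit.\<close>

lemma compact_cball_finite_dimensional:
  fixes B :: "'a::real_inner set"
  assumes "finite B" "span B = UNIV"
  shows "compact (cball (a::'a) r)"
proof -
  obtain C where C: "finite C" "span C = span B" "pairwise orthogonal C"
    using basis_orthogonal[OF assms(1)] by blast
  define D where "D = C - {0}"
  have D: "finite D" "span D = UNIV" "pairwise orthogonal D" "0 \<notin> D"
    using C assms(2) by (auto simp: D_def span_delete_0 pairwise_def)
  define proj where "proj x d = (x \<bullet> d) / (d \<bullet> d)" for x d :: 'a
  define unproj where "unproj e = (\<Sum>d\<in>D. e d *\<^sub>R d)" for e :: "'a \<Rightarrow> real"
  have pu: "proj (unproj e) k = e k" if "k \<in> D" for e k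
  proof -
    have "unproj e \<bullet> k = (\<Sum>d\<in>D. e d * (d \<bullet> k))"
      by (simp add: unproj_def inner_sum_left)
    also have "\<dots> = (\<Sum>d\<in>D. if d = k then e k * (k \<bullet> k) else 0)"
      using D(3) that by (intro sum.cong) (auto simp: pairwise_def orthogonal_def)
    also have "\<dots> = e k * (k \<bullet> k)" using D(1) that by simp
    finally show ?thesis using D(4) that by (auto simp: proj_def)
  qed
  have up: "unproj (proj x) = x" for x
  proof -
    have "x \<in> span D" using D(2) by simp
    then obtain u where u: "x = unproj u"
      unfolding span_finite[OF D(1)] unproj_def by auto
    have "unproj (proj (unproj u)) = (\<Sum>d\<in>D. proj (unproj u) d *\<^sub>R d)"
      by (rule unproj_def)
    also have "\<dots> = unproj u"
      unfolding unproj_def[of u] by (rule sum.cong) (simp_all add: pu flip: unproj_def)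
    finally have "unproj (proj (unproj u)) = unproj u" .
    then show ?thesis using u by simp
  qed
  have "\<exists>l\<in>cball a r. \<exists>s. strict_mono s \<and> (f \<circ> s) \<longlonglongrightarrow> l" if f: "\<forall>n. f n \<in> cball a r" for f :: "nat \<Rightarrow> 'a"
  proof -
    have bf: "bounded (range f)"
      by (rule bounded_subset[OF bounded_cball[of a r]]) (use f in auto)
    have "\<forall>d\<subseteq>D. \<exists>l. \<exists>s. strict_mono s \<and>
        (\<forall>e>0. eventually (\<lambda>n. \<forall>i\<in>d. dist (proj (f (s n)) i) (proj l i) < e) sequentially)"
    proof (rule compact_lemma_general[where proj = proj and unproj = unproj and f = f, OF D(1)])
      show "bounded ((\<lambda>x. proj x k) ` range f)" if "k \<in> D" for k
        unfolding proj_def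
        by (rule bounded_linear_image[OF bf])
          (intro bounded_linear_compose[OF bounded_linear_divide] bounded_linear_inner_left)
    qed (use pu up in auto)
    then obtain l s where s: "strict_mono s"
      and lim: "\<And>e. e > 0 \<Longrightarrow> eventually (\<lambda>n. \<forall>i\<in>D. dist (proj (f (s n)) i) (proj l i) < e) sequentially"
      by blast
    have "(\<lambda>n. proj (f (s n)) i) \<longlonglongrightarrow> proj l i" if "i \<in> D" for i
    proof (rule tendstoI)
      fix e :: real assume "e > 0"
      from lim[OF this] show "\<forall>\<^sub>F n in sequentially. dist (proj (f (s n)) i) (proj l i) < e"
        by (rule eventually_mono) (use that in blast)
    qed
    then have "(\<lambda>n. unproj (proj (f (s n)))) \<longlonglongrightarrow> unproj (proj l)"
      unfolding unproj_def by (intro tendsto_intros)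
    then have "(f \<circ> s) \<longlonglongrightarrow> l" by (simp add: up comp_def)
    moreover from this have "l \<in> cball a r"
      by (rule closed_sequentially[OF closed_cball, rotated]) (use f in simp)
    ultimately show ?thesis using s by blast
  qed
  then show ?thesis by (simp add: compact_def)
qed

section \<open>The metric as a norm in coordinates\<close>

context riem
begin

text \<open>With the base point as a separate argument, the norms of one coordinate vector at
  different points can be compared, which has no counterpart for
  \<open>tangent_norm\<close>.\<close>

definition cnorm :: "('m, 'e) chart \<Rightarrow> 'e \<Rightarrow> 'e \<Rightarrow> real" where
  "cnorm c x a = sqrt (gram c x a a)"

lemma tangent_norm_cnorm:
  assumes "c \<in> A" "q \<in> fst c" "v \<in> tangent_space A q"
  shows "tangent_norm g q v = cnorm c (snd c q) (v c)"
  by (simp add: tangent_norm_def cnorm_def gram_eq[OF assms(1,2,3,3)])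

lemma tangent_norm_nonneg: "v \<in> tangent_space A q \<Longrightarrow> tangent_norm g q v \<ge> 0"
  by (rule cover[of q]) (simp add: tangent_norm_cnorm cnorm_def gram_nonneg)

lemma cnorm_nonneg: "c \<in> A \<Longrightarrow> x \<in> snd c ` fst c \<Longrightarrow> cnorm c x a \<ge> 0"
  by (simp add: cnorm_def gram_nonneg)

lemma cnorm_power2: "c \<in> A \<Longrightarrow> x \<in> snd c ` fst c \<Longrightarrow> (cnorm c x a)\<^sup>2 = gram c x a a"
  by (simp add: cnorm_def gram_nonneg)

lemma cnorm_scale: "cnorm c x (t *\<^sub>R a) = \<bar>t\<bar> * cnorm c x a"
proof -
  have "gram c x (t *\<^sub>R a) (t *\<^sub>R a) = t\<^sup>2 * gram c x a a"
    by (simp add: blinfun.scaleR_left blinfun.scaleR_right power2_eq_square)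
  then show ?thesis by (simp add: cnorm_def real_sqrt_mult)
qed

lemma cnorm_minus_commute: "cnorm c x (a - b) = cnorm c x (b - a)"
  using cnorm_scale[of c x "-1" "a - b"] by simp

text \<open>With \<alpha> and \<beta> the norms of \<open>a\<close> and \<open>b\<close>, the form
  at \<beta> a - \<alpha> b equals 2 \<alpha> \<beta> (\<alpha> \<beta> -
  \<open>gram c x a b\<close>), and it is nonnegative.\<close>

lemma gram_Cauchy_Schwarz:
  assumes "c \<in> A" "x \<in> snd c ` fst c"
  shows "gram c x a b \<le> cnorm c x a * cnorm c x b"
proof (cases "a = 0 \<or> b = 0")
  case False
  let ?\<alpha> = "cnorm c x a" and ?\<beta> = "cnorm c x b"
  have pos: "?\<alpha> > 0" "?\<beta> > 0"
    using False gram_eq_0[OF assms] gram_nonneg[OF assms] by (auto simp: cnorm_def less_le)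
  let ?z = "?\<beta> *\<^sub>R a - ?\<alpha> *\<^sub>R b"
  have "0 \<le> gram c x ?z ?z" by (rule gram_nonneg[OF assms])
  also have "gram c x ?z ?z = ?\<beta>\<^sup>2 * gram c x a a - 2 * ?\<alpha> * ?\<beta> * gram c x a b + ?\<alpha>\<^sup>2 * gram c x b b"
    using gram_sym[OF assms, of b a]
    by (simp add: blinfun.diff_left blinfun.diff_right blinfun.scaleR_left blinfun.scaleR_right
        power2_eq_square algebra_simps)
  also have "\<dots> = 2 * (?\<alpha> * ?\<beta>) * (?\<alpha> * ?\<beta> - gram c x a b)"
    unfolding cnorm_power2[OF assms, symmetric] by (simp add: power2_eq_square algebra_simps)
  finally have nn: "0 \<le> 2 * (?\<alpha> * ?\<beta>) * (?\<alpha> * ?\<beta> - gram c x a b)" .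
  have "2 * (?\<alpha> * ?\<beta>) > 0" using pos by simp
  from mult_pos_neg[OF this, of "?\<alpha> * ?\<beta> - gram c x a b"] nn show ?thesis
    by linarith
qed (auto simp: cnorm_def)

lemma cnorm_triangle:
  assumes "c \<in> A" "x \<in> snd c ` fst c"
  shows "cnorm c x (a + b) \<le> cnorm c x a + cnorm c x b"
proof (rule power2_le_imp_le)
  have "(cnorm c x (a + b))\<^sup>2 = (cnorm c x a)\<^sup>2 + 2 * gram c x a b + (cnorm c x b)\<^sup>2"
    using gram_sym[OF assms, of b a]
    by (simp add: cnorm_power2[OF assms] blinfun.add_left blinfun.add_right)
  also have "\<dots> \<le> (cnorm c x a)\<^sup>2 + 2 * (cnorm c x a * cnorm c x b) + (cnorm c x b)\<^sup>2"
    using gram_Cauchy_Schwarz[OF assms, of a b] by simp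
  also have "\<dots> = (cnorm c x a + cnorm c x b)\<^sup>2" by (simp add: power2_sum)
  finally show "(cnorm c x (a + b))\<^sup>2 \<le> (cnorm c x a + cnorm c x b)\<^sup>2" .
qed (use cnorm_nonneg[OF assms] in simp)

lemma cnorm_equiv:
  assumes "c \<in> A" "x \<in> snd c ` fst c"
  obtains k K where "k > 0" "K > 0" "\<And>a. k * norm a \<le> cnorm c x a" "\<And>a. cnorm c x a \<le> K * norm a"
proof -
  obtain k where k: "k > 0" "\<And>a. k * (norm a)\<^sup>2 \<le> gram c x a a"
    using gram_coercive[OF assms] by blast
  have 1: "sqrt k * norm a \<le> cnorm c x a" for a
    using real_sqrt_le_mono[OF k(2)[of a]] by (simp add: cnorm_def real_sqrt_mult)
  have 2: "cnorm c x a \<le> (sqrt (norm (gram c x)) + 1) * norm a" for a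
  proof -
    have "gram c x a a \<le> norm (gram c x a) * norm a"
      using norm_blinfun[of "gram c x a" a] by simp
    also have "\<dots> \<le> (norm (gram c x) * norm a) * norm a"
      by (intro mult_right_mono norm_blinfun) auto
    finally have "gram c x a a \<le> norm (gram c x) * (norm a)\<^sup>2"
      by (simp add: power2_eq_square mult.assoc)
    from real_sqrt_le_mono[OF this] have "cnorm c x a \<le> sqrt (norm (gram c x)) * norm a"
      by (simp add: cnorm_def real_sqrt_mult)
    also have "\<dots> \<le> (sqrt (norm (gram c x)) + 1) * norm a" by (intro mult_right_mono) auto
    finally show ?thesis .
  qed
  have "sqrt (norm (gram c x)) + 1 > 0" by (simp add: add_nonneg_pos)
  then show thesis using k(1) 1 2 by (intro that[of "sqrt k" "sqrt (norm (gram c x)) + 1"]) auto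
qed

text \<open>Continuity of \<open>gram c\<close> in the operator norm with tolerance
  \<open>e * k\<close>, combined with coercivity at \<open>x0\<close>, becomes a relative error
  \<open>e\<close> of the squared norms. The inequalities (1 - e)^2 \<le> 1 - e and 1 + e \<le> (1 +
  e)^2 carry it over to the norms.\<close>

lemma cnorm_compare:
  assumes c: "c \<in> A" and x0: "x0 \<in> snd c ` fst c" and e: "0 < e" "e < 1"
  obtains \<rho> where "\<rho> > 0" "cball x0 \<rho> \<subseteq> snd c ` fst c"
    "\<And>x a. x \<in> cball x0 \<rho> \<Longrightarrow> (1 - e) * cnorm c x0 a \<le> cnorm c x a"
    "\<And>x a. x \<in> cball x0 \<rho> \<Longrightarrow> cnorm c x a \<le> (1 + e) * cnorm c x0 a"
proof -
  obtain k where k: "k > 0" "\<And>a. k * (norm a)\<^sup>2 \<le> gram c x0 a a"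
    using gram_coercive[OF c x0] by blast
  have "e * k > 0" using e k by simp
  then obtain d1 where d1: "d1 > 0"
    "\<And>x. x \<in> snd c ` fst c \<Longrightarrow> dist x x0 < d1 \<Longrightarrow> dist (gram c x) (gram c x0) < e * k"
    using gram_cont[OF c, unfolded continuous_on_iff] x0 by metis
  obtain d2 where d2: "d2 > 0" "ball x0 d2 \<subseteq> snd c ` fst c"
    using open_img[OF c] x0 openE by blast
  define \<rho> where "\<rho> = min d1 d2 / 2"
  have \<rho>: "\<rho> > 0" "\<rho> < d1" "\<rho> < d2" using d1 d2 by (auto simp: \<rho>_def)
  have sub: "cball x0 \<rho> \<subseteq> snd c ` fst c"
    using \<rho>(3) d2(2) by (auto simp: subset_iff)
  have bd: "\<bar>gram c x a a - gram c x0 a a\<bar> \<le> e * gram c x0 a a" if x: "x \<in> cball x0 \<rho>" for x a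
  proof -
    have "dist (gram c x) (gram c x0) < e * k"
      by (rule d1(2)) (use x sub \<rho> in \<open>auto simp: dist_commute\<close>)
    then have n: "norm (gram c x - gram c x0) \<le> e * k" by (simp add: dist_norm)
    have "\<bar>gram c x a a - gram c x0 a a\<bar> = norm ((gram c x - gram c x0) a a)"
      by (simp add: blinfun.diff_left)
    also have "\<dots> \<le> norm ((gram c x - gram c x0) a) * norm a" by (rule norm_blinfun)
    also have "\<dots> \<le> (norm (gram c x - gram c x0) * norm a) * norm a"
      by (intro mult_right_mono norm_blinfun) auto
    also have "\<dots> = norm (gram c x - gram c x0) * (norm a)\<^sup>2"
      by (simp add: power2_eq_square mult.assoc)
    also have "\<dots> \<le> (e * k) * (norm a)\<^sup>2" using n by (intro mult_right_mono) auto
    also have "\<dots> = e * (k * (norm a)\<^sup>2)" by simp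
    also have "\<dots> \<le> e * gram c x0 a a" using k(2)[of a] e by (intro mult_left_mono) auto
    finally show ?thesis .
  qed
  show thesis
  proof (rule that[OF \<rho>(1) sub])
    fix x a assume x: "x \<in> cball x0 \<rho>"
    have xU: "x \<in> snd c ` fst c" using x sub by blast
    note nn = gram_nonneg[OF c x0, of a] cnorm_nonneg[OF c xU, of a] cnorm_nonneg[OF c x0, of a]
    have "(1 - e)\<^sup>2 \<le> 1 - e"
      using e by (simp add: power2_eq_square mult_left_le_one_le)
    then have "(1 - e)\<^sup>2 * gram c x0 a a \<le> (1 - e) * gram c x0 a a"
      using nn(1) by (intro mult_right_mono) auto
    also have "\<dots> \<le> gram c x a a" using bd[OF x, of a] by (simp add: algebra_simps)
    finally have "((1 - e) * cnorm c x0 a)\<^sup>2 \<le> (cnorm c x a)\<^sup>2"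
      by (simp add: power_mult_distrib cnorm_power2[OF c] xU x0)
    then show "(1 - e) * cnorm c x0 a \<le> cnorm c x a"
      by (rule power2_le_imp_le[OF _ nn(2)])
    have "1 + e \<le> (1 + e)\<^sup>2"
      using e by (simp add: power2_eq_square algebra_simps)
    then have "(1 + e) * gram c x0 a a \<le> (1 + e)\<^sup>2 * gram c x0 a a"
      using nn(1) by (intro mult_right_mono) auto
    moreover have "gram c x a a \<le> (1 + e) * gram c x0 a a"
      using bd[OF x, of a] by (simp add: algebra_simps)
    ultimately have "(cnorm c x a)\<^sup>2 \<le> ((1 + e) * cnorm c x0 a)\<^sup>2"
      by (simp add: power_mult_distrib cnorm_power2[OF c] xU x0)
    then show "cnorm c x a \<le> (1 + e) * cnorm c x0 a"
      by (rule power2_le_imp_le) (use nn e in simp)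
  qed
qed

lemma C1_imp_piecewise_C1: "C1_curve A \<gamma> {0..1} \<Longrightarrow> piecewise_C1_curve A \<gamma>"
  unfolding piecewise_C1_curve_def
  by (auto simp: C1_curve_def[of A \<gamma> "{0..1}"] intro!: exI[of _ "{0, 1}"])

text \<open>The coordinate segment from \<open>a\<close> to \<open>b\<close> stays in the convex
  ball, and its speed is at most \<open>B * cnorm c x0 (b - a)\<close>.\<close>

lemma riem_dist_le_cnorm:
  assumes c: "c \<in> A" and sub: "cball x0 \<rho> \<subseteq> snd c ` fst c"
    and cmp: "\<And>x a. x \<in> cball x0 \<rho> \<Longrightarrow> cnorm c x a \<le> B * cnorm c x0 a"
    and ab: "a \<in> cball x0 \<rho>" "b \<in> cball x0 \<rho>"
  shows "riem_dist A g (chart_inv c a) (chart_inv c b) \<le> ereal (B * cnorm c x0 (b - a))"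
proof -
  define x where "x s = a + s *\<^sub>R (b - a)" for s
  define \<gamma> where "\<gamma> s = chart_inv c (x s)" for s
  have xb: "x s \<in> cball x0 \<rho>" if "s \<in> {0..1}" for s
  proof -
    have "(1 - s) *\<^sub>R a + s *\<^sub>R b \<in> cball x0 \<rho>"
      using convex_cball[of x0 \<rho>] ab that by (auto simp: convex_alt)
    moreover have "x s = (1 - s) *\<^sub>R a + s *\<^sub>R b" by (simp add: x_def algebra_simps)
    ultimately show ?thesis by simp
  qed
  have xU: "x s \<in> snd c ` fst c" if "s \<in> {0..1}" for s using xb[OF that] sub by blast
  have dx: "(x has_vector_derivative (b - a)) (at s within {0..1})" for s
    unfolding x_def by (auto simp: has_vector_derivative_def intro!: derivative_eq_intros)
  have vel: "velocity A \<gamma> {0..1} s = coord_tangent A c (\<gamma> s) (b - a)" if "s \<in> {0..1}" for s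
    unfolding \<gamma>_def
    by (rule velocity_chart_curve[where x' = "\<lambda>_. b - a", OF zero_less_one c xU dx _ that])
      (auto intro: continuous_intros)
  have C1: "C1_curve A \<gamma> {0..1}"
    unfolding \<gamma>_def
    by (rule C1_chart_curve[where x' = "\<lambda>_. b - a", OF zero_less_one c xU dx]) (auto intro: continuous_intros)
  have sp: "tangent_norm g (\<gamma> s) (velocity A \<gamma> {0..1} s) = cnorm c (x s) (b - a)" if "s \<in> {0..1}" for s
  proof -
    have q: "\<gamma> s \<in> fst c" "snd c (\<gamma> s) = x s"
      using chart_inv_in[OF c xU[OF that]] chart_chart_inv[OF c xU[OF that]] by (auto simp: \<gamma>_def)
    show ?thesis
      unfolding vel[OF that] using tangent_norm_cnorm[OF c q(1) coord_tangent_in[OF c q(1)]] q c by simp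
  qed
  have cx: "continuous_on {0..1} x" unfolding x_def by (intro continuous_intros)
  have "continuous_on {0..1} (\<lambda>s. cnorm c (x s) (b - a))"
    unfolding cnorm_def
    by (intro continuous_intros continuous_on_compose2[OF gram_cont[OF c] cx]) (use xU in blast)
  then have cont: "continuous_on {0..1} (\<lambda>s. tangent_norm g (\<gamma> s) (velocity A \<gamma> {0..1} s))"
    by (rule continuous_on_eq) (simp add: sp)
  have "norm (curve_length A g \<gamma>) \<le> (B * cnorm c x0 (b - a)) * (1 - 0)"
    unfolding curve_length_def
  proof (rule integral_bound[OF _ cont])
    fix s :: real assume s: "s \<in> {0..1}"
    show "norm (tangent_norm g (\<gamma> s) (velocity A \<gamma> {0..1} s)) \<le> B * cnorm c x0 (b - a)"
      using cmp[OF xb[OF s], of "b - a"] cnorm_nonneg[OF c xU[OF s], of "b - a"] by (simp add: sp[OF s])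
  qed simp
  then have "ereal (curve_length A g \<gamma>) \<le> ereal (B * cnorm c x0 (b - a))" by simp
  moreover have "riem_dist A g (chart_inv c a) (chart_inv c b) \<le> ereal (curve_length A g \<gamma>)"
    unfolding riem_dist_def
    by (rule INF_lower) (use C1_imp_piecewise_C1[OF C1] in \<open>auto simp: \<gamma>_def x_def\<close>)
  ultimately show ?thesis by (rule order_trans[rotated])
qed

section \<open>Speed of piecewise C1 curves and lower bounds for their length\<close>

lemma C1_curve_vector_derivative:
  assumes "C1_curve A \<gamma> I" "c \<in> A" "t \<in> I" "\<gamma> t \<in> fst c"
  shows "((\<lambda>s. snd c (\<gamma> s)) has_vector_derivative velocity A \<gamma> I t c) (at t within I)"
  using assms unfolding C1_curve_def by (auto simp: velocity_def vector_derivative_works comp_def)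

lemma velocity_in_tangent_space:
  assumes \<gamma>: "C1_curve A \<gamma> {a..b}" and ab: "a < b" and t: "t \<in> {a..b}"
  shows "velocity A \<gamma> {a..b} t \<in> tangent_space A (\<gamma> t)"
proof (rule tangent_spaceI)
  fix c c' assume c: "c \<in> A" "c' \<in> A" "\<gamma> t \<in> fst c" "\<gamma> t \<in> fst c'"
  have cont: "continuous_on {a..b} \<gamma>" using \<gamma> unfolding C1_curve_def by blast
  obtain d where d: "d > 0" "\<And>r. r \<in> {a..b} \<Longrightarrow> dist r t < d \<Longrightarrow> \<gamma> r \<in> fst c"
    by (rule continuous_on_nbhd[OF cont open_dom[OF c(1)] t c(3)]) (rule that)
  have "(transition c c' has_derivative tder c c' (snd c (\<gamma> t)))
      (at (snd c (\<gamma> t)) within (\<lambda>s. snd c (\<gamma> s)) ` {a..b})"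
  proof (rule has_derivative_at_withinI, rule tder_deriv[OF c(1,2)])
    show "snd c (\<gamma> t) \<in> snd c ` (fst c \<inter> fst c')" using c(3,4) by blast
  qed
  from vector_derivative_diff_chain_within[OF C1_curve_vector_derivative[OF \<gamma> c(1) t c(3)] this]
  have "((\<lambda>s. transition c c' (snd c (\<gamma> s))) has_derivative
      (\<lambda>h. h *\<^sub>R tder c c' (snd c (\<gamma> t)) (velocity A \<gamma> {a..b} t c))) (at t within {a..b})"
    by (simp add: has_vector_derivative_def comp_def)
  then have "((\<lambda>s. snd c' (\<gamma> s)) has_vector_derivative
      tder c c' (snd c (\<gamma> t)) (velocity A \<gamma> {a..b} t c)) (at t within {a..b})"
    unfolding has_vector_derivative_def
    by (rule has_derivative_transform_within[OF _ d(1) t]) (simp add: transition_chart c d(2))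
  then have "vector_derivative (\<lambda>s. snd c' (\<gamma> s)) (at t within cbox a b)
      = tder c c' (snd c (\<gamma> t)) (velocity A \<gamma> {a..b} t c)"
    by (intro vector_derivative_within_cbox) (use ab t in simp_all)
  then show "velocity A \<gamma> {a..b} t c' = tder c c' (snd c (\<gamma> t)) (velocity A \<gamma> {a..b} t c)"
    using c by (simp add: velocity_def[of A \<gamma> "{a..b}" t, THEN fun_cong, of c'] comp_def)
qed (auto simp: velocity_def)

text \<open>Continuity is local: near each time the curve lies in one chart, where the speed is
  \<open>cnorm\<close> of continuous data.\<close>

lemma speed_continuous:
  assumes \<gamma>: "C1_curve A \<gamma> {a..b}" and ab: "a < b"
  shows "continuous_on {a..b} (\<lambda>t. tangent_norm g (\<gamma> t) (velocity A \<gamma> {a..b} t))"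
    (is "continuous_on ?I ?f")
  unfolding continuous_on_eq_continuous_within
proof
  fix t assume t: "t \<in> ?I"
  obtain c where c: "c \<in> A" "\<gamma> t \<in> fst c" by (rule cover)
  have cont: "continuous_on ?I \<gamma>" using \<gamma> unfolding C1_curve_def by blast
  obtain d where d: "d > 0" "\<And>r. r \<in> ?I \<Longrightarrow> dist r t < d \<Longrightarrow> \<gamma> r \<in> fst c"
    by (rule continuous_on_nbhd[OF cont open_dom[OF c(1)] t c(2)]) (rule that)
  define V where "V = {r \<in> ?I. \<gamma> r \<in> fst c}"
  have cv: "continuous_on V (\<lambda>r. velocity A \<gamma> ?I r c)"
    using \<gamma> c(1) unfolding C1_curve_def V_def by blast
  have c\<gamma>: "continuous_on V \<gamma>" by (rule continuous_on_subset[OF cont]) (auto simp: V_def)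
  have "continuous_on V (\<lambda>r. snd c (\<gamma> r))"
    by (rule continuous_on_compose2[OF cont_chart[OF c(1)] c\<gamma>]) (auto simp: V_def)
  from continuous_on_compose2[OF gram_cont[OF c(1)] this]
  have cg: "continuous_on V (\<lambda>r. gram c (snd c (\<gamma> r)))" by (auto simp: V_def)
  have "continuous_on V (\<lambda>r. cnorm c (snd c (\<gamma> r)) (velocity A \<gamma> ?I r c))"
    unfolding cnorm_def by (intro continuous_intros cv cg)
  then have "continuous_on V ?f"
  proof (rule continuous_on_eq)
    fix r assume "r \<in> V"
    then have "r \<in> ?I" "\<gamma> r \<in> fst c" by (auto simp: V_def)
    then show "cnorm c (snd c (\<gamma> r)) (velocity A \<gamma> ?I r c) = ?f r"
      by (intro tangent_norm_cnorm[symmetric] c(1) velocity_in_tangent_space[OF \<gamma> ab])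
  qed
  then have "continuous (at t within V) ?f"
    using t c(2) by (auto simp: continuous_on_eq_continuous_within V_def)
  moreover have "at t within ?I = at t within V"
    by (rule at_within_nhd[of t "ball t d"]) (use d in \<open>auto simp: V_def dist_commute\<close>)
  ultimately show "continuous (at t within ?I) ?f" by simp
qed

text \<open>At a time inside a piece, the derivatives within the piece and within {0..1} are both
  the two-sided one. At break points nothing is claimed, which is why a finite set \<open>S\<close>
  is exempted.\<close>

lemma piecewise_C1_curve_speed:
  assumes "piecewise_C1_curve A \<gamma>"
  obtains S where "finite S" "(\<lambda>t. tangent_norm g (\<gamma> t) (velocity A \<gamma> {0..1} t)) integrable_on {0..1}"
    "\<And>t. t \<in> {0..1} - S \<Longrightarrow> velocity A \<gamma> {0..1} t \<in> tangent_space A (\<gamma> t)"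
    "\<And>t c. t \<in> {0..1} - S \<Longrightarrow> c \<in> A \<Longrightarrow> \<gamma> t \<in> fst c \<Longrightarrow>
       ((\<lambda>s. snd c (\<gamma> s)) has_vector_derivative velocity A \<gamma> {0..1} t c) (at t)"
proof -
  obtain S where S: "finite S" "{0, 1} \<subseteq> S" "S \<subseteq> {0..1}"
    and C1': "\<forall>a\<in>S. \<forall>b\<in>S. a < b \<and> {a<..<b} \<inter> S = {} \<longrightarrow> C1_curve A \<gamma> {a..b}"
    using assms unfolding piecewise_C1_curve_def by (elim conjE exE)
  have C1: "C1_curve A \<gamma> {a..b}" if "a \<in> S" "b \<in> S" "a < b" "{a<..<b} \<inter> S = {}" for a b
    using C1' that by blast
  have at_eq: "at t within {0..1} = at t" "at t within {a..b} = at t"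
    if "a \<in> S" "b \<in> S" "a < t" "t < b" for a b t
  proof -
    have "0 < t" "t < 1" using S(3) that by force+
    then show "at t within {0..1} = at t" by (rule at_within_Icc_at)
    show "at t within {a..b} = at t" using that(3,4) by (rule at_within_Icc_at)
  qed
  have vel: "velocity A \<gamma> {0..1} t = velocity A \<gamma> {a..b} t"
    if "a \<in> S" "b \<in> S" "a < t" "t < b" for a b t
    unfolding velocity_def at_eq[OF that] ..
  show thesis
  proof (rule that[OF S(1)])
    show "(\<lambda>t. tangent_norm g (\<gamma> t) (velocity A \<gamma> {0..1} t)) integrable_on {0..1}"
    proof (rule integrable_on_pieces[OF S])
      fix a b assume ab: "a \<in> S" "b \<in> S" "a < b" "{a<..<b} \<inter> S = {}"
      have "(\<lambda>t. tangent_norm g (\<gamma> t) (velocity A \<gamma> {a..b} t)) integrable_on {a..b}"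
        by (intro integrable_continuous_real speed_continuous C1 ab)
      then show "(\<lambda>t. tangent_norm g (\<gamma> t) (velocity A \<gamma> {0..1} t)) integrable_on {a..b}"
        by (rule integrable_spike_finite[of "{a, b}", rotated 2]) (use vel[OF ab(1,2)] in auto)
    qed
  next
    fix t :: real assume t: "t \<in> {0..1} - S"
    obtain a b where ab: "a \<in> S" "b \<in> S" "a < t" "t < b" "{a<..<b} \<inter> S = {}"
      by (rule enclosing_piece[OF S t]) (rule that)
    have C: "C1_curve A \<gamma> {a..b}" using C1[OF ab(1,2) _ ab(5)] ab by simp
    show "velocity A \<gamma> {0..1} t \<in> tangent_space A (\<gamma> t)"
      unfolding vel[OF ab(1-4)] by (rule velocity_in_tangent_space[OF C]) (use ab in auto)
    show "((\<lambda>s. snd c (\<gamma> s)) has_vector_derivative velocity A \<gamma> {0..1} t c) (at t)"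
      if "c \<in> A" "\<gamma> t \<in> fst c" for c
      using C1_curve_vector_derivative[OF C that(1) _ that(2)] ab
      unfolding vel[OF ab(1-4)] at_eq[OF ab(1-4)] by simp
  qed
qed

lemma curve_length_nonneg:
  assumes "piecewise_C1_curve A \<gamma>"
  shows "curve_length A g \<gamma> \<ge> 0"
proof -
  obtain S where S: "finite S" "(\<lambda>t. tangent_norm g (\<gamma> t) (velocity A \<gamma> {0..1} t)) integrable_on {0..1}"
    "\<And>t. t \<in> {0..1} - S \<Longrightarrow> velocity A \<gamma> {0..1} t \<in> tangent_space A (\<gamma> t)"
    using piecewise_C1_curve_speed[OF assms] by metis
  have "integral {0..1} (\<lambda>_::real. 0::real) \<le> curve_length A g \<gamma>"
    unfolding curve_length_def
    by (rule integral_le_off_finite[OF S(2) integrable_0 S(1) tangent_norm_nonneg[OF S(3)]])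
  then show ?thesis by simp
qed

lemma riem_dist_nonneg: "riem_dist A g q r \<ge> 0"
  unfolding riem_dist_def by (rule INF_greatest) (auto intro: curve_length_nonneg)

text \<open>Pairing with the displacement \<open>z\<close> reduces the estimate to a real-valued
  function: \<open>gram c x0 z z\<close> is the integral of the pairing of the velocity with
  \<open>z\<close>, and Cauchy-Schwarz bounds the integrand by the speed times
  \<open>cnorm c x0 z / e\<close>. Only the part up to \<open>T\<close> has to stay in the chart, as
  needed at a first exit time.\<close>

lemma curve_length_ge_cnorm:
  assumes \<gamma>: "piecewise_C1_curve A \<gamma>" and c: "c \<in> A" and x0: "x0 \<in> snd c ` fst c"
    and e: "e > 0" and T: "T \<in> {0..1}"
    and inc: "\<And>t. t \<in> {0..T} \<Longrightarrow> \<gamma> t \<in> fst c"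
    and cmp: "\<And>t a. t \<in> {0..T} \<Longrightarrow> e * cnorm c x0 a \<le> cnorm c (snd c (\<gamma> t)) a"
  shows "e * cnorm c x0 (snd c (\<gamma> T) - snd c (\<gamma> 0)) \<le> curve_length A g \<gamma>"
proof -
  let ?sp = "\<lambda>t. tangent_norm g (\<gamma> t) (velocity A \<gamma> {0..1} t)"
  obtain S where S: "finite S" "?sp integrable_on {0..1}"
    "\<And>t. t \<in> {0..1} - S \<Longrightarrow> velocity A \<gamma> {0..1} t \<in> tangent_space A (\<gamma> t)"
    and dv: "\<And>t c. t \<in> {0..1} - S \<Longrightarrow> c \<in> A \<Longrightarrow> \<gamma> t \<in> fst c \<Longrightarrow>
       ((\<lambda>s. snd c (\<gamma> s)) has_vector_derivative velocity A \<gamma> {0..1} t c) (at t)"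
    by (rule piecewise_C1_curve_speed[OF \<gamma>]) (rule that)
  define z where "z = snd c (\<gamma> T) - snd c (\<gamma> 0)"
  have c\<gamma>: "continuous_on {0..T} \<gamma>"
    by (rule continuous_on_subset[of "{0..1}"]) (use \<gamma> T in \<open>auto simp: piecewise_C1_curve_def\<close>)
  have cx: "continuous_on {0..T} (\<lambda>t. snd c (\<gamma> t))"
    by (rule continuous_on_compose2[OF cont_chart[OF c] c\<gamma>]) (use inc in blast)
  have T01: "{0..T} - S \<subseteq> {0..1} - S" using T by auto
  have FTC: "((\<lambda>t. gram c x0 (velocity A \<gamma> {0..1} t c) z) has_integral
      (gram c x0 (snd c (\<gamma> T)) z - gram c x0 (snd c (\<gamma> 0)) z)) {0..T}"
  proof (rule fundamental_theorem_of_calculus_interior_strong[OF S(1)])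
    fix t assume t: "t \<in> {0<..<T} - S"
    then have "t \<in> {0..1} - S" "t \<in> {0..T}" using T by auto
    from dv[OF this(1) c inc[OF this(2)]]
    show "((\<lambda>t. gram c x0 (snd c (\<gamma> t)) z) has_vector_derivative
        gram c x0 (velocity A \<gamma> {0..1} t c) z) (at t)"
      by (intro bounded_linear.has_vector_derivative[of "\<lambda>a. gram c x0 a z"]
          bounded_linear_compose[OF bounded_linear_apply_blinfun blinfun.bounded_linear_right])
  next
    show "continuous_on {0..T} (\<lambda>t. gram c x0 (snd c (\<gamma> t)) z)"
      by (intro continuous_intros cx)
  qed (use T in simp)
  have int: "?sp integrable_on {0..T}" "?sp integrable_on {T..1}"
    using S(2) T by (auto intro: integrable_subinterval_real)
  have cint: "(\<lambda>t. cnorm c x0 z / e * ?sp t) integrable_on {0..T}"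
    using integrable_cmul[OF int(1), of "cnorm c x0 z / e"] by simp
  have le_len: "integral {0..T} ?sp \<le> curve_length A g \<gamma>"
  proof -
    have "integral {T..1} (\<lambda>_. 0) \<le> integral {T..1} ?sp"
      by (rule integral_le_off_finite[OF int(2) integrable_0 S(1) tangent_norm_nonneg[OF S(3)]])
        (use T in auto)
    moreover have "integral {0..T} ?sp + integral {T..1} ?sp = curve_length A g \<gamma>"
      unfolding curve_length_def
      by (rule Henstock_Kurzweil_Integration.integral_combine) (use T S(2) in auto)
    ultimately show ?thesis by simp
  qed
  have "gram c x0 z z = gram c x0 (snd c (\<gamma> T)) z - gram c x0 (snd c (\<gamma> 0)) z"
    unfolding z_def by (simp add: blinfun.diff_left blinfun.diff_right)
  also have "\<dots> = integral {0..T} (\<lambda>t. gram c x0 (velocity A \<gamma> {0..1} t c) z)"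
    using FTC by (simp add: integral_unique)
  also have "\<dots> \<le> integral {0..T} (\<lambda>t. cnorm c x0 z / e * ?sp t)"
  proof (rule integral_le_off_finite[OF cint has_integral_integrable[OF FTC] S(1)])
    fix t assume t: "t \<in> {0..T} - S"
    let ?v = "velocity A \<gamma> {0..1} t"
    have tI: "t \<in> {0..1} - S" "t \<in> {0..T}" using t T01 by blast+
    have "e * cnorm c x0 (?v c) \<le> ?sp t"
      using cmp[OF tI(2), of "?v c"] by (simp add: tangent_norm_cnorm[OF c inc[OF tI(2)] S(3)[OF tI(1)]])
    then have "cnorm c x0 (?v c) \<le> ?sp t / e" using e by (simp add: field_simps)
    then have "cnorm c x0 (?v c) * cnorm c x0 z \<le> ?sp t / e * cnorm c x0 z"
      using cnorm_nonneg[OF c x0] by (intro mult_right_mono) auto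
    then show "gram c x0 (?v c) z \<le> cnorm c x0 z / e * ?sp t"
      using gram_Cauchy_Schwarz[OF c x0, of "?v c" z] by (simp add: mult.commute)
  qed
  also have "\<dots> = cnorm c x0 z / e * integral {0..T} ?sp" by simp
  also have "\<dots> \<le> cnorm c x0 z / e * curve_length A g \<gamma>"
    using le_len e cnorm_nonneg[OF c x0] by (intro mult_left_mono) auto
  finally have *: "(cnorm c x0 z)\<^sup>2 \<le> cnorm c x0 z / e * curve_length A g \<gamma>"
    by (simp add: cnorm_power2[OF c x0])
  show ?thesis
  proof (cases "cnorm c x0 z = 0")
    case True
    then show ?thesis using curve_length_nonneg[OF \<gamma>] by (simp add: z_def)
  next
    case False
    then have pos: "cnorm c x0 z > 0" using cnorm_nonneg[OF c x0, of z] by simp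
    from * have "cnorm c x0 z * (e * cnorm c x0 z) \<le> cnorm c x0 z * curve_length A g \<gamma>"
      using e by (simp add: field_simps power2_eq_square)
    then show ?thesis using pos by (simp add: z_def)
  qed
qed

text \<open>A short curve cannot leave a coordinate ball around its initial point: where it first
  reaches the boundary, its length is already bounded from below.  Closedness of the coordinate
  ball in the manifold is where compactness is used.\<close>

lemma short_curve_stays_near:
  assumes c: "c \<in> A" "p \<in> fst c" and e: "0 < e" "e < 1"
    and cpt: "\<And>r. compact (cball (snd c p) r)"
  obtains r where "r > 0"
    "\<And>\<gamma>. piecewise_C1_curve A \<gamma> \<Longrightarrow> \<gamma> 0 \<in> fst c \<Longrightarrow> dist (snd c p) (snd c (\<gamma> 0)) < r \<Longrightarrow>
      curve_length A g \<gamma> < r \<Longrightarrow> \<gamma> 1 \<in> fst c \<and>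
      (1 - e) * cnorm c (snd c p) (snd c (\<gamma> 1) - snd c (\<gamma> 0)) \<le> curve_length A g \<gamma>"
proof -
  define x0 where "x0 = snd c p"
  have x0: "x0 \<in> snd c ` fst c" using c by (simp add: x0_def)
  obtain \<rho> where \<rho>: "\<rho> > 0" "cball x0 \<rho> \<subseteq> snd c ` fst c"
    and cmp: "\<And>x a. x \<in> cball x0 \<rho> \<Longrightarrow> (1 - e) * cnorm c x0 a \<le> cnorm c x a"
    using cnorm_compare[OF c(1) x0 e] by metis
  obtain k where k: "k > 0" "\<And>a. k * norm a \<le> cnorm c x0 a"
    using cnorm_equiv[OF c(1) x0] by metis
  \<comment> \<open>The open coordinate ball \<open>V\<close> and the closed one \<open>K\<close>:
    leaving is detected by the complement of \<open>V\<close>, while \<open>K\<close>, compact and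
    hence closed in the manifold, contains the exit point.\<close>
  define V where "V = fst c \<inter> snd c -` ball x0 \<rho>"
  define K where "K = chart_inv c ` cball x0 \<rho>"
  have V: "open V" unfolding V_def
    by (rule continuous_open_preimage[OF cont_chart[OF c(1)] open_dom[OF c(1)] open_ball])
  have "compact K"
    unfolding K_def x0_def
    by (rule compact_continuous_image[OF continuous_on_subset[OF cont_inv[OF c(1)] \<rho>(2)[unfolded x0_def]] cpt])
  then have K: "closed K" by (rule compact_imp_closed)
  have Kin: "q \<in> fst c" "snd c q \<in> cball x0 \<rho>" if "q \<in> K" for q
    using that \<rho>(2) unfolding K_def by (auto simp: chart_inv_in[OF c(1)] chart_chart_inv[OF c(1)] subset_iff)
  have VK: "V \<subseteq> K"
  proof
    fix q assume "q \<in> V"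
    then show "q \<in> K" unfolding K_def V_def
      by (intro image_eqI[of q _ "snd c q"]) (auto simp: chart_inv_chart[OF c(1)])
  qed
  \<comment> \<open>A curve that starts within \<rho>/2 of \<open>x0\<close> and reaches the sphere
    of radius \<rho> has coordinate displacement at least \<rho>/2, hence length at least
    \<open>(1 - e) * k * \<rho> / 2\<close>.\<close>
  define r where "r = min (\<rho>/2) ((1 - e) * k * \<rho> / 2)"
  have r: "r > 0" "r \<le> \<rho>/2" "r \<le> (1 - e) * k * \<rho> / 2" using \<rho> e k by (auto simp: r_def)
  show thesis
  proof (rule that[OF r(1)])
    fix \<gamma> assume \<gamma>: "piecewise_C1_curve A \<gamma>" "\<gamma> 0 \<in> fst c" "dist (snd c p) (snd c (\<gamma> 0)) < r"
      "curve_length A g \<gamma> < r"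
    have d0: "dist x0 (snd c (\<gamma> 0)) < \<rho>/2" using \<gamma>(3) r(2) by (simp add: x0_def)
    then have \<gamma>0: "\<gamma> 0 \<in> V" using \<gamma>(2) \<rho>(1) by (simp add: V_def)
    have c\<gamma>: "continuous_on {0..1} \<gamma>" using \<gamma>(1) unfolding piecewise_C1_curve_def by blast
    have len: "(1 - e) * cnorm c x0 (snd c (\<gamma> T) - snd c (\<gamma> 0)) \<le> curve_length A g \<gamma>"
      if T: "T \<in> {0..1}" and "\<And>t. t \<in> {0..T} \<Longrightarrow> \<gamma> t \<in> K" for T
      by (rule curve_length_ge_cnorm[OF \<gamma>(1) c(1) x0 _ T])
        (use e Kin[OF that(2)] cmp in auto)
    define E where "E = {0..1} \<inter> \<gamma> -` (- V)"
    have "E = {}"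
    proof (rule ccontr)
      assume ne: "E \<noteq> {}"
      have cl: "closed E" unfolding E_def
        by (rule continuous_closed_preimage[OF c\<gamma>]) (use V in auto)
      have bdd: "bdd_below E" by (rule bdd_belowI[of _ 0]) (auto simp: E_def)
      define T where "T = Inf E"
      have TE: "T \<in> E" unfolding T_def by (rule closed_contains_Inf[OF ne bdd cl])
      then have T: "T \<in> {0..1}" "\<gamma> T \<notin> V" by (auto simp: E_def)
      have before: "\<gamma> t \<in> V" if "0 \<le> t" "t < T" for t
      proof (rule ccontr)
        assume "\<gamma> t \<notin> V"
        then have "t \<in> E" using that T by (auto simp: E_def)
        then have "T \<le> t" unfolding T_def by (rule cInf_lower[OF _ bdd])
        then show False using that by simp
      qed
      have T0: "0 < T" using T \<gamma>0 by (cases "T = 0") auto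
      have "\<gamma> ` closure {0..<T} \<subseteq> K"
      proof (rule image_closure_subset[OF _ K])
        show "continuous_on (closure {0..<T}) \<gamma>"
          using T0 T by (auto intro: continuous_on_subset[OF c\<gamma>])
        show "\<gamma> ` {0..<T} \<subseteq> K" using before VK by auto
      qed
      then have inK: "\<gamma> t \<in> K" if "t \<in> {0..T}" for t using that T0 by auto
      have "\<gamma> T \<in> K" using inK T0 by simp
      \<comment> \<open>The exit point lies in \<open>K\<close> but not in \<open>V\<close>, so it
        is on the coordinate sphere.\<close>
      then have "\<rho> \<le> dist x0 (snd c (\<gamma> T))" using T(2) Kin by (fastforce simp: V_def)
      also have "\<dots> \<le> dist x0 (snd c (\<gamma> 0)) + dist (snd c (\<gamma> 0)) (snd c (\<gamma> T))"
        by (rule dist_triangle)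
      finally have "\<rho>/2 \<le> norm (snd c (\<gamma> T) - snd c (\<gamma> 0))"
        using d0 by (simp add: dist_norm norm_minus_commute)
      then have "k * (\<rho>/2) \<le> k * norm (snd c (\<gamma> T) - snd c (\<gamma> 0))" using k(1) by simp
      also have "\<dots> \<le> cnorm c x0 (snd c (\<gamma> T) - snd c (\<gamma> 0))" by (rule k(2))
      finally have "(1 - e) * (k * (\<rho>/2)) \<le> (1 - e) * cnorm c x0 (snd c (\<gamma> T) - snd c (\<gamma> 0))"
        using e by (intro mult_left_mono) auto
      also have "\<dots> \<le> curve_length A g \<gamma>" by (rule len[OF T(1) inK])
      finally show False using \<gamma>(4) r(3) by simp
    qed
    then have "\<gamma> t \<in> K" if "t \<in> {0..1}" for t
      using that VK unfolding E_def by blast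
    from len[of 1] this Kin(1)[OF this, of 1]
    show "\<gamma> 1 \<in> fst c \<and>
        (1 - e) * cnorm c (snd c p) (snd c (\<gamma> 1) - snd c (\<gamma> 0)) \<le> curve_length A g \<gamma>"
      by (simp add: x0_def)
  qed
qed

end

section \<open>The contingent derivative of the distance function\<close>

context riem
begin

section \<open>The distance to a set and the neighbourhood filter of a direction\<close>

lemma riem_setdist_nonneg: "riem_setdist A g \<Omega> q \<ge> 0"
  unfolding riem_setdist_def by (rule INF_greatest) (rule riem_dist_nonneg)

lemma riem_setdist_self:
  assumes "p \<in> \<Omega>"
  shows "riem_setdist A g \<Omega> p = 0"
proof (rule antisym)
  obtain c where c: "c \<in> A" "p \<in> fst c" by (rule cover)
  have x0: "snd c p \<in> snd c ` fst c" using c by simp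
  obtain \<rho> where \<rho>: "\<rho> > 0" "cball (snd c p) \<rho> \<subseteq> snd c ` fst c"
    "\<And>x a. x \<in> cball (snd c p) \<rho> \<Longrightarrow> cnorm c x a \<le> (1 + 1/2) * cnorm c (snd c p) a"
    by (rule cnorm_compare[OF c(1) x0, of "1/2"]) (simp, simp, rule that)
  have "riem_dist A g (chart_inv c (snd c p)) (chart_inv c (snd c p))
      \<le> ereal ((1 + 1/2) * cnorm c (snd c p) (snd c p - snd c p))"
    by (rule riem_dist_le_cnorm[OF c(1) \<rho>(2,3)]) (use \<rho>(1) in auto)
  then have "riem_dist A g p p \<le> 0"
    by (simp add: chart_inv_chart c cnorm_def zero_ereal_def)
  then show "riem_setdist A g \<Omega> p \<le> 0"
    unfolding riem_setdist_def using assms by (meson INF_lower2)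
qed (rule riem_setdist_nonneg)

lemma riem_setdist_less:
  assumes "riem_setdist A g \<Omega> q < ereal L"
  obtains \<gamma> where "piecewise_C1_curve A \<gamma>" "\<gamma> 0 = q" "\<gamma> 1 \<in> \<Omega>" "curve_length A g \<gamma> < L"
  using assms that unfolding riem_setdist_def riem_dist_def INF_less_iff by auto

lemma tangent_norm_diff:
  assumes "c \<in> A" "p \<in> fst c" "v \<in> tangent_space A p" "w \<in> tangent_space A p"
  shows "tangent_norm g p (tangent_minus v w) = cnorm c (snd c p) (v c - w c)"
  using tangent_norm_cnorm[OF assms(1,2) tangent_minus_in[OF assms(3,4)]]
  by (simp add: tangent_minus_def)

text \<open>The filter is not punctured, so the direction \<open>v\<close> itself competes in the
  lower limit. This suffices for the upper estimate.\<close>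

lemma eventually_tangent_nhds_self:
  assumes "eventually P (tangent_nhds A g p v)" "v \<in> tangent_space A p"
  shows "P v"
proof -
  have "g p (\<lambda>_. 0) (\<lambda>_. 0) = 0"
  proof -
    obtain c where c: "c \<in> A" "p \<in> fst c" by (rule cover)
    have z: "(\<lambda>_. 0) \<in> tangent_space A p"
      using tangent_minus_in[OF assms(2,2)] by (simp add: tangent_minus_def)
    show ?thesis using gram_eq[OF c z z] by simp
  qed
  then have "tangent_norm g p (tangent_minus v v) = 0"
    by (simp add: tangent_norm_def tangent_minus_def)
  with assms show ?thesis
    unfolding tangent_nhds_def eventually_inf_principal eventually_filtercomap
    by (metis eventually_nhds_x_imp_x)
qed

lemma eventually_tangent_nhds:
  assumes "\<eta> > 0"
  shows "eventually (\<lambda>w. w \<in> tangent_space A p \<and> tangent_norm g p (tangent_minus w v) < \<eta>)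
           (tangent_nhds A g p v)"
proof -
  have "eventually (\<lambda>r::real. r < \<eta>) (nhds 0)"
    unfolding eventually_nhds by (rule exI[of _ "{..<\<eta>}"]) (use assms in auto)
  then show ?thesis
    unfolding tangent_nhds_def eventually_inf_principal eventually_filtercomap by blast
qed

text \<open>The lower limit is tested along the fixed direction \<open>v\<close> and the times
  \<open>t i\<close> of a sequence defining \<open>w\<close>: the point of \<Omega> reached along
  \<open>ws i\<close> is joined to \<open>exp_p (t i v)\<close> by a coordinate segment.\<close>

lemma contingent_deriv_le:
  assumes p: "p \<in> \<Omega>" and v: "v \<in> tangent_space A p" and w: "w \<in> contingent_cone A g \<Omega> p"
  shows "contingent_deriv A g (riem_setdist A g \<Omega>) p v
    \<le> ereal (tangent_norm g p (tangent_minus v w))"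
proof (rule ccontr)
  define N where "N = tangent_norm g p (tangent_minus v w)"
  let ?F = "\<lambda>(w, t). (riem_setdist A g \<Omega> (riem_exp A g p (tangent_scale t w))
      - riem_setdist A g \<Omega> p) / ereal t"
  assume "\<not> contingent_deriv A g (riem_setdist A g \<Omega>) p v \<le> ereal (tangent_norm g p (tangent_minus v w))"
  then obtain y where y: "ereal N < ereal y" "ereal y < contingent_deriv A g (riem_setdist A g \<Omega>) p v"
    using ereal_dense2 by (metis N_def not_le)
  from y(2) have "eventually (\<lambda>z. ereal y < ?F z) (tangent_nhds A g p v \<times>\<^sub>F at_right 0)"
    unfolding contingent_deriv_def by (rule less_LiminfD)
  then obtain P1 P2 where P: "eventually P1 (tangent_nhds A g p v)" "eventually P2 (at_right 0)"
    "\<And>w t. P1 w \<Longrightarrow> P2 t \<Longrightarrow> ereal y < ?F (w, t)"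
    unfolding eventually_prod_filter by blast
  have P1v: "P1 v" by (rule eventually_tangent_nhds_self[OF P(1) v])
  obtain ws t where wT: "w \<in> tangent_space A p" and ws: "\<And>i::nat. ws i \<in> tangent_space A p"
    and t: "\<And>i. t i > 0" and in\<Omega>: "\<And>i. riem_exp A g p (tangent_scale (t i) (ws i)) \<in> \<Omega>"
    and t0: "t \<longlonglongrightarrow> 0" and wlim: "(\<lambda>i. tangent_norm g p (tangent_minus (ws i) w)) \<longlonglongrightarrow> 0"
    using w unfolding contingent_cone_def by blast
  obtain c where c: "c \<in> A" "p \<in> fst c" by (rule cover)
  define x0 where "x0 = snd c p"
  have x0: "x0 \<in> snd c ` fst c" using c by (simp add: x0_def)
  define \<eta> where "\<eta> i = tangent_norm g p (tangent_minus (ws i) w)" for i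
  have \<eta>: "\<eta> i = cnorm c x0 (ws i c - w c)" for i
    unfolding \<eta>_def x0_def by (rule tangent_norm_diff[OF c ws wT])
  have N: "N = cnorm c x0 (v c - w c)"
    unfolding N_def x0_def by (rule tangent_norm_diff[OF c v wT])
  have N0: "N \<ge> 0" unfolding N by (rule cnorm_nonneg[OF c(1) x0])
  have Ny: "N < y" using y(1) by simp
  \<comment> \<open>Chosen so that the metric distortion \<open>1 + e\<close> does not use up the
    gap between \<open>N\<close> and \<open>y\<close>; \<open>N + 1\<close> avoids division by
    zero.\<close>
  define e where "e = min (1/2) ((y - N) / (2 * (N + 1)))"
  have e: "0 < e" "e < 1" using Ny N0 by (auto simp: e_def)
  have eN: "(1 + e) * N < y"
  proof -
    have "e * N \<le> (y - N) / (2 * (N + 1)) * N"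
      using N0 by (intro mult_right_mono) (auto simp: e_def)
    also have "\<dots> \<le> (y - N) / 2" using N0 Ny by (simp add: field_simps)
    finally show ?thesis using Ny by (simp add: distrib_right)
  qed
  obtain \<rho> where \<rho>: "\<rho> > 0" "cball x0 \<rho> \<subseteq> snd c ` fst c"
    "\<And>x a. x \<in> cball x0 \<rho> \<Longrightarrow> cnorm c x a \<le> (1 + e) * cnorm c x0 a"
    by (rule cnorm_compare[OF c(1) x0 e]) (rule that)
  obtain k K where k: "k > 0" "K > 0" "\<And>a. k * norm a \<le> cnorm c x0 a" "\<And>a. cnorm c x0 a \<le> K * norm a"
    by (rule cnorm_equiv[OF c(1) x0]) (rule that)
  \<comment> \<open>Covers \<open>v\<close> and every \<open>ws i\<close> within coordinate distance
    1 of \<open>w\<close>; the condition \<open>\<eta> i < k\<close> below ensures the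
    latter.\<close>
  define R where "R = norm (v c) + norm (w c) + 1"
  have R: "R > 0" unfolding R_def by (simp add: add_nonneg_pos)
  obtain \<delta> M where \<delta>: "\<delta> > 0" "M > 0" and ex: "\<And>t w. 0 < t \<Longrightarrow> t < \<delta> \<Longrightarrow> w \<in> tangent_space A p \<Longrightarrow> norm (w c) \<le> R \<Longrightarrow>
       riem_exp A g p (tangent_scale t w) \<in> fst c \<and>
       norm (snd c (riem_exp A g p (tangent_scale t w)) - x0 - t *\<^sub>R w c) \<le> M * t\<^sup>2"
    by (rule exp_chart[OF c R, folded x0_def]) (rule that)
  have "eventually (\<lambda>i. t i < \<delta>) sequentially"
    using order_tendstoD(2)[OF t0 \<delta>(1)] .
  moreover have "eventually (\<lambda>i. M * (t i)\<^sup>2 + t i * R < \<rho>) sequentially"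
  proof -
    have "(\<lambda>i. M * (t i)\<^sup>2 + t i * R) \<longlonglongrightarrow> M * 0\<^sup>2 + 0 * R" by (intro tendsto_intros t0)
    then show ?thesis using order_tendstoD(2) \<rho>(1) by fastforce
  qed
  moreover have "eventually (\<lambda>i. \<eta> i < k) sequentially"
    using order_tendstoD(2)[OF wlim k(1)] by (simp add: \<eta>_def)
  \<comment> \<open>Besides \<open>\<eta> i\<close>, the error contains the remainders of the two
    exponential maps: each is at most \<open>M * (t i)\<^sup>2\<close>, \<open>K\<close> converts it
    into the metric norm, and one factor \<open>t i\<close> is divided out.\<close>
  moreover have "eventually (\<lambda>i. (1 + e) * (N + \<eta> i + 2 * K * M * t i) < y) sequentially"
  proof -
    have "(\<lambda>i. (1 + e) * (N + \<eta> i + 2 * K * M * t i)) \<longlonglongrightarrow> (1 + e) * (N + 0 + 2 * K * M * 0)"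
      using wlim unfolding \<eta>_def[symmetric] by (intro tendsto_intros t0)
    then show ?thesis using order_tendstoD(2) eN by fastforce
  qed
  moreover have "eventually (\<lambda>i. P2 (t i)) sequentially"
  proof -
    have "filterlim t (at_right 0) sequentially"
      by (rule tendsto_imp_filterlim_at_right[OF t0]) (simp add: t)
    then show ?thesis using P(2) unfolding filterlim_iff by blast
  qed
  ultimately have "eventually (\<lambda>i. t i < \<delta> \<and> M * (t i)\<^sup>2 + t i * R < \<rho> \<and> \<eta> i < k \<and>
      (1 + e) * (N + \<eta> i + 2 * K * M * t i) < y \<and> P2 (t i)) sequentially"
    by eventually_elim auto
  then obtain i where i: "t i < \<delta>" "M * (t i)\<^sup>2 + t i * R < \<rho>" "\<eta> i < k"
      "(1 + e) * (N + \<eta> i + 2 * K * M * t i) < y" "P2 (t i)"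
    using eventually_happens'[OF sequentially_bot] by blast
  define q where "q = riem_exp A g p (tangent_scale (t i) v)"
  define a where "a = riem_exp A g p (tangent_scale (t i) (ws i))"
  have wR: "norm (ws i c) \<le> R"
  proof -
    have "k * norm (ws i c - w c) < k * 1" using k(3)[of "ws i c - w c"] i(3) \<eta>[of i] by linarith
    then have "norm (ws i c - w c) < 1" using k(1) by simp
    then show ?thesis
      unfolding R_def using norm_triangle_sub[of "ws i c" "w c"] norm_ge_zero[of "v c"] by linarith
  qed
  have vR: "norm (v c) \<le> R" by (simp add: R_def)
  have q: "q \<in> fst c" "norm (snd c q - x0 - t i *\<^sub>R v c) \<le> M * (t i)\<^sup>2"
    using ex[OF t i(1) v vR] by (auto simp: q_def)
  have a: "a \<in> fst c" "norm (snd c a - x0 - t i *\<^sub>R ws i c) \<le> M * (t i)\<^sup>2"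
    using ex[OF t i(1) ws wR] by (auto simp: a_def)
  have near: "snd c b \<in> cball x0 \<rho>"
    if "norm (snd c b - x0 - t i *\<^sub>R u) \<le> M * (t i)\<^sup>2" "norm u \<le> R" for b u
  proof -
    have "norm (snd c b - x0) \<le> norm (snd c b - x0 - t i *\<^sub>R u) + norm (t i *\<^sub>R u)"
      using norm_triangle_sub[of "snd c b - x0" "t i *\<^sub>R u"] by simp
    also have "norm (t i *\<^sub>R u) \<le> t i * R" using that(2) t[of i] by simp
    finally show ?thesis using that(1) i(2) by (simp add: dist_norm norm_minus_commute)
  qed
  have "riem_dist A g (chart_inv c (snd c q)) (chart_inv c (snd c a))
      \<le> ereal ((1 + e) * cnorm c x0 (snd c a - snd c q))"
    by (rule riem_dist_le_cnorm[OF c(1) \<rho>(2,3) near[OF q(2) vR] near[OF a(2) wR]])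
  then have "riem_dist A g q a \<le> ereal ((1 + e) * cnorm c x0 (snd c a - snd c q))"
    by (simp add: chart_inv_chart c q a)
  moreover have "riem_setdist A g \<Omega> q \<le> riem_dist A g q a"
    unfolding riem_setdist_def by (rule INF_lower) (use in\<Omega> in \<open>simp add: a_def\<close>)
  moreover have "(1 + e) * cnorm c x0 (snd c a - snd c q)
      \<le> (1 + e) * (N + \<eta> i + 2 * K * M * t i) * t i"
  proof -
    define e1 where "e1 = snd c a - x0 - t i *\<^sub>R ws i c"
    define e2 where "e2 = snd c q - x0 - t i *\<^sub>R v c"
    note tri = cnorm_triangle[OF c(1) x0]
    have "snd c a - snd c q = t i *\<^sub>R (ws i c - v c) + (e1 - e2)"
      by (simp add: e1_def e2_def algebra_simps)
    then have "cnorm c x0 (snd c a - snd c q) \<le> t i * cnorm c x0 (ws i c - v c) + cnorm c x0 (e1 - e2)"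
      using tri[of "t i *\<^sub>R (ws i c - v c)" "e1 - e2"] t[of i] by (simp add: cnorm_scale)
    also have "cnorm c x0 (ws i c - v c) \<le> \<eta> i + N"
      using tri[of "ws i c - w c" "w c - v c"] by (simp add: \<eta> N cnorm_minus_commute[of c x0 "v c"])
    also have "cnorm c x0 (e1 - e2) \<le> K * (2 * (M * (t i)\<^sup>2))"
    proof -
      have "norm (e1 - e2) \<le> 2 * (M * (t i)\<^sup>2)"
        using norm_triangle_ineq4[of e1 e2] a(2)[folded e1_def] q(2)[folded e2_def] by linarith
      then show ?thesis using k(4)[of "e1 - e2"] k(2) by (meson mult_left_mono less_imp_le order_trans)
    qed
    finally have "cnorm c x0 (snd c a - snd c q) \<le> (N + \<eta> i + 2 * K * M * t i) * t i"
      using t[of i] by (simp add: algebra_simps power2_eq_square)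
    then show ?thesis using e by (simp add: mult.assoc)
  qed
  ultimately have "riem_setdist A g \<Omega> q \<le> ereal ((1 + e) * (N + \<eta> i + 2 * K * M * t i) * t i)"
    by (meson ereal_less_eq(3) order_trans)
  also have "\<dots> \<le> ereal (y * t i)" using i(4) t[of i] by simp
  finally have "riem_setdist A g \<Omega> q / ereal (t i) \<le> ereal (y * t i) / ereal (t i)"
    by (rule ereal_divide_right_mono) (use t in simp)
  also have "\<dots> = ereal y" using t[of i] by simp
  finally have "?F (v, t i) \<le> ereal y"
    by (simp add: q_def riem_setdist_self[OF p])
  then show False using P(3)[OF P1v i(5)] by simp
qed

text \<open>If the derivative were below \<open>y < y2 < ?D\<close>, then points
  \<open>exp_p (t w)\<close> with \<open>w\<close> near \<open>v\<close> and \<open>t\<close> small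
  would have nearly closest points in \<Omega> of the form \<open>exp_p (t u)\<close>. A limit of
  such \<open>u\<close> would lie in the cone at distance at most \<open>y2\<close> from
  \<open>v\<close>.\<close>

lemma contingent_deriv_ge:
  assumes cpt: "\<And>(a::'e) r. compact (cball a r)"
    and p: "p \<in> \<Omega>" and v: "v \<in> tangent_space A p"
  shows "tangent_setdist g p (contingent_cone A g \<Omega> p) v
    \<le> contingent_deriv A g (riem_setdist A g \<Omega>) p v"
proof (rule ccontr)
  let ?D = "tangent_setdist g p (contingent_cone A g \<Omega> p) v"
  let ?F = "\<lambda>(w, t). (riem_setdist A g \<Omega> (riem_exp A g p (tangent_scale t w))
      - riem_setdist A g \<Omega> p) / ereal t"
  assume "\<not> ?D \<le> contingent_deriv A g (riem_setdist A g \<Omega>) p v"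
  then obtain y where y: "contingent_deriv A g (riem_setdist A g \<Omega>) p v < ereal y" "ereal y < ?D"
    using ereal_dense2 by (metis not_le)
  obtain y2 where y2: "ereal y < ereal y2" "ereal y2 < ?D"
    using ereal_dense2[OF y(2)] by blast
  have freq: "\<exists>w t. w \<in> tangent_space A p \<and> tangent_norm g p (tangent_minus w v) < \<eta> \<and> 0 < t \<and> t < \<eta> \<and>
      riem_setdist A g \<Omega> (riem_exp A g p (tangent_scale t w)) < ereal (y * t)" if \<eta>: "\<eta> > 0" for \<eta>
  proof (rule ccontr)
    assume no: "\<not> ?thesis"
    have "eventually (\<lambda>z. ereal y \<le> ?F z) (tangent_nhds A g p v \<times>\<^sub>F at_right 0)"
      unfolding eventually_prod_filter
    proof (intro exI conjI allI impI)
      show "eventually (\<lambda>w. w \<in> tangent_space A p \<and> tangent_norm g p (tangent_minus w v) < \<eta>) (tangent_nhds A g p v)"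
        by (rule eventually_tangent_nhds[OF \<eta>])
      show "eventually (\<lambda>t. t \<in> {0<..<\<eta>}) (at_right 0)"
        by (rule eventually_at_right_real[OF \<eta>])
      fix w t assume w: "w \<in> tangent_space A p \<and> tangent_norm g p (tangent_minus w v) < \<eta>" and t: "t \<in> {0<..<\<eta>}"
      have "ereal (y * t) \<le> riem_setdist A g \<Omega> (riem_exp A g p (tangent_scale t w))"
        using no w t by (metis greaterThanLessThan_iff not_le)
      then have "ereal (y * t) / ereal t \<le> riem_setdist A g \<Omega> (riem_exp A g p (tangent_scale t w)) / ereal t"
        by (rule ereal_divide_right_mono) (use t in simp)
      moreover have "ereal (y * t) / ereal t = ereal y" using t by simp
      ultimately show "ereal y \<le> ?F (w, t)" by (simp add: riem_setdist_self[OF p])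
    qed
    then have "ereal y \<le> contingent_deriv A g (riem_setdist A g \<Omega>) p v"
      unfolding contingent_deriv_def by (rule Liminf_bounded)
    then show False using y(1) by simp
  qed
  \<comment> \<open>Distances are nonnegative, so a value of the quotient below \<open>y\<close>
    forces \<open>y\<close> to be positive; the factor \<open>1 - e = y / y2\<close> chosen below is
    then positive.\<close>
  have y0: "y > 0"
  proof -
    obtain w t where t: "0 < t" "riem_setdist A g \<Omega> (riem_exp A g p (tangent_scale t w)) < ereal (y * t)"
      using freq[OF zero_less_one] by blast
    have "0 < ereal (y * t)" by (rule le_less_trans[OF riem_setdist_nonneg t(2)])
    then show ?thesis using t(1) by (simp add: zero_less_mult_iff)
  qed
  have yy: "y < y2" using y2(1) by simp
  \<comment> \<open>The loss \<open>1 / (1 - e)\<close> in the comparison of length with the norm at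
    \<open>p\<close> turns the bound \<open>y\<close> exactly into \<open>y2\<close>.\<close>
  define e where "e = 1 - y / y2"
  have e: "0 < e" "e < 1" "1 - e = y / y2" using y0 yy by (auto simp: e_def)
  obtain c where c: "c \<in> A" "p \<in> fst c" by (rule cover)
  define x0 where "x0 = snd c p"
  have x0: "x0 \<in> snd c ` fst c" using c by (simp add: x0_def)
  note tri = cnorm_triangle[OF c(1) x0]
  obtain k K where k: "k > 0" "K > 0" "\<And>a. k * norm a \<le> cnorm c x0 a" "\<And>a. cnorm c x0 a \<le> K * norm a"
    by (rule cnorm_equiv[OF c(1) x0]) (rule that)
  obtain r where r: "r > 0"
    and short: "\<And>\<gamma>. piecewise_C1_curve A \<gamma> \<Longrightarrow> \<gamma> 0 \<in> fst c \<Longrightarrow> dist x0 (snd c (\<gamma> 0)) < r \<Longrightarrow>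
      curve_length A g \<gamma> < r \<Longrightarrow> \<gamma> 1 \<in> fst c \<and>
      (1 - e) * cnorm c x0 (snd c (\<gamma> 1) - snd c (\<gamma> 0)) \<le> curve_length A g \<gamma>"
    by (rule short_curve_stays_near[OF c e(1,2) cpt, folded x0_def]) (rule that)
  \<comment> \<open>\<open>R / 2\<close> bounds the direction \<open>z\<close> constructed below:
    \<open>norm (w c)\<close> is at most \<open>norm (v c) + 1 / k\<close>, and \<open>z\<close>
    differs from \<open>w c\<close> by at most \<open>y2 / k + 1\<close>.\<close>
  define R where "R = 2 * (y2 / k + norm (v c) + 1 / k + 1)"
  have R: "R > 0" using k(1) y0 yy by (auto simp: R_def intro!: add_nonneg_pos)
  obtain \<delta> M where \<delta>: "\<delta> > 0" "M > 0"
    and ex: "\<And>t w. 0 < t \<Longrightarrow> t < \<delta> \<Longrightarrow> w \<in> tangent_space A p \<Longrightarrow> norm (w c) \<le> R \<Longrightarrow>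
       riem_exp A g p (tangent_scale t w) \<in> fst c \<and>
       norm (snd c (riem_exp A g p (tangent_scale t w)) - x0 - t *\<^sub>R w c) \<le> M * t\<^sup>2"
    and surj: "\<And>t z. 0 < t \<Longrightarrow> t < \<delta> \<Longrightarrow> norm z \<le> R/2 \<Longrightarrow>
       \<exists>w\<in>tangent_space A p. norm (w c) \<le> R \<and> norm (w c - z) \<le> M * t \<and>
         riem_exp A g p (tangent_scale t w) = chart_inv c (x0 + t *\<^sub>R z)"
    by (rule exp_chart[OF c R, folded x0_def]) (rule that)
  \<comment> \<open>In order: the range of \<open>exp_chart\<close>; \<open>w\<close> within metric
    distance 1 of \<open>v\<close>; \<open>M * t < 1\<close>; curves shorter than \<open>r\<close>;
    starting points within \<open>r\<close> of \<open>x0\<close>.\<close>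
  define \<eta>0 where "\<eta>0 = min (min \<delta> 1) (min (1 / M) (min (r / y2) (r / (1 + R))))"
  have \<eta>0: "\<eta>0 > 0" using \<delta> r R y0 yy by (auto simp: \<eta>0_def)
  have approx: "\<exists>t u. 0 < t \<and> t < \<eta> \<and> u \<in> tangent_space A p \<and> norm (u c) \<le> R \<and>
      riem_exp A g p (tangent_scale t u) \<in> \<Omega> \<and> cnorm c x0 (v c - u c) \<le> y2 + \<eta> * (1 + 2 * K * M)"
    if \<eta>: "\<eta> > 0" for \<eta>
  proof -
    obtain w t where w: "w \<in> tangent_space A p" "tangent_norm g p (tangent_minus w v) < min \<eta> \<eta>0"
      and t: "0 < t" "t < min \<eta> \<eta>0"
      and d: "riem_setdist A g \<Omega> (riem_exp A g p (tangent_scale t w)) < ereal (y * t)"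
      using freq[of "min \<eta> \<eta>0"] \<eta> \<eta>0 by auto
    have t1: "t < \<delta>" "t < 1" "M * t < 1" "t * y2 < r" "t * (1 + R) < r"
      using t \<delta> y0 yy R by (auto simp: \<eta>0_def field_simps)
    have wv: "cnorm c x0 (w c - v c) < min \<eta> 1"
      using w(2) tangent_norm_diff[OF c w(1) v] by (simp add: x0_def \<eta>0_def)
    have wR: "norm (w c) \<le> norm (v c) + 1 / k"
    proof -
      have "k * norm (w c - v c) < 1" using k(3)[of "w c - v c"] wv by linarith
      then have "norm (w c - v c) < 1 / k" using k(1) by (simp add: field_simps)
      then show ?thesis using norm_triangle_sub[of "w c" "v c"] by linarith
    qed
    have R2: "norm (w c) + y2 / k + 1 \<le> R / 2" proof -
      have "R / 2 = y2 / k + norm (v c) + 1 / k + 1" unfolding R_def by simp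
      then show ?thesis using wR by linarith
    qed
    have "0 \<le> y2 / k" using y0 yy k(1) by simp
    then have wR': "norm (w c) \<le> R" using R2 R by linarith
    define q where "q = riem_exp A g p (tangent_scale t w)"
    have q: "q \<in> fst c" "norm (snd c q - x0 - t *\<^sub>R w c) \<le> M * t\<^sup>2"
      using ex[OF t(1) t1(1) w(1) wR'] by (auto simp: q_def)
    have Mt: "M * t\<^sup>2 \<le> t" using t1(3) t(1) by (simp add: power2_eq_square)
    have qr: "dist x0 (snd c q) < r"
    proof -
      have "norm (snd c q - x0) \<le> norm (snd c q - x0 - t *\<^sub>R w c) + norm (t *\<^sub>R w c)"
        using norm_triangle_sub[of "snd c q - x0" "t *\<^sub>R w c"] by simp
      also have "norm (t *\<^sub>R w c) \<le> t * R" using wR' t(1) by simp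
      finally show ?thesis using q(2) Mt t1(5) by (simp add: dist_norm norm_minus_commute distrib_left)
    qed
    obtain \<gamma> where \<gamma>: "piecewise_C1_curve A \<gamma>" "\<gamma> 0 = q" "\<gamma> 1 \<in> \<Omega>" "curve_length A g \<gamma> < y * t"
      using d unfolding q_def[symmetric] by (rule riem_setdist_less)
    have "y * t < r"
      using t1(4) mult_strict_right_mono[OF yy t(1)] unfolding mult.commute[of t] by linarith
    then have a: "\<gamma> 1 \<in> fst c" "(1 - e) * cnorm c x0 (snd c (\<gamma> 1) - snd c q) \<le> curve_length A g \<gamma>"
      using short[OF \<gamma>(1)] \<gamma> q(1) qr by auto
    define a where "a = \<gamma> 1"
    have "y / y2 * cnorm c x0 (snd c a - snd c q) < y * t"
      using a(2) \<gamma>(4) by (simp add: e(3) a_def)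
    then have aq: "cnorm c x0 (snd c a - snd c q) \<le> y2 * t"
      using y0 yy by (simp add: field_simps)
    \<comment> \<open>Coordinate direction from \<open>p\<close> to the nearby point
      \<open>a\<close> of \<Omega>, rescaled by \<open>t\<close>. Surjectivity of the exponential
      map replaces it by a tangent vector \<open>u\<close> with \<open>a = exp_p (t u)\<close>, at
      the cost of \<open>M * t\<close>.\<close>
    define z where "z = (1/t) *\<^sub>R (snd c a - x0)"
    have tz: "x0 + t *\<^sub>R z = snd c a" using t(1) by (simp add: z_def)
    define b where "b = snd c q - x0 - t *\<^sub>R w c"
    have zw: "z - w c = (1/t) *\<^sub>R ((snd c a - snd c q) + b)"
      using t(1) by (simp add: z_def b_def algebra_simps)
    have "norm (snd c a - snd c q) \<le> y2 * t / k"
      using k(3)[of "snd c a - snd c q"] aq k(1) by (simp add: field_simps)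
    then have "norm ((snd c a - snd c q) + b) \<le> y2 * t / k + t"
      using norm_triangle_ineq[of "snd c a - snd c q" b] q(2) Mt by (simp add: b_def)
    then have "norm (z - w c) \<le> (1/t) * (y2 * t / k + t)"
      unfolding zw norm_scaleR using t(1) by (simp add: divide_right_mono)
    also have "\<dots> = y2 / k + 1" using t(1) by (simp add: field_simps)
    finally have zR: "norm z \<le> R / 2"
      using norm_triangle_sub[of z "w c"] R2 by linarith
    obtain u where u: "u \<in> tangent_space A p" "norm (u c) \<le> R" "norm (u c - z) \<le> M * t"
      "riem_exp A g p (tangent_scale t u) = chart_inv c (snd c a)"
      using surj[OF t(1) t1(1) zR] unfolding tz by blast
    have "cnorm c x0 (z - w c) \<le> y2 + K * M * t"
    proof -
      have "cnorm c x0 ((snd c a - snd c q) + b) \<le> y2 * t + K * (M * t\<^sup>2)"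
        using tri[of "snd c a - snd c q" b] aq k(4)[of b] mult_left_mono[OF q(2)[folded b_def], of K] k(2)
        by linarith
      then have "(1/t) * cnorm c x0 ((snd c a - snd c q) + b) \<le> (1/t) * (y2 * t + K * (M * t\<^sup>2))"
        using t(1) by (intro mult_left_mono) auto
      also have "\<dots> = y2 + K * M * t" using t(1) by (simp add: field_simps power2_eq_square)
      finally show ?thesis unfolding zw cnorm_scale using t(1) by simp
    qed
    moreover have "cnorm c x0 (u c - z) \<le> K * M * t"
      using k(4)[of "u c - z"] mult_left_mono[OF u(3), of K] k(2)
      unfolding mult.assoc by linarith
    moreover have "cnorm c x0 (v c - u c) \<le> cnorm c x0 (w c - v c) + cnorm c x0 (z - w c) + cnorm c x0 (u c - z)"
      using tri[of "u c - z" "z - w c"] tri[of "u c - w c" "w c - v c"]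
      by (simp add: cnorm_minus_commute[of c x0 "v c"])
    moreover have "K * M * t \<le> K * M * \<eta>" using t k(2) \<delta>(2) by (intro mult_left_mono) auto
    ultimately have "cnorm c x0 (v c - u c) \<le> y2 + \<eta> * (1 + 2 * K * M)"
      using wv by (simp add: algebra_simps)
    moreover have "riem_exp A g p (tangent_scale t u) \<in> \<Omega>"
      using u(4) \<gamma>(3) a(1) by (simp add: a_def chart_inv_chart[OF c(1)])
    ultimately show ?thesis
      using t u(1,2) by (intro exI[of _ t] exI[of _ u]) simp
  qed
  define h where "h n = inverse (real (Suc n))" for n
  have h: "h n > 0" for n by (simp add: h_def)
  have h0: "h \<longlonglongrightarrow> 0" unfolding h_def by (rule LIMSEQ_inverse_real_of_nat)
  have "\<forall>n. \<exists>t u. 0 < t \<and> t < h n \<and> u \<in> tangent_space A p \<and> norm (u c) \<le> R \<and>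
      riem_exp A g p (tangent_scale t u) \<in> \<Omega> \<and> cnorm c x0 (v c - u c) \<le> y2 + h n * (1 + 2 * K * M)"
    using approx[OF h] by blast
  then obtain t u where tu: "\<And>n. 0 < t n" "\<And>n. t n < h n" "\<And>n. u n \<in> tangent_space A p"
    "\<And>n. norm (u n c) \<le> R" "\<And>n. riem_exp A g p (tangent_scale (t n) (u n)) \<in> \<Omega>"
    "\<And>n. cnorm c x0 (v c - u n c) \<le> y2 + h n * (1 + 2 * K * M)"
    by metis
  have "\<forall>n. u n c \<in> cball 0 R" using tu(4) by simp
  \<comment> \<open>Compactness of balls in the model space provides the limit direction, and
    continuity of the norm keeps it within \<open>y2\<close> of \<open>v\<close>.\<close>
  then obtain u0 s where s: "strict_mono s" "((\<lambda>n. u n c) \<circ> s) \<longlonglongrightarrow> u0"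
    using cpt[of 0 R] unfolding compact_def by meson
  have us: "(\<lambda>n. u (s n) c) \<longlonglongrightarrow> u0" using s(2) by (simp add: comp_def)
  have hs: "(\<lambda>n. h (s n)) \<longlonglongrightarrow> 0"
    using LIMSEQ_subseq_LIMSEQ[OF h0 s(1)] by (simp add: comp_def)
  define w where "w = coord_tangent A c p u0"
  have wT: "w \<in> tangent_space A p" unfolding w_def by (rule coord_tangent_in[OF c])
  have wc: "w c = u0" by (simp add: w_def c)
  have cn: "(\<lambda>n. cnorm c x0 (f n)) \<longlonglongrightarrow> cnorm c x0 l" if "f \<longlonglongrightarrow> l" for f l
    unfolding cnorm_def by (intro tendsto_intros that)
  have "w \<in> contingent_cone A g \<Omega> p"
    unfolding contingent_cone_def
  proof (intro CollectI conjI wT exI)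
    show "\<forall>n. u (s n) \<in> tangent_space A p \<and> t (s n) > 0 \<and>
        riem_exp A g p (tangent_scale (t (s n)) (u (s n))) \<in> \<Omega>"
      using tu by blast
    show "(\<lambda>n. t (s n)) \<longlonglongrightarrow> 0"
      by (rule real_tendsto_sandwich[OF _ _ tendsto_const hs])
        (use tu(1,2) in \<open>auto intro!: always_eventually less_imp_le\<close>)
    have "(\<lambda>n. cnorm c x0 (u (s n) c - u0)) \<longlonglongrightarrow> cnorm c x0 (u0 - u0)"
      by (intro cn tendsto_intros us)
    then show "(\<lambda>n. tangent_norm g p (tangent_minus (u (s n)) w)) \<longlonglongrightarrow> 0"
      unfolding tangent_norm_diff[OF c tu(3) wT] by (simp add: wc x0_def cnorm_def)
  qed
  then have "?D \<le> ereal (tangent_norm g p (tangent_minus v w))"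
    unfolding tangent_setdist_def by (rule INF_lower)
  also have "tangent_norm g p (tangent_minus v w) = cnorm c x0 (v c - u0)"
    using tangent_norm_diff[OF c v wT] by (simp add: wc x0_def)
  also have "ereal (cnorm c x0 (v c - u0)) \<le> ereal y2"
  proof -
    have "(\<lambda>n. cnorm c x0 (v c - u (s n) c)) \<longlonglongrightarrow> cnorm c x0 (v c - u0)"
      by (intro cn tendsto_intros us)
    moreover have "(\<lambda>n. y2 + h (s n) * (1 + 2 * K * M)) \<longlonglongrightarrow> y2 + 0 * (1 + 2 * K * M)"
      by (intro tendsto_intros hs)
    ultimately have "cnorm c x0 (v c - u0) \<le> y2 + 0 * (1 + 2 * K * M)"
      by (rule LIMSEQ_le) (use tu(6) in blast)
    then show ?thesis by simp
  qed
  finally show False using y2(2) by simp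
qed

end

theorem theorem4p2:
  fixes A :: "('m::t2_space, 'e::{real_inner, complete_space}) chart set"
    and g :: "('m, 'e) metric"
    and \<Omega> :: "'m set" and p :: 'm
  assumes "riemannian_manifold A g"
    and "p \<in> \<Omega>"
  shows "(\<forall>v\<in>tangent_space A p.
            contingent_deriv A g (riem_setdist A g \<Omega>) p v
              \<le> tangent_setdist g p (contingent_cone A g \<Omega> p) v) \<and>
         ((\<exists>B :: 'e set. finite B \<and> span B = UNIV) \<longrightarrow>
          (\<forall>v\<in>tangent_space A p.
            contingent_deriv A g (riem_setdist A g \<Omega>) p v
              = tangent_setdist g p (contingent_cone A g \<Omega> p) v))"
proof -
  interpret riem A g by standard (rule assms(1))
  have le: "contingent_deriv A g (riem_setdist A g \<Omega>) p v
      \<le> tangent_setdist g p (contingent_cone A g \<Omega> p) v" if "v \<in> tangent_space A p" for v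
    unfolding tangent_setdist_def by (rule INF_greatest) (rule contingent_deriv_le[OF assms(2) that])
  have ge: "tangent_setdist g p (contingent_cone A g \<Omega> p) v
      \<le> contingent_deriv A g (riem_setdist A g \<Omega>) p v"
    if "finite B" "span B = UNIV" "v \<in> tangent_space A p" for v and B :: "'e set"
    by (rule contingent_deriv_ge[OF compact_cball_finite_dimensional[OF that(1,2)] assms(2) that(3)])
  show ?thesis
  proof (intro conjI ballI impI)
    fix v assume v: "v \<in> tangent_space A p"
    show "contingent_deriv A g (riem_setdist A g \<Omega>) p v
      \<le> tangent_setdist g p (contingent_cone A g \<Omega> p) v" by (rule le[OF v])
    assume "\<exists>B :: 'e set. finite B \<and> span B = UNIV"
    then obtain B :: "'e set" where "finite B" "span B = UNIV" by blast
    from ge[OF this v] le[OF v]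
    show "contingent_deriv A g (riem_setdist A g \<Omega>) p v
      = tangent_setdist g p (contingent_cone A g \<Omega> p) v" by (rule antisym[rotated])
  qed
qed

end
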